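(* The operator $\tilde A_m:M'\to M$ (with values in the completion of $M$) factors as $$\tilde A_m:\ M'\xrightarrow{\ g\ }M'\xrightarrow{\ \Phi_m\ }M\otimes V\xrightarrow{\ \mathrm{Id}\otimes\mathrm{ev}\ }M,$$ where $M'\xrightarrow{\Phi_m}M\otimes V$ is the $\widehat{\mathfrak{gl}}_n$-intertwiner (unique up to a constant multiple, suitably normalized) and $\mathrm{ev}:V\to\mathbb C$ is the linear map given by evaluation at $y_1=\dots=y_n=1$.
   Context: Let $n\ge2$; $\mathbb N=\{1,2,\dots\}$ in the case distinctions below. **Lie algebra.** $\widehat{\mathfrak{gl}}_n=\mathfrak{gl}_n[z,z^{-1}]\oplus\mathbb C\gamma$ with $\gamma$ central and $[Xz^k,Yz^l]=[X,Y]z^{k+l}+\delta_{k+l}^0k\,\mathrm{Tr}(XY)\gamma$. For integers $i\ne j$ put $E_{ij}=E_{\bar i\bar j}z^{\lfloor\frac{j-1}n\rfloor-\lfloor\frac{i-1}n\rfloor}$, where $\bar i\in\{1,\dots,n\}$ is the residue of $i$ mod $n$ and the $E_{\bar i\bar j}$ on the right are elementary matrices; and put $E_{ii}=E_{\bar i\bar i}-\gamma\lfloor\frac{i-1}n\rfloor$. **Verma modules.** $M$ is the Verma module freely generated over $U(\langle E_{ij}\rangle_{i<j})$ by a vector $v$ with $E_{ji}v=0$ for $i<j$, $E_{kk}v=(a_k-k)v$ for $1\le k\le n$, $\gamma v=(n+p)v$, with generic parameters $a_1,\dots,a_n,p$. It is $\mathbb N^n$-graded (with $0$ included in degrees), $E_{ij}$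 for $i<j$ having degree $\sum_{a=i}^{j-1}\varsigma^{\bar a}$ with $\varsigma^r$ the standard basis vectors. $M'$ is the analogous module with generic parameters $a_1',\dots,a_n'$ (same $p$) and generator $v'$. **The operator $\tilde A_m$.** It is the operator on Verma modules induced by the cohomological Ext operator on affine Laumon spaces (whose equivariant cohomology is isomorphic to $M$). It is characterized, and may be taken as defined, as the unique linear map from $M'$ to the completion (product of graded pieces) of $M$ with $\tilde A_mv'=v+(\text{terms of higher degree})$ and, for all $i,j\in\mathbb Z$, $$(E_{ij}+E_{i+1,j})\tilde A_m=\tilde A_m(E_{ij}+E_{i,j-1}+\alpha_{i-j}m),$$ where $\alpha_k=1$ if $k\in\{0,-1\}$; $\alpha_k=(-1)^{ns-1}\frac np$ if $k=ns$ or $k=ns-1$ with $s>0$; and $\alpha_k=0$ otherwise. **The element $g$.** $g=\mathrm{Id}+\sum_{i=1}^nE_{i+1,i}$ as an element of the group of invertible matrices over $\mathbb C[z^{-1}]$, acting on $M'$ by $$g=\exp\Big(\sum_{1\le i\le n,\ j>i}\frac{(-1)^{j-i-1}}{j-i}E_{ji}\Big)$$ (well-defined, since each vector of $M'$ is killed by all sufficiently long products/large-degree elements of the $E_{ji}$, $i<j$). **The module $V$.** $V$ has basis the symbols $y_1^{b_1}\cdots y_n^{b_n}$, $b_i\in\mathbb C$, with $\gamma\mapsto0$ and $$E_{ij}\mapsto(-1)^{i-j}y_{\bar i}\frac{\partial}{\partial y_{\bar j}}-m\cdot\mathrm{Id}\cdot\begin{cases}1&i=j\\(-1)^{i-j-1}\frac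 np&i-j\in n\mathbb N\\0&\text{otherwise.}\end{cases}$$ An intertwiner $\Phi_m$ necessarily sends $v'\mapsto\alpha\,v\otimes y_1^{a_1'-a_1+m}\cdots y_n^{a_n'-a_n+m}+(\text{terms with first factor of higher degree})$ for some scalar $\alpha$, which determines it; $M\otimes V$ is understood as completed with respect to the grading of $M$. The normalization is $\alpha=1$. The map $\mathrm{ev}$ sends every basis symbol to $1$. *)

theory Defs
  imports Complex_Main "HOL-Library.Poly_Mapping"
begin

section \<open>Formal linear combinations\<close>

definition smul :: "complex \<Rightarrow> ('k \<Rightarrow>\<^sub>0 complex) \<Rightarrow> ('k \<Rightarrow>\<^sub>0 complex)" where
  "smul c = Poly_Mapping.map ((*) c)"

section \<open>The affine Lie algebra\<close>

text \<open>\<open>Loop k a b\<close> stands for the elementary matrix \<open>E\<^sub>a\<^sub>b\<close> times \<open>z\<^sup>k\<close> (with \<open>a, b \<in> {1..n}\<close>), and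
  \<open>Gam\<close> for the central element \<open>\<gamma>\<close>.\<close>

datatype aff_basis = Loop int nat nat | Gam

type_synonym affgl = "aff_basis \<Rightarrow>\<^sub>0 complex"

definition affgl :: "nat \<Rightarrow> affgl set" where
  "affgl n = {X. \<forall>k a b. Loop k a b \<in> Poly_Mapping.keys X \<longrightarrow> a \<in> {1..n} \<and> b \<in> {1..n}}"

definition gam :: affgl where
  "gam = Poly_Mapping.single Gam 1"

text \<open>Elementary matrices satisfy \<open>E\<^sub>a\<^sub>b E\<^sub>c\<^sub>d = \<delta>\<^sub>b\<^sub>c E\<^sub>a\<^sub>d\<close> and \<open>Tr (E\<^sub>a\<^sub>b E\<^sub>c\<^sub>d) = \<delta>\<^sub>b\<^sub>c \<delta>\<^sub>a\<^sub>d\<close>.\<close>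

fun basis_bracket :: "aff_basis \<Rightarrow> aff_basis \<Rightarrow> affgl" where
  "basis_bracket (Loop k a b) (Loop l c d) =
     (if b = c then Poly_Mapping.single (Loop (k + l) a d) 1 else 0)
   - (if d = a then Poly_Mapping.single (Loop (k + l) c b) 1 else 0)
   + (if k + l = 0 \<and> b = c \<and> a = d then Poly_Mapping.single Gam (of_int k) else 0)"
| "basis_bracket Gam y = 0"
| "basis_bracket x Gam = 0"

definition bracket :: "affgl \<Rightarrow> affgl \<Rightarrow> affgl" where
  "bracket X Y = (\<Sum>x\<in>Poly_Mapping.keys X. \<Sum>y\<in>Poly_Mapping.keys Y. smul (Poly_Mapping.lookup X x * Poly_Mapping.lookup Y y) (basis_bracket x y))"

definition res :: "nat \<Rightarrow> int \<Rightarrow> nat" where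
  "res n i = nat ((i - 1) mod int n) + 1"

text \<open>\<open>div\<close> on integers rounds down.\<close>

definition E :: "nat \<Rightarrow> int \<Rightarrow> int \<Rightarrow> affgl" where
  "E n i j =
     (if i = j
      then Poly_Mapping.single (Loop 0 (res n i) (res n i)) 1
           - Poly_Mapping.single Gam (of_int ((i - 1) div int n))
      else Poly_Mapping.single
             (Loop ((j - 1) div int n - (i - 1) div int n) (res n i) (res n j)) 1)"

text \<open>The degree of \<open>E n i j\<close> for arbitrary \<open>i, j\<close>. One of the two sets is empty, so this is
  \<open>\<Sum>a=i..j-1. \<sigma>\<^sup>a\<close> for \<open>i < j\<close> and its negative counterpart for \<open>i > j\<close>. Degrees are functions that
  vanish outside \<open>{1..n}\<close>.\<close>

definition edeg :: "nat \<Rightarrow> int \<Rightarrow> int \<Rightarrow> nat \<Rightarrow> int" where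
  "edeg n i j r = int (card {a \<in> {i..<j}. res n a = r}) - int (card {a \<in> {j..<i}. res n a = r})"

text \<open>\<open>E\<^sub>a\<^sub>b z\<^sup>k\<close> is \<open>E n a (b + n k)\<close> for \<open>a, b \<in> {1..n}\<close>.\<close>

fun basis_deg :: "nat \<Rightarrow> aff_basis \<Rightarrow> nat \<Rightarrow> int" where
  "basis_deg n (Loop k a b) = edeg n (int a) (int b + int n * k)"
| "basis_deg n Gam = (\<lambda>_. 0)"

locale affgl_module = vector_space scale
  for scale :: "complex \<Rightarrow> 'a::ab_group_add \<Rightarrow> 'a" +
  fixes n :: nat and act :: "affgl \<Rightarrow> 'a \<Rightarrow> 'a"
  assumes act_linear: "X \<in> affgl n \<Longrightarrow> Vector_Spaces.linear scale scale (act X)"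
    and act_add: "\<lbrakk>X \<in> affgl n; Y \<in> affgl n\<rbrakk> \<Longrightarrow> act (X + Y) w = act X w + act Y w"
    and act_smul: "X \<in> affgl n \<Longrightarrow> act (smul c X) w = scale c (act X w)"
    and act_bracket: "\<lbrakk>X \<in> affgl n; Y \<in> affgl n\<rbrakk>
      \<Longrightarrow> act (bracket X Y) w = act X (act Y w) - act Y (act X w)"

section \<open>Freely generated modules over an enveloping algebra\<close>

text \<open>For a Lie subalgebra \<open>L\<close>, the enveloping algebra \<open>U(L)\<close> is presented as the quotient of the free
  associative algebra on the set \<open>L\<close> (formal combinations of words) by the two-sided ideal
  \<open>env_ideal L\<close>, whose generators make the letters linear and identify \<open>xy - yx\<close> with the bracket.\<close>

inductive_set env_ideal :: "affgl set \<Rightarrow> (affgl list \<Rightarrow>\<^sub>0 complex) set"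
  for L :: "affgl set" where
  zero: "0 \<in> env_ideal L"
| sum: "\<lbrakk>P \<in> env_ideal L; Q \<in> env_ideal L\<rbrakk> \<Longrightarrow> P + Q \<in> env_ideal L"
| add_rel: "\<lbrakk>u \<in> lists L; w \<in> lists L; x \<in> L; y \<in> L\<rbrakk> \<Longrightarrow>
    Poly_Mapping.single (u @ [x + y] @ w) c - Poly_Mapping.single (u @ [x] @ w) c
      - Poly_Mapping.single (u @ [y] @ w) c \<in> env_ideal L"
| smul_rel: "\<lbrakk>u \<in> lists L; w \<in> lists L; x \<in> L\<rbrakk> \<Longrightarrow>
    Poly_Mapping.single (u @ [smul k x] @ w) c - Poly_Mapping.single (u @ [x] @ w) (c * k)
      \<in> env_ideal L"
| bracket_rel: "\<lbrakk>u \<in> lists L; w \<in> lists L; x \<in> L; y \<in> L\<rbrakk> \<Longrightarrow>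
    Poly_Mapping.single (u @ [x, y] @ w) c - Poly_Mapping.single (u @ [y, x] @ w) c
      - Poly_Mapping.single (u @ [bracket x y] @ w) c \<in> env_ideal L"

definition env_act ::
  "(complex \<Rightarrow> 'a::ab_group_add \<Rightarrow> 'a) \<Rightarrow> (affgl \<Rightarrow> 'a \<Rightarrow> 'a) \<Rightarrow> (affgl list \<Rightarrow>\<^sub>0 complex) \<Rightarrow> 'a \<Rightarrow> 'a"
where
  "env_act scale act P v = (\<Sum>w\<in>Poly_Mapping.keys P. scale (Poly_Mapping.lookup P w) (foldr act w v))"

text \<open>The map \<open>U(L) \<rightarrow> M\<close>, \<open>u \<mapsto> u v\<close>, is surjective and injective.\<close>

definition freely_generated ::
  "(complex \<Rightarrow> 'a::ab_group_add \<Rightarrow> 'a) \<Rightarrow> (affgl \<Rightarrow> 'a \<Rightarrow> 'a) \<Rightarrow> affgl set \<Rightarrow> 'a \<Rightarrow> bool" where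
  "freely_generated scale act L v \<longleftrightarrow>
     (\<forall>w. \<exists>P. Poly_Mapping.keys P \<subseteq> lists L \<and> env_act scale act P v = w) \<and>
     (\<forall>P. Poly_Mapping.keys P \<subseteq> lists L \<longrightarrow> env_act scale act P v = 0 \<longrightarrow> P \<in> env_ideal L)"

section \<open>Verma modules\<close>

inductive_set nplus :: "nat \<Rightarrow> affgl set" for n :: nat where
  gen: "i < j \<Longrightarrow> E n i j \<in> nplus n"
| add: "\<lbrakk>X \<in> nplus n; Y \<in> nplus n\<rbrakk> \<Longrightarrow> X + Y \<in> nplus n"
| smul: "X \<in> nplus n \<Longrightarrow> smul c X \<in> nplus n"
| bracket: "\<lbrakk>X \<in> nplus n; Y \<in> nplus n\<rbrakk> \<Longrightarrow> bracket X Y \<in> nplus n"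

locale verma = affgl_module scale n act
  for scale :: "complex \<Rightarrow> 'a::ab_group_add \<Rightarrow> 'a" and n act +
  fixes v :: 'a and a :: "nat \<Rightarrow> complex" and p :: complex
  assumes free: "freely_generated scale act (nplus n) v"
    and lower: "i < j \<Longrightarrow> act (E n j i) v = 0"
    and weight: "k \<in> {1..n} \<Longrightarrow> act (E n (int k) (int k)) v = scale (a k - of_nat k) v"
    and level: "act gam v = scale (of_nat n + p) v"

text \<open>Algebraic independence over the rationals; elements of \<open>(nat \<Rightarrow>\<^sub>0 nat) \<Rightarrow>\<^sub>0 rat\<close> are polynomials
  in variables indexed by natural numbers.\<close>

definition alg_independent :: "nat set \<Rightarrow> (nat \<Rightarrow> complex) \<Rightarrow> bool" where
  "alg_independent I x \<longleftrightarrow>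
     (\<forall>P :: (nat \<Rightarrow>\<^sub>0 nat) \<Rightarrow>\<^sub>0 rat.
        (\<forall>e\<in>Poly_Mapping.keys P. Poly_Mapping.keys e \<subseteq> I) \<longrightarrow>
        (\<Sum>e\<in>Poly_Mapping.keys P. of_rat (Poly_Mapping.lookup P e) * (\<Prod>i\<in>Poly_Mapping.keys e. x i ^ Poly_Mapping.lookup e i)) = 0 \<longrightarrow> P = 0)"

text \<open>Genericity of the parameters \<open>a\<^sub>1, \<dots>, a\<^sub>n, p\<close>: no polynomial relation over the rationals.\<close>

definition generic :: "nat \<Rightarrow> (nat \<Rightarrow> complex) \<Rightarrow> complex \<Rightarrow> bool" where
  "generic n a p \<longleftrightarrow> alg_independent {0..n} (a(0 := p))"

text \<open>The homogeneous pieces of a Verma module. They are indexed by all integer degrees; pieces outside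
  of \<open>\<nat>\<^sup>n\<close> are zero because there are no words of such a degree.\<close>

definition piece ::
  "nat \<Rightarrow> (complex \<Rightarrow> 'a::ab_group_add \<Rightarrow> 'a) \<Rightarrow> (affgl \<Rightarrow> 'a \<Rightarrow> 'a) \<Rightarrow> 'a \<Rightarrow> (nat \<Rightarrow> int) \<Rightarrow> 'a set" where
  "piece n scale act v d = module.span scale
     {foldr act (map (\<lambda>(i, j). E n i j) ws) v | ws.
        (\<forall>(i, j) \<in> set ws. i < j) \<and> (\<forall>r. (\<Sum>(i, j)\<leftarrow>ws. edeg n i j r) = d r)}"

definition completion ::
  "nat \<Rightarrow> (complex \<Rightarrow> 'a::ab_group_add \<Rightarrow> 'a) \<Rightarrow> (affgl \<Rightarrow> 'a \<Rightarrow> 'a) \<Rightarrow> 'a \<Rightarrow> ((nat \<Rightarrow> int) \<Rightarrow> 'a) set" where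
  "completion n scale act v = {f. \<forall>d. f d \<in> piece n scale act v d}"

text \<open>Extension of an action to the completion: the homogeneous constituent of \<open>X\<close> of degree
  \<open>\<delta>\<close> contributes to the component of degree \<open>d\<close> through the component of degree \<open>d - \<delta>\<close>.\<close>

definition hat_act ::
  "nat \<Rightarrow> (affgl \<Rightarrow> 'a::ab_group_add \<Rightarrow> 'a) \<Rightarrow> affgl \<Rightarrow> ((nat \<Rightarrow> int) \<Rightarrow> 'a) \<Rightarrow> ((nat \<Rightarrow> int) \<Rightarrow> 'a)" where
  "hat_act n act X f = (\<lambda>d. \<Sum>x\<in>Poly_Mapping.keys X.
     act (Poly_Mapping.single x (Poly_Mapping.lookup X x)) (f (\<lambda>r. d r - basis_deg n x r)))"

section \<open>The operator \<open>A\<^sub>m\<close>\<close>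

definition alpha :: "nat \<Rightarrow> complex \<Rightarrow> int \<Rightarrow> complex" where
  "alpha n p k =
     (if k = 0 \<or> k = -1 then 1
      else if k > 0 \<and> int n dvd k then (-1) ^ nat (k - 1) * (of_nat n / p)
      else if k > 0 \<and> int n dvd k + 1 then (-1) ^ nat k * (of_nat n / p)
      else 0)"

definition is_A_op ::
  "nat \<Rightarrow> complex \<Rightarrow> complex
   \<Rightarrow> (complex \<Rightarrow> 'b::ab_group_add \<Rightarrow> 'b) \<Rightarrow> (affgl \<Rightarrow> 'b \<Rightarrow> 'b) \<Rightarrow> 'b
   \<Rightarrow> (complex \<Rightarrow> 'a::ab_group_add \<Rightarrow> 'a) \<Rightarrow> (affgl \<Rightarrow> 'a \<Rightarrow> 'a) \<Rightarrow> 'a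
   \<Rightarrow> ('b \<Rightarrow> (nat \<Rightarrow> int) \<Rightarrow> 'a) \<Rightarrow> bool" where
  "is_A_op n p m scale' act' v' scale act v A \<longleftrightarrow>
     (\<forall>d. Vector_Spaces.linear scale' scale (\<lambda>w. A w d)) \<and>
     (\<forall>w. A w \<in> completion n scale act v) \<and>
     A v' (\<lambda>_. 0) = v \<and>
     (\<forall>i j w d.
        hat_act n act (E n i j) (A w) d + hat_act n act (E n (i + 1) j) (A w) d
        = A (act' (E n i j) w + act' (E n i (j - 1)) w + scale' (alpha n p (i - j) * m) w) d)"

section \<open>The element \<open>g\<close>\<close>

text \<open>On each vector only finitely many terms of the sums below are nonzero (lowering operators);
  \<open>Sum_any\<close> is the sum over the nonzero terms.\<close>

definition log_g ::
  "nat \<Rightarrow> (complex \<Rightarrow> 'b::ab_group_add \<Rightarrow> 'b) \<Rightarrow> (affgl \<Rightarrow> 'b \<Rightarrow> 'b) \<Rightarrow> 'b \<Rightarrow> 'b" where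
  "log_g n scale act w = Sum_any (\<lambda>(i, j).
     if 1 \<le> i \<and> i \<le> int n \<and> i < j
     then scale ((-1) ^ nat (j - i - 1) / of_int (j - i)) (act (E n j i) w) else 0)"

definition g_op ::
  "nat \<Rightarrow> (complex \<Rightarrow> 'b::ab_group_add \<Rightarrow> 'b) \<Rightarrow> (affgl \<Rightarrow> 'b \<Rightarrow> 'b) \<Rightarrow> 'b \<Rightarrow> 'b" where
  "g_op n scale act w = Sum_any (\<lambda>k. scale (1 / fact k) ((log_g n scale act ^^ k) w))"

section \<open>The module \<open>V\<close>\<close>

text \<open>The basis symbol with exponents \<open>b\<^sub>1, \<dots>, b\<^sub>n\<close> is the function \<open>b\<close> (vanishing outside
  \<open>{1..n}\<close>); \<open>V\<close> consists of the finite formal combinations of these symbols.\<close>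

type_synonym exps = "nat \<Rightarrow> complex"

definition exps :: "nat \<Rightarrow> exps set" where
  "exps n = {b. \<forall>i. i \<notin> {1..n} \<longrightarrow> b i = 0}"

definition y_dy :: "nat \<Rightarrow> nat \<Rightarrow> exps \<Rightarrow> (exps \<Rightarrow>\<^sub>0 complex)" where
  "y_dy i j b =
     Poly_Mapping.single (\<lambda>r. b r + (if r = i then 1 else 0) - (if r = j then 1 else 0)) (b j)"

definition V_E :: "nat \<Rightarrow> complex \<Rightarrow> complex \<Rightarrow> int \<Rightarrow> int \<Rightarrow> exps \<Rightarrow> (exps \<Rightarrow>\<^sub>0 complex)" where
  "V_E n p m i j b =
     smul ((-1) powi (i - j)) (y_dy (res n i) (res n j) b)
     - Poly_Mapping.single b (m *
         (if i = j then 1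
          else if i - j > 0 \<and> int n dvd i - j then (-1) ^ nat (i - j - 1) * (of_nat n / p)
          else 0))"

fun V_basis :: "nat \<Rightarrow> complex \<Rightarrow> complex \<Rightarrow> aff_basis \<Rightarrow> exps \<Rightarrow> (exps \<Rightarrow>\<^sub>0 complex)" where
  "V_basis n p m (Loop k a b) = V_E n p m (int a) (int b + int n * k)"
| "V_basis n p m Gam = (\<lambda>_. 0)"

definition V_act :: "nat \<Rightarrow> complex \<Rightarrow> complex \<Rightarrow> affgl \<Rightarrow> (exps \<Rightarrow>\<^sub>0 complex) \<Rightarrow> (exps \<Rightarrow>\<^sub>0 complex)" where
  "V_act n p m X x =
     (\<Sum>u\<in>Poly_Mapping.keys X. \<Sum>b\<in>Poly_Mapping.keys x. smul (Poly_Mapping.lookup X u * Poly_Mapping.lookup x b) (V_basis n p m u b))"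

definition ev :: "(exps \<Rightarrow>\<^sub>0 complex) \<Rightarrow> complex" where
  "ev x = (\<Sum>b\<in>Poly_Mapping.keys x. Poly_Mapping.lookup x b)"

text \<open>\<open>V_basis\<close> fixes the action of the basis of the Lie algebra; the following shows that all
  \<open>E n i j\<close> and \<open>\<gamma>\<close> act as prescribed.\<close>

lemma V_E_periodic: "n \<ge> 1 \<Longrightarrow> V_E n p m (i + int n * k) (j + int n * k) b = V_E n p m i j b"
proof -
  have "res n (l + int n * k) = res n l" for l
  proof -
    have "(l + int n * k - 1) mod int n = (l - 1 + int n * k) mod int n"
      by (simp add: algebra_simps)
    also have "\<dots> = (l - 1) mod int n" by simp
    finally show ?thesis by (simp add: res_def)
  qed
  then show ?thesis by (simp add: V_E_def)
qed

lemma V_act_E: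
  assumes "n \<ge> 1"
  shows "V_act n p m (E n i j) (Poly_Mapping.single b 1) = V_E n p m i j b"
    and "V_act n p m gam x = 0"
proof -
  have smul_1: "smul 1 y = y" and smul_0: "smul 0 y = 0" for y :: "'k \<Rightarrow>\<^sub>0 complex"
    unfolding smul_def by (auto intro!: poly_mapping_eqI simp: Poly_Mapping.map.rep_eq when_def)
  have smul_z: "smul c (0 :: 'k \<Rightarrow>\<^sub>0 complex) = 0" for c
    unfolding smul_def by (rule poly_mapping_eqI) (simp add: Poly_Mapping.map.rep_eq)
  have res: "int (res n l) = (l - 1) mod int n + 1" for l
    using assms by (simp add: res_def)
  have per: "V_E n p m (int (res n i)) (int (res n j) + int n * ((j - 1) div int n - (i - 1) div int n)) b
    = V_E n p m i j b" for i j
  proof -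
    have i: "int (res n i) + int n * ((i - 1) div int n) = i" for i
      unfolding res by (smt (verit) mult_div_mod_eq)
    have "int (res n j) + int n * ((j - 1) div int n - (i - 1) div int n) + int n * ((i - 1) div int n) = j"
      using i[of j] by (simp add: algebra_simps)
    then show ?thesis
      using V_E_periodic[OF assms, of p m "int (res n i)" "(i - 1) div int n"
        "int (res n j) + int n * ((j - 1) div int n - (i - 1) div int n)" b] i by simp
  qed
  show "V_act n p m gam x = 0"
    by (simp add: V_act_def gam_def smul_z)
  show "V_act n p m (E n i j) (Poly_Mapping.single b 1) = V_E n p m i j b"
  proof (cases "i = j")
    case False
    then show ?thesis by (simp add: V_act_def E_def smul_1 per)
  next
    case True
    let ?u = "Loop 0 (res n i) (res n i)"
    let ?X = "E n i j"
    have l: "Poly_Mapping.lookup ?X ?u = 1" "Poly_Mapping.keys ?X \<subseteq> {?u, Gam}"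
      using True by (auto simp: E_def lookup_minus lookup_single in_keys_iff when_def split: if_splits)
    have "(\<Sum>u\<in>Poly_Mapping.keys ?X. smul (Poly_Mapping.lookup ?X u) (V_basis n p m u b))
      = (\<Sum>u\<in>{?u, Gam}. smul (Poly_Mapping.lookup ?X u) (V_basis n p m u b))"
      by (rule sum.mono_neutral_left) (use l in \<open>auto simp: in_keys_iff smul_0\<close>)
    also have "\<dots> = V_basis n p m ?u b"
      using l by (simp add: smul_1 smul_z)
    finally show ?thesis
      using per[of i i] True by (simp add: V_act_def)
  qed
qed

section \<open>The completed tensor product of a Verma module with \<open>V\<close>\<close>

text \<open>\<open>exps \<Rightarrow>\<^sub>0 'a\<close> is the tensor product of \<open>'a\<close> with the free vector space on \<open>exps\<close>:
  \<open>Poly_Mapping.single b w\<close> is \<open>w \<otimes> y\<^sup>b\<close>.\<close>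

definition tens ::
  "(complex \<Rightarrow> 'a::ab_group_add \<Rightarrow> 'a) \<Rightarrow> 'a \<Rightarrow> (exps \<Rightarrow>\<^sub>0 complex) \<Rightarrow> (exps \<Rightarrow>\<^sub>0 'a)" where
  "tens scale w x = (\<Sum>b\<in>Poly_Mapping.keys x. Poly_Mapping.single b (scale (Poly_Mapping.lookup x b) w))"

definition tens_completion ::
  "nat \<Rightarrow> (complex \<Rightarrow> 'a::ab_group_add \<Rightarrow> 'a) \<Rightarrow> (affgl \<Rightarrow> 'a \<Rightarrow> 'a) \<Rightarrow> 'a
   \<Rightarrow> ((nat \<Rightarrow> int) \<Rightarrow> (exps \<Rightarrow>\<^sub>0 'a)) set" where
  "tens_completion n scale act v =
     {F. \<forall>d. Poly_Mapping.keys (F d) \<subseteq> exps n \<and> (\<forall>b. Poly_Mapping.lookup (F d) b \<in> piece n scale act v d)}"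

text \<open>\<open>X \<otimes> 1 + 1 \<otimes> X\<close>; the second summand preserves the degree.\<close>

definition tens_act ::
  "nat \<Rightarrow> complex \<Rightarrow> complex \<Rightarrow> (complex \<Rightarrow> 'a::ab_group_add \<Rightarrow> 'a) \<Rightarrow> (affgl \<Rightarrow> 'a \<Rightarrow> 'a) \<Rightarrow> affgl
   \<Rightarrow> ((nat \<Rightarrow> int) \<Rightarrow> (exps \<Rightarrow>\<^sub>0 'a)) \<Rightarrow> ((nat \<Rightarrow> int) \<Rightarrow> (exps \<Rightarrow>\<^sub>0 'a))" where
  "tens_act n p m scale act X F = (\<lambda>d.
     hat_act n (\<lambda>Y. Poly_Mapping.map (act Y)) X F d
     + (\<Sum>b\<in>Poly_Mapping.keys (F d). tens scale (Poly_Mapping.lookup (F d) b) (V_act n p m X (Poly_Mapping.single b 1))))"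

definition id_tens_ev ::
  "(complex \<Rightarrow> 'a::ab_group_add \<Rightarrow> 'a) \<Rightarrow> ((nat \<Rightarrow> int) \<Rightarrow> (exps \<Rightarrow>\<^sub>0 'a)) \<Rightarrow> ((nat \<Rightarrow> int) \<Rightarrow> 'a)" where
  "id_tens_ev scale F = (\<lambda>d.
     \<Sum>b\<in>Poly_Mapping.keys (F d). scale (ev (Poly_Mapping.single b 1)) (Poly_Mapping.lookup (F d) b))"

definition tens_scale ::
  "(complex \<Rightarrow> 'a::ab_group_add \<Rightarrow> 'a) \<Rightarrow> complex \<Rightarrow> (exps \<Rightarrow>\<^sub>0 'a) \<Rightarrow> (exps \<Rightarrow>\<^sub>0 'a)" where
  "tens_scale scale c = Poly_Mapping.map (scale c)"

definition is_intertwiner ::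
  "nat \<Rightarrow> complex \<Rightarrow> complex
   \<Rightarrow> (complex \<Rightarrow> 'b::ab_group_add \<Rightarrow> 'b) \<Rightarrow> (affgl \<Rightarrow> 'b \<Rightarrow> 'b)
   \<Rightarrow> (complex \<Rightarrow> 'a::ab_group_add \<Rightarrow> 'a) \<Rightarrow> (affgl \<Rightarrow> 'a \<Rightarrow> 'a) \<Rightarrow> 'a
   \<Rightarrow> ('b \<Rightarrow> (nat \<Rightarrow> int) \<Rightarrow> (exps \<Rightarrow>\<^sub>0 'a)) \<Rightarrow> bool" where
  "is_intertwiner n p m scale' act' scale act v \<Phi> \<longleftrightarrow>
     (\<forall>d. Vector_Spaces.linear scale' (tens_scale scale) (\<lambda>w. \<Phi> w d)) \<and>
     (\<forall>w. \<Phi> w \<in> tens_completion n scale act v) \<and>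
     (\<forall>X\<in>affgl n. \<forall>w. \<Phi> (act' X w) = tens_act n p m scale act X (\<Phi> w))"

text \<open>The degree zero component of \<open>\<Phi> v'\<close> is \<open>v \<otimes> y\<^sup>b\<close> with \<open>b\<^sub>k = a'\<^sub>k - a\<^sub>k + m\<close>.\<close>

definition normalized ::
  "nat \<Rightarrow> complex \<Rightarrow> (nat \<Rightarrow> complex) \<Rightarrow> 'b \<Rightarrow> (nat \<Rightarrow> complex) \<Rightarrow> 'a::ab_group_add
   \<Rightarrow> ('b \<Rightarrow> (nat \<Rightarrow> int) \<Rightarrow> (exps \<Rightarrow>\<^sub>0 'a)) \<Rightarrow> bool" where
  "normalized n m a' v' a v \<Phi> \<longleftrightarrow>
     \<Phi> v' (\<lambda>_. 0) = Poly_Mapping.single (\<lambda>k. if k \<in> {1..n} then a' k - a k + m else 0) v"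

end

theory Submission
  imports Defs "HOL-Library.Function_Algebras"
begin

text \<open>
  Let \<open>L\<close> and \<open>R\<close> be the operations \<open>E\<^sub>i\<^sub>j \<mapsto> E\<^sub>i\<^sub>+\<^sub>1\<^sub>,\<^sub>j\<close> and \<open>E\<^sub>i\<^sub>j \<mapsto> E\<^sub>i\<^sub>,\<^sub>j\<^sub>-\<^sub>1\<close> on matrix units. Bracketing
  with the \<open>t\<close>-th power of the shift matrix is \<open>L\<^sup>t - R\<^sup>t\<close>, with no central correction because of the way
  \<open>\<gamma>\<close> enters \<open>E\<^sub>i\<^sub>i\<close>. As \<open>log g\<close> is the alternating series of these powers, conjugation by \<open>g\<close> is
  \<open>(1 + L) / (1 + R)\<close>, so that \<open>g (E\<^sub>i\<^sub>j + E\<^sub>i\<^sub>,\<^sub>j\<^sub>-\<^sub>1) = (E\<^sub>i\<^sub>j + E\<^sub>i\<^sub>+\<^sub>1\<^sub>,\<^sub>j) g\<close> (\<open>g_op_intertwines\<close>). The intertwiner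
  carries \<open>E\<^sub>i\<^sub>j + E\<^sub>i\<^sub>+\<^sub>1\<^sub>,\<^sub>j\<close> over to \<open>M \<otimes> V\<close>, and evaluation at \<open>y = 1\<close> cancels the differential operators
  in the second factor against each other, leaving the scalar \<open>-\<alpha> m\<close> (\<open>evaluation_V_part\<close>). Hence the
  composite satisfies the relations that characterize \<open>A\<close> (\<open>A_op_factors\<close>), and the theorem
  follows from the existence of the intertwiner and from two uniqueness statements.

  Those three are questions about one module: which vectors of the completed \<open>M\<close> have prescribed images under
  the lowering operators? The answer comes from the Casimir operator, written as a sum of products
  raising times lowering plus a correction on the scalar matrices. It acts on the piece of degree \<open>d\<close> by a
  number (\<open>casimir_scalar\<close>) that is a rational constant plus a linear form in \<open>a\<^sub>1, \<dots>, a\<^sub>n, p\<close>, and for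
  generic parameters this number vanishes only at \<open>d = 0\<close> (\<open>casimir_value_nonzero\<close>). A vector of degree
  \<open>d \<noteq> 0\<close> killed by all lowering operators is killed by the Casimir operator, so it is zero
  (\<open>no_singular\<close>): this gives the uniqueness of both \<open>\<Phi>\<close> and \<open>A\<close>. Conversely the Casimir operator is a
  contracting homotopy: applied to a compatible system of prescribed images, and divided by its
  eigenvalue, it returns a vector with these images (\<open>integrate_cocycle\<close>).

  Weights force the image of \<open>v'\<close> under an intertwiner to be a sum of \<open>f\<^sub>d \<otimes> y\<^sup>b\<close> with one exponent \<open>b\<close> for
  each degree \<open>d\<close>, and singularity prescribes the lowered vectors of \<open>f\<^sub>d\<close> as multiples of \<open>f\<close> in smaller
  degrees. The compatibility of these prescriptions is the statement that \<open>V\<close> is a module; so the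
  \<open>f\<^sub>d\<close> exist by recursion on the degree (\<open>family_lower\<close>), and the universal property of \<open>M'\<close> turns the
  singular vector into \<open>\<Phi>\<close> (\<open>intertwiner_exists\<close>).\<close>

section \<open>The bracket in the basis \<open>E n i j\<close>\<close>

abbreviation (input) single :: "'k \<Rightarrow> 'c::zero \<Rightarrow> ('k \<Rightarrow>\<^sub>0 'c)" where
  "single \<equiv> Poly_Mapping.single"

abbreviation (input) lookup :: "('k \<Rightarrow>\<^sub>0 'c::zero) \<Rightarrow> 'k \<Rightarrow> 'c" where
  "lookup \<equiv> Poly_Mapping.lookup"

abbreviation (input) keys :: "('k \<Rightarrow>\<^sub>0 'c::zero) \<Rightarrow> 'k set" where
  "keys \<equiv> Poly_Mapping.keys"

lemma lookup_smul [simp]: "lookup (smul c x) k = c * lookup x k"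
  by (simp add: smul_def Poly_Mapping.map.rep_eq when_def)

lemma smul_simps [simp]: "smul c 0 = 0" "smul 0 x = 0" "smul 1 x = x"
  "smul c (smul d x) = smul (c * d) x" "smul c (single k d) = single k (c * d)"
  by (auto intro!: poly_mapping_eqI simp: lookup_single when_def)

lemma smul_distribs: "smul c (x + y) = smul c x + smul c y" "smul (c + d) x = smul c x + smul d x"
  "smul c (x - y) = smul c x - smul c y"
  by (auto intro!: poly_mapping_eqI simp: lookup_add lookup_minus algebra_simps)

lemma keys_smul: "keys (smul c x) \<subseteq> keys x"
  by (auto simp: in_keys_iff)

lemma bracket_superset:
  assumes "finite S" "keys X \<subseteq> S" "finite T" "keys Y \<subseteq> T"
  shows "bracket X Y = (\<Sum>x\<in>S. \<Sum>y\<in>T. smul (lookup X x * lookup Y y) (basis_bracket x y))"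
proof -
  have "bracket X Y = (\<Sum>x\<in>keys X. \<Sum>y\<in>T. smul (lookup X x * lookup Y y) (basis_bracket x y))"
    unfolding bracket_def
    by (intro sum.cong sum.mono_neutral_left) (use assms in \<open>auto simp: in_keys_iff\<close>)
  also have "\<dots> = (\<Sum>x\<in>S. \<Sum>y\<in>T. smul (lookup X x * lookup Y y) (basis_bracket x y))"
    by (intro sum.mono_neutral_left) (use assms in \<open>auto simp: in_keys_iff\<close>)
  finally show ?thesis .
qed

lemma bracket_add:
  "bracket (X + Y) Z = bracket X Z + bracket Y Z" "bracket Z (X + Y) = bracket Z X + bracket Z Y"
proof -
  let ?S = "keys X \<union> keys Y" and ?T = "keys Z"
  have *: "keys (X + Y) \<subseteq> ?S"
    by (rule Poly_Mapping.keys_add)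
  show "bracket (X + Y) Z = bracket X Z + bracket Y Z"
    using * by (subst (1 2 3) bracket_superset[of ?S _ ?T])
      (auto simp: lookup_add smul_distribs sum.distrib algebra_simps)
  show "bracket Z (X + Y) = bracket Z X + bracket Z Y"
    using * by (subst (1 2 3) bracket_superset[of ?T _ ?S])
      (auto simp: lookup_add smul_distribs sum.distrib algebra_simps)
qed

lemma bracket_single [simp]:
  "bracket (single x c) (single y d) = smul (c * d) (basis_bracket x y)"
  by (subst bracket_superset[of "{x}" _ "{y}"]) auto

lemma basis_bracket_Gam [simp]: "basis_bracket x Gam = 0"
  by (cases x) auto

lemma bracket_zero [simp]: "bracket 0 X = 0" "bracket X 0 = 0"
  by (simp_all add: bracket_def)

lemma bracket_uminus: "bracket (- X) Z = - bracket X Z" "bracket Z (- X) = - bracket Z X"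
  using bracket_add(1)[of X "-X" Z] bracket_add(2)[of Z X "-X"]
  by (simp_all add: eq_neg_iff_add_eq_0 add.commute)

lemma bracket_minus:
  "bracket (X - Y) Z = bracket X Z - bracket Y Z" "bracket Z (X - Y) = bracket Z X - bracket Z Y"
  by (simp_all add: bracket_add bracket_uminus flip: add_uminus_conv_diff)

lemma int_res: "n \<ge> 1 \<Longrightarrow> int (res n l) = (l - 1) mod int n + 1"
  by (simp add: res_def)

lemma res_range: "n \<ge> 1 \<Longrightarrow> res n i \<in> {1..n}"
proof -
  assume "n \<ge> 1"
  then have "int 1 \<le> int (res n i) \<and> int (res n i) \<le> int n"
    using pos_mod_bound[of "int n" "i - 1"] pos_mod_sign[of "int n" "i - 1"]
    unfolding int_res[OF \<open>n \<ge> 1\<close>] by linarith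
  then show ?thesis
    unfolding of_nat_le_iff by simp
qed

lemma res_id [simp]: "k \<in> {1..n} \<Longrightarrow> res n (int k) = k"
  by (auto simp: res_def)

lemma res_eq_iff: "n \<ge> 1 \<Longrightarrow> res n i = res n j \<longleftrightarrow> int n dvd i - j"
proof -
  assume "n \<ge> 1"
  then have "res n i = res n j \<longleftrightarrow> (i - 1) mod int n = (j - 1) mod int n"
    using int_res[of n i] int_res[of n j] by (smt (verit) of_nat_eq_iff)
  also have "\<dots> \<longleftrightarrow> int n dvd i - j"
    by (simp add: mod_eq_dvd_iff)
  finally show ?thesis .
qed

lemma res_decomp: "n \<ge> 1 \<Longrightarrow> int (res n i) + int n * ((i - 1) div int n) = i"
  using mult_div_mod_eq[of "int n" "i - 1"] by (simp add: int_res)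

lemma E_eq: "n \<ge> 1 \<Longrightarrow> E n i j =
    single (Loop ((j - 1) div int n - (i - 1) div int n) (res n i) (res n j)) 1
    - single Gam (if i = j then of_int ((i - 1) div int n) else 0)"
  by (simp add: E_def)

lemma keys_single_sub: "keys (single k c) \<subseteq> {k}" by simp

lemma affgl_single: "x = Gam \<or> (\<exists>k a b. x = Loop k a b \<and> a \<in> {1..n} \<and> b \<in> {1..n}) \<Longrightarrow> single x c \<in> affgl n"
  using keys_single_sub[of x c] by (auto simp: affgl_def split: if_splits)

lemma affgl_zero [simp]: "0 \<in> affgl n"
  by (simp add: affgl_def)

lemma affgl_add [simp]: "X \<in> affgl n \<Longrightarrow> Y \<in> affgl n \<Longrightarrow> X + Y \<in> affgl n"
  unfolding affgl_def mem_Collect_eq using Poly_Mapping.keys_add[of X Y] by blast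

lemma affgl_diff [simp]: "X \<in> affgl n \<Longrightarrow> Y \<in> affgl n \<Longrightarrow> X - Y \<in> affgl n"
  unfolding affgl_def mem_Collect_eq using keys_diff[of X Y] by blast

lemma affgl_smul [simp]: "X \<in> affgl n \<Longrightarrow> smul c X \<in> affgl n"
  unfolding affgl_def mem_Collect_eq using keys_smul[of c X] by blast

lemma gam_affgl [simp]: "gam \<in> affgl n"
  unfolding gam_def by (rule affgl_single) simp

lemma E_affgl [simp]: "n \<ge> 1 \<Longrightarrow> E n i j \<in> affgl n"
  using res_range[of n] by (simp add: E_eq affgl_single)

lemma affgl_sum: "(\<And>i. i \<in> A \<Longrightarrow> f i \<in> affgl n) \<Longrightarrow> sum f A \<in> affgl n"
  by (induction A rule: infinite_finite_induct) auto

lemma Loop_eq_E: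
  assumes "a \<in> {1..n}" "b \<in> {1..n}"
  shows "single (Loop k a b) c =
    smul c (E n (int a) (int b + int n * k))"
proof -
  from assms have n: "n \<ge> 1" by auto
  have d: "(int c - 1) div int n = 0" if "c \<in> {1..n}" for c using that by auto
  have q: "(int b + int n * k - 1) div int n = k"
  proof -
    have "int b + int n * k - 1 = (int b - 1) + int n * k" by simp
    also have "\<dots> div int n = k + (int b - 1) div int n"
      using n by (intro div_mult_self2) simp
    finally show ?thesis using d[OF assms(2)] by simp
  qed
  have "res n (int b + int n * k) = res n (int b)"
    using res_eq_iff[OF n, of "int b + int n * k" "int b"] by simp
  then have r: "res n (int b + int n * k) = b" using assms by simp
  show ?thesis
    unfolding E_eq[OF n] q r d[OF assms(1)] using assms by simp
qed

lemma block_shift: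
  assumes "n \<ge> 1"
  shows "(i + int n * t - 1) div int n = (i - 1) div int n + t" "res n (i + int n * t) = res n i"
proof -
  have "i + int n * t - 1 = (i - 1) + int n * t" by simp
  also have "\<dots> div int n = t + (i - 1) div int n"
    using assms by (intro div_mult_self2) simp
  finally show "(i + int n * t - 1) div int n = (i - 1) div int n + t" by simp
  show "res n (i + int n * t) = res n i"
    using res_eq_iff[OF assms, of "i + int n * t" i] by simp
qed

text \<open>A cocycle term occurs only in total degree zero, where the two summands on the right are both diagonal;
  the difference of the multiples of \<open>\<gamma>\<close> in \<open>E n i i\<close> and \<open>E n j j\<close> is exactly that term. So the
  relations are those of periodic matrix units, which keeps \<open>\<gamma>\<close> out of the computations below.\<close>

lemma bracket_E:
  assumes n: "n \<ge> 1"
  shows "bracket (E n i j) (E n k l) =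
    (if int n dvd j - k then E n i (l + j - k) else 0) - (if int n dvd i - l then E n (k + i - l) j else 0)"
proof -
  define q where "q i = (i - 1) div int n" for i
  have q_eq: "i = int (res n i) + int n * q i" for i
    using res_decomp[OF n] by (simp add: q_def)
  have E: "E n i j = single (Loop (q j - q i) (res n i) (res n j)) 1
      - single Gam (if i = j then of_int (q i) else 0)" for i j
    unfolding E_eq[OF n] q_def ..
  have same: "i - k = int n * (q i - q k)" if "res n i = res n k" for i k
    using q_eq[of i] q_eq[of k] that by (simp add: right_diff_distrib)
  have shift: "q (l + j - k) = q l + q j - q k \<and> res n (l + j - k) = res n l"
    if "res n j = res n k" for j k l
  proof -
    have *: "l + j - k = l + int n * (q j - q k)" using same[OF that] by simp
    show ?thesis unfolding * q_def block_shift[OF n] by simp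
  qed
  have dvd: "int n dvd j - k \<longleftrightarrow> res n j = res n k" "int n dvd i - l \<longleftrightarrow> res n l = res n i"
    using res_eq_iff[OF n] by (auto simp: dvd_diff_commute)
  define s where "s = q j - q i + (q l - q k)"
  have br: "bracket (E n i j) (E n k l)
      = basis_bracket (Loop (q j - q i) (res n i) (res n j)) (Loop (q l - q k) (res n k) (res n l))"
    by (simp add: E bracket_minus)
  have E1: "E n i (l + j - k) = single (Loop s (res n i) (res n l)) 1
      - single Gam (if s = 0 \<and> res n i = res n l then of_int (q i) else 0)"
    if r: "res n j = res n k"
  proof -
    have "i = l + j - k \<longleftrightarrow> s = 0 \<and> res n i = res n l"
    proof
      assume "i = l + j - k"
      then show "s = 0 \<and> res n i = res n l"
        using shift[OF r, of l] by (simp add: s_def)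
    next
      assume a: "s = 0 \<and> res n i = res n l"
      then have "i - l = int n * (q i - q l)" "j - k = int n * (q j - q k)"
        using same r by auto
      moreover from a have "q i - q l = q j - q k" by (simp add: s_def)
      ultimately show "i = l + j - k" by simp
    qed
    moreover have "q l + q j - q k - q i = s" by (simp add: s_def)
    ultimately show ?thesis
      unfolding E using shift[OF r, of l] by simp
  qed
  have E2: "E n (k + i - l) j = single (Loop s (res n k) (res n j)) 1
      - single Gam (if s = 0 \<and> res n j = res n k then of_int (q j) else 0)"
    if r: "res n l = res n i"
  proof -
    note r' = r[symmetric]
    have "k + i - l = j \<longleftrightarrow> s = 0 \<and> res n j = res n k"
    proof
      assume "k + i - l = j"
      then show "s = 0 \<and> res n j = res n k"
        using shift[OF r', of k] by (auto simp: s_def)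
    next
      assume a: "s = 0 \<and> res n j = res n k"
      then have "i - l = int n * (q i - q l)" "j - k = int n * (q j - q k)"
        using same r' by auto
      moreover from a have "q i - q l = q j - q k" by (simp add: s_def)
      ultimately show "k + i - l = j" by simp
    qed
    moreover have "q j - (q k + q i - q l) = s" by (simp add: s_def)
    ultimately show ?thesis
      unfolding E using shift[OF r', of k] by auto
  qed
  show ?thesis
  proof (cases "res n j = res n k"; cases "res n l = res n i")
    assume c: "res n j = res n k" "res n l = res n i"
    have "single Gam (of_int (q j) :: complex) - single Gam (of_int (q i))
      = single Gam (of_int (q j - q i))"
      by (simp flip: single_diff)
    with c show ?thesis
      unfolding br dvd by (simp add: E1 E2 s_def[symmetric])
  qed (simp_all add: br dvd E1 E2 s_def[symmetric])
qed

section \<open>Degrees, weights and representations\<close>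

lemma edeg_step:
  "edeg n i (j + 1) r = edeg n i j r + (if res n j = r then 1 else 0)"
proof (cases "i \<le> j")
  case True
  then have "{a \<in> {i..<j+1}. res n a = r} = {a \<in> {i..<j}. res n a = r} \<union> (if res n j = r then {j} else {})"
    by (auto simp: less_le)
  moreover have "finite {a \<in> {i..<j}. res n a = r}"
    by (rule finite_subset[of _ "{i..<j}"]) auto
  ultimately show ?thesis using True by (auto simp: edeg_def)
next
  case False
  then have "{a \<in> {j..<i}. res n a = r} = {a \<in> {j+1..<i}. res n a = r} \<union> (if res n j = r then {j} else {})"
    (is "?L = ?R")
  proof (intro set_eqI)
    show "x \<in> ?L \<longleftrightarrow> x \<in> ?R" for x using False by (cases "x = j") auto
  qed
  moreover have "{i..<j+1} = {}" "{i..<j} = {}" using False by auto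
  moreover have "finite {a \<in> {j+1..<i}. res n a = r}"
    by (rule finite_subset[of _ "{j+1..<i}"]) auto
  ultimately show ?thesis by (auto simp: edeg_def)
qed

lemma edeg_self [simp]: "edeg n i i r = 0"
  by (simp add: edeg_def)

lemma edeg_swap: "edeg n j i r = - edeg n i j r"
  by (simp add: edeg_def)

lemma int_step_induct [case_names base step]:
  fixes i j :: int
  assumes "P i" "\<And>j. P j \<longleftrightarrow> P (j + 1)"
  shows "P j"
proof (induction j rule: int_induct[where k = i])
  case (step2 j)
  then show ?case using assms(2)[of "j - 1"] by simp
qed (use assms in auto)

lemma edeg_trans: "edeg n i j r + edeg n j k r = edeg n i k r"
  by (induction k rule: int_step_induct[where i = j]) (auto simp: edeg_step)

lemma edeg_periodic:
  assumes "n \<ge> 1"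
  shows "edeg n (i + int n * t) (j + int n * t) r = edeg n i j r"
proof (induction j rule: int_step_induct[where i = i])
  case (step j)
  have "edeg n (i + int n * t) (j + 1 + int n * t) r
      = edeg n (i + int n * t) (j + int n * t) r + (if res n (j + int n * t) = r then 1 else 0)"
    using edeg_step[of n "i + int n * t" "j + int n * t" r] by (simp add: ac_simps)
  then show "(edeg n (i + int n * t) (j + int n * t) r = edeg n i j r) \<longleftrightarrow>
      (edeg n (i + int n * t) (j + 1 + int n * t) r = edeg n i (j + 1) r)"
    using block_shift(2)[OF assms, of j t] by (simp add: edeg_step)
qed simp

lemma edeg_comp:
  assumes n: "n \<ge> 1" and "int n dvd j - k"
  shows "edeg n i (l + j - k) r = edeg n i j r + edeg n k l r"
    and "edeg n (i + k - j) l r = edeg n i j r + edeg n k l r"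
proof -
  obtain t where t: "j - k = int n * t" using assms(2) by auto
  then have "edeg n k l r = edeg n j (l + j - k) r"
    using edeg_periodic[OF n, of k t l r] by (simp add: algebra_simps)
  then show 1: "edeg n i (l + j - k) r = edeg n i j r + edeg n k l r"
    using edeg_trans[of n i j r "l + j - k"] by simp
  have "edeg n (i + k - j) l r = edeg n i (l + j - k) r"
    using t edeg_periodic[OF n, of "i + k - j" t l r] by (simp add: algebra_simps)
  with 1 show "edeg n (i + k - j) l r = edeg n i j r + edeg n k l r" by simp
qed

lemma edeg_unsupported:
  assumes "n \<ge> 1" "r \<notin> {1..n}"
  shows "edeg n i j r = 0"
proof -
  have "res n a \<noteq> r" for a using res_range[OF assms(1), of a] assms(2) by metis
  then show ?thesis by (simp add: edeg_def)
qed

definition tdeg :: "nat \<Rightarrow> (nat \<Rightarrow> int) \<Rightarrow> int" where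
  "tdeg n d = (\<Sum>r=1..n. d r)"

lemma tdeg_edeg [simp]:
  assumes "n \<ge> 1"
  shows "tdeg n (edeg n i j) = j - i"
proof (induction j rule: int_step_induct[where i = i])
  case (step j)
  have "tdeg n (edeg n i (j + 1)) = tdeg n (edeg n i j) + 1"
    using res_range[OF assms, of j] by (simp add: tdeg_def edeg_step sum.distrib)
  then show "(tdeg n (edeg n i j) = j - i) \<longleftrightarrow> (tdeg n (edeg n i (j + 1)) = j + 1 - i)" by auto
qed (simp add: tdeg_def)

lemma tdeg_add [simp]: "tdeg n (\<lambda>r. d r + d' r) = tdeg n d + tdeg n d'"
  "tdeg n (\<lambda>r. d r - d' r) = tdeg n d - tdeg n d'" "tdeg n (\<lambda>_. 0) = 0"
  by (simp_all add: tdeg_def sum.distrib sum_subtractf)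

text \<open>The integer by which the eigenvalue of \<open>E k k\<close> in degree \<open>d\<close> of a Verma module exceeds the one on the
  generator.\<close>

definition wt :: "nat \<Rightarrow> (nat \<Rightarrow> int) \<Rightarrow> int \<Rightarrow> int" where
  "wt n d k = d (res n k) - d (res n (k - 1))"

lemma wt_add [simp]: "wt n (\<lambda>r. d r + d' r) k = wt n d k + wt n d' k"
  "wt n (\<lambda>r. d r - d' r) k = wt n d k - wt n d' k" "wt n (\<lambda>_. 0) k = 0"
  by (simp_all add: wt_def)

lemma wt_edeg:
  assumes n: "n \<ge> 1"
  shows "wt n (edeg n i j) k = (if int n dvd i - k then 1 else 0) - (if int n dvd j - k then 1 else 0)"
proof (induction j rule: int_step_induct[where i = i])
  case (step j)
  have "res n j = res n k \<longleftrightarrow> int n dvd j - k" "res n j = res n (k - 1) \<longleftrightarrow> int n dvd j + 1 - k"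
    using res_eq_iff[OF n, of j k] res_eq_iff[OF n, of j "k - 1"] by (auto simp: algebra_simps)
  then show "(wt n (edeg n i j) k = (if int n dvd i - k then 1 else 0) - (if int n dvd j - k then 1 else 0)) \<longleftrightarrow>
    (wt n (edeg n i (j + 1)) k = (if int n dvd i - k then 1 else 0) - (if int n dvd j + 1 - k then 1 else 0))"
    by (auto simp: wt_def edeg_step)
qed (simp add: wt_def)

lemma sum_residue:
  fixes \<phi> :: "int \<Rightarrow> 'a::comm_monoid_add"
  assumes n_pos: "n \<ge> 1" and "\<And>i. \<phi> (i + int n) = \<phi> i"
  shows "(\<Sum>i=1..int n. if int n dvd i - k then \<phi> i else 0) = \<phi> k"
proof -
  have per: "\<phi> (i + int n * t) = \<phi> i" for i t
  proof (induction t rule: int_step_induct[where i = 0])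
    case (step t)
    show "(\<phi> (i + int n * t) = \<phi> i) \<longleftrightarrow> (\<phi> (i + int n * (t + 1)) = \<phi> i)"
      using assms(2)[of "i + int n * t"] by (simp add: algebra_simps)
  qed simp
  let ?r = "int (res n k)"
  have r: "?r \<in> {1..int n}" using res_range[OF n_pos, of k] by simp
  have "(\<Sum>i=1..int n. if int n dvd i - k then \<phi> i else 0)
      = (\<Sum>i=1..int n. if i = ?r then \<phi> i else 0)"
  proof (rule sum.cong)
    fix i assume i: "i \<in> {1..int n}"
    have "int n dvd i - k \<longleftrightarrow> res n i = res n k" using res_eq_iff[OF n_pos] by simp
    also have "res n i = res n k \<longleftrightarrow> i = ?r"
    proof -
      from i obtain m where "i = int m" using nonneg_int_cases[of i] by auto
      with i show ?thesis by (auto simp: res_id)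
    qed
    finally show "(if int n dvd i - k then \<phi> i else 0) = (if i = ?r then \<phi> i else 0)" by simp
  qed simp
  also have "\<dots> = \<phi> ?r" using r by simp
  also have "\<dots> = \<phi> (?r + int n * ((k - 1) div int n))" by (simp add: per)
  finally show ?thesis by (simp add: res_decomp[OF n_pos])
qed

locale affgl_rep = affgl_module +
  assumes n_pos: "n \<ge> 1"
begin

abbreviation e :: "int \<Rightarrow> int \<Rightarrow> 'a \<Rightarrow> 'a" where
  "e i j \<equiv> act (E n i j)"

lemma act_lin:
  assumes "X \<in> affgl n"
  shows "act X (w + w') = act X w + act X w'" "act X (scale c w) = scale c (act X w)"
    "act X 0 = 0" "act X (- w) = - act X w" "act X (w - w') = act X w - act X w'"
proof -
  interpret l: Vector_Spaces.linear scale scale "act X" using act_linear[OF assms] .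
  show "act X (w + w') = act X w + act X w'" "act X (scale c w) = scale c (act X w)"
    "act X 0 = 0" "act X (- w) = - act X w" "act X (w - w') = act X w - act X w'"
    by (simp_all add: l.add l.scale l.zero l.neg l.diff)
qed

lemma act_sum: "X \<in> affgl n \<Longrightarrow> act X (sum f A) = (\<Sum>i\<in>A. act X (f i))"
  by (induction A rule: infinite_finite_induct) (auto simp: act_lin)

lemma act_0 [simp]: "act 0 w = 0"
  using act_smul[of 0 0 w] by simp

lemma act_diff:
  assumes "X \<in> affgl n" "Y \<in> affgl n"
  shows "act (X - Y) w = act X w - act Y w"
  using act_add[of "X - Y" Y w] assms by simp

lemma e_affgl [simp]: "E n i j \<in> affgl n"
  using n_pos by simp

lemma e_lin [simp]: 
  "e i j (w + w') = e i j w + e i j w'" "e i j (scale c w) = scale c (e i j w)"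
  "e i j 0 = 0" "e i j (- w) = - e i j w" "e i j (w - w') = e i j w - e i j w'"
  by (simp_all add: act_lin)

lemma e_sum: "e i j (sum f A) = (\<Sum>k\<in>A. e i j (f k))"
  by (simp add: act_sum)

lemma e_comm:
  "e i j (e k l w) = e k l (e i j w) + (if int n dvd j - k then e i (l + j - k) w else 0)
     - (if int n dvd i - l then e (k + i - l) j w else 0)"
proof -
  have "e i j (e k l w) - e k l (e i j w) = act (bracket (E n i j) (E n k l)) w"
    by (simp add: act_bracket)
  also have "\<dots> = (if int n dvd j - k then e i (l + j - k) w else 0) 
      - (if int n dvd i - l then e (k + i - l) j w else 0)"
    by (simp add: bracket_E[OF n_pos] act_diff)
  finally show ?thesis by (simp add: algebra_simps)
qed

lemma e_shift:
  "e (i + int n * t) (j + int n * t) w = e i j w - (if i = j then scale (of_int t) (act gam w) else 0)"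
proof -
  have "E n (i + int n * t) (j + int n * t) = E n i j - (if i = j then smul (of_int t) gam else 0)"
    unfolding E_eq[OF n_pos] block_shift[OF n_pos] gam_def
    by (auto simp: single_add)
  then show ?thesis by (simp add: act_diff act_smul)
qed

lemma e_diag_res:
  "e k k w = e (int (res n k)) (int (res n k)) w - scale (of_int ((k - 1) div int n)) (act gam w)"
  using e_shift[of "int (res n k)" "(k - 1) div int n" "int (res n k)" w] by (simp add: res_decomp[OF n_pos])

lemma gam_comm: "act gam (e i j w) = e i j (act gam w)"
proof -
  have "bracket gam (E n i j) = 0"
    by (simp add: gam_def E_eq[OF n_pos] bracket_minus)
  then show ?thesis
    using act_bracket[of gam "E n i j" w] by simp
qed

text \<open>The \<open>t\<close>-th power of the shift matrix \<open>E\<^sub>2\<^sub>1 + \<dots> + E\<^sub>n\<^sub>+\<^sub>1\<^sub>,\<^sub>n\<close>. The logarithm of \<open>g\<close> is a combination of the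
  \<open>S t\<close> with \<open>t > 0\<close>, and \<open>S (n s)\<close> is the scalar matrix \<open>z\<^sup>-\<^sup>s\<close>.\<close>

definition S :: "int \<Rightarrow> 'a \<Rightarrow> 'a" where
  "S t w = (\<Sum>i=1..int n. e (i + t) i w)"

lemma S_lin [simp]: 
  "S t (w + w') = S t w + S t w'" "S t (scale c w) = scale c (S t w)"
  "S t 0 = 0" "S t (- w) = - S t w" "S t (w - w') = S t w - S t w'"
  by (simp_all add: S_def sum.distrib scale_sum_right sum_negf sum_subtractf)

lemma S_sum: "S t (sum f A) = (\<Sum>k\<in>A. S t (f k))"
  by (induction A rule: infinite_finite_induct) auto

lemma e_per: "i \<noteq> j \<Longrightarrow> e (i + int n) (j + int n) w = e i j w"
  using e_shift[of i 1 j w] by simp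

text \<open>In the bracket each of the two residue conditions selects one summand. For \<open>k + t = l\<close> the summands
  are diagonal, hence not periodic; but then the two conditions coincide, and the difference of the
  summands is periodic.\<close>

lemma S_e: "S t (e k l w) = e k l (S t w) + e (k + t) l w - e k (l - t) w"
proof -
  have "e (i + t) i (e k l w) = e k l (e (i + t) i w) 
       + ((if int n dvd i - k then e (i + t) (l + i - k) w else 0)
       - (if int n dvd i - (l - t) then e (k + i + t - l) i w else 0))" for i
    by (subst e_comm) (simp add: algebra_simps)
  then have "S t (e k l w) = e k l (S t w) + ((\<Sum>i=1..int n. (if int n dvd i - k then e (i + t) (l + i - k) w else 0)
       - (if int n dvd i - (l - t) then e (k + i + t - l) i w else 0)))"
    by (simp add: S_def e_sum sum.distrib)
  also have "(\<Sum>i=1..int n. (if int n dvd i - k then e (i + t) (l + i - k) w else 0)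
       - (if int n dvd i - (l - t) then e (k + i + t - l) i w else 0)) = e (k + t) l w - e k (l - t) w"
  proof (cases "k + t = l")
    case True
    have "e (i + int n + t) (i + int n + t) w - e (i + int n) (i + int n) w = e (i + t) (i + t) w - e i i w" for i
      using e_shift[of "i + t" 1 "i + t" w] e_shift[of i 1 i w] by (simp add: ac_simps)
    then have "(\<Sum>i=1..int n. if int n dvd i - k then e (i + t) (i + t) w - e i i w else 0) = e (k + t) (k + t) w - e k k w"
      by (rule sum_residue[OF n_pos])
    moreover have "(if int n dvd i - k then e (i + t) (l + i - k) w else 0)
       - (if int n dvd i - (l - t) then e (k + i + t - l) i w else 0)
      = (if int n dvd i - k then e (i + t) (i + t) w - e i i w else 0)" for i
      using True by (auto simp: algebra_simps)
    ultimately show ?thesis using True by auto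
  next
    case False
    have "(\<Sum>i=1..int n. if int n dvd i - k then e (i + t) (l + i - k) w else 0) = e (k + t) (l + k - k) w"
      by (rule sum_residue[OF n_pos]) (use False e_per[of "i + t" "l + i - k" w for i] in \<open>auto simp: algebra_simps\<close>)
    moreover have "(\<Sum>i=1..int n. if int n dvd i - (l - t) then e (k + i + t - l) i w else 0) = e (k + (l - t) + t - l) (l - t) w"
      by (rule sum_residue[OF n_pos]) (use False e_per[of "k + i + t - l" i w for i] in \<open>auto simp: algebra_simps\<close>)
    ultimately show ?thesis by (simp add: sum_subtractf)
  qed
  finally show ?thesis by (simp add: algebra_simps)
qed

lemma sum_one_period:
  fixes \<phi> :: "int \<Rightarrow> 'a"
  assumes per: "\<And>i. \<phi> (i + int n) = \<phi> i"
  shows "(\<Sum>i\<in>{l..<l + int n}. \<phi> i) = (\<Sum>i=1..int n. \<phi> i)"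
proof (induction l rule: int_step_induct[where i = 1])
  case base
  have "{1..<1 + int n} = {1..int n}" by auto
  then show ?case by simp
next
  case (step l)
  have "{l..<l + int n} = insert l {l + 1..<l + int n}" "{l + 1..<l + 1 + int n} = insert (l + int n) {l + 1..<l + int n}"
    using n_pos by auto
  then show ?case using per[of l] by simp
qed

lemma S_S_comm:
  assumes "s > 0" "t > 0"
  shows "S s (S t w) = S t (S s w)"
proof -
  have "S s (S t w) = (\<Sum>i=1..int n. e (i + t) i (S s w) + (e (i + t + s) i w - e (i + t) (i - s) w))"
    unfolding S_def[of t] S_sum by (rule sum.cong) (simp_all add: S_e algebra_simps)
  also have "\<dots> = S t (S s w) + ((\<Sum>i=1..int n. e (i + t + s) i w) - (\<Sum>i=1..int n. e (i + t) (i - s) w))"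
    by (simp add: sum.distrib S_def[of t] sum_subtractf)
  also have "(\<Sum>i=1..int n. e (i + t) (i - s) w) = (\<Sum>i\<in>{1 - s..<1 - s + int n}. e (i + t + s) i w)"
    by (rule sum.reindex_bij_witness[of _ "\<lambda>i. i + s" "\<lambda>i. i - s"]) auto
  also have "\<dots> = (\<Sum>i=1..int n. e (i + t + s) i w)"
    by (rule sum_one_period) (use e_per[of "i + t + s" i w for i] assms in \<open>simp add: ac_simps\<close>)
  finally show ?thesis by simp
qed

end

section \<open>The Casimir operator\<close>

lemma telescope_up:
  fixes P :: "int \<Rightarrow> 'a::ab_group_add"
  assumes "l \<le> k" "\<And>j. j > l + N \<Longrightarrow> P j = 0"
  shows "(\<Sum>t=1..N. P (l + t)) - (\<Sum>t=1..N. P (k + t)) = (\<Sum>j\<in>{l<..k}. P j)"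
proof -
  have shift: "(\<Sum>t=1..N. P (u + t)) = (\<Sum>j\<in>{u<..u + N}. P j)" for u
    by (rule sum.reindex_bij_witness[of _ "\<lambda>j. j - u" "\<lambda>t. u + t"]) auto
  let ?M = "max (k + N) k"
  have l: "(\<Sum>j\<in>{l<..l + N}. P j) = (\<Sum>j\<in>{l<..?M}. P j)"
    by (rule sum.mono_neutral_left) (use assms in auto)
  have k: "(\<Sum>j\<in>{k<..k + N}. P j) = (\<Sum>j\<in>{k<..?M}. P j)"
    by (rule sum.mono_neutral_left) (use assms in auto)
  have "{l<..?M} = {l<..k} \<union> {k<..?M}" using assms(1) by auto
  then have "(\<Sum>j\<in>{l<..?M}. P j) = (\<Sum>j\<in>{l<..k}. P j) + (\<Sum>j\<in>{k<..?M}. P j)"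
    by (simp add: sum.union_disjoint ivl_disj_int)
  then show ?thesis using l k by (simp add: shift)
qed

lemma telescope_down:
  fixes Q :: "int \<Rightarrow> 'a::ab_group_add"
  assumes "l \<le> k" "\<And>i. i < k - N \<Longrightarrow> Q i = 0"
  shows "(\<Sum>t=1..N. Q (k - t)) - (\<Sum>t=1..N. Q (l - t)) = (\<Sum>i\<in>{l..<k}. Q i)"
proof -
  have "(\<Sum>t=1..N. Q (- (- k + t))) - (\<Sum>t=1..N. Q (- (- l + t))) = (\<Sum>j\<in>{-k<..-l}. Q (- j))"
    by (rule telescope_up) (use assms in auto)
  also have "(\<Sum>j\<in>{-k<..-l}. Q (- j)) = (\<Sum>i\<in>{l..<k}. Q i)"
    by (rule sum.reindex_bij_witness[of _ uminus uminus]) auto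
  finally show ?thesis by (simp add: algebra_simps)
qed

context affgl_rep
begin

lemma sum_residue_flip:
  fixes \<phi> :: "int \<Rightarrow> 'a"
  assumes "\<And>i. \<phi> (i + int n) = \<phi> i"
  shows "(\<Sum>i=1..int n. if int n dvd k - (i + t) then \<phi> i else 0) = \<phi> (k - t)"
proof -
  have "int n dvd k - (i + t) \<longleftrightarrow> int n dvd i - (k - t)" for i
    using dvd_diff_commute[of "int n" i "k - t"] by (simp add: algebra_simps)
  then show ?thesis using sum_residue[OF n_pos, of \<phi> "k - t"] assms by simp
qed

lemma sum_periods:
  fixes \<phi> :: "int \<Rightarrow> 'a"
  assumes per: "\<And>i. \<phi> (i + int n) = \<phi> i"
  shows "(\<Sum>i\<in>{l..<l + int n * int s}. \<phi> i) = scale (of_nat s) (\<Sum>i=1..int n. \<phi> i)"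
proof (induction s)
  case (Suc s)
  have "{l..<l + int n * int (Suc s)} = {l..<l + int n * int s} \<union> {l + int n * int s..<l + int n * int s + int n}"
    by (auto simp: algebra_simps) (smt (verit) of_nat_0_le_iff mult_nonneg_nonneg)
  then have "(\<Sum>i\<in>{l..<l + int n * int (Suc s)}. \<phi> i) = (\<Sum>i\<in>{l..<l + int n * int s}. \<phi> i) + (\<Sum>i\<in>{l + int n * int s..<l + int n * int s + int n}. \<phi> i)"
    by (simp add: sum.union_disjoint ivl_disj_int)
  then show ?case using Suc sum_one_period[of \<phi> "l + int n * int s", OF per]
    by (simp add: scale_left_distrib add.commute)
qed simp

text \<open>Here \<open>g\<close> plays two roles: \<open>g i j = e i j w\<close>, which gives commutators of the Casimir operator, and
  a cocycle on the lowering operators, which gives the homotopy formula. In both cases \<open>coc\<close> holds,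
  and moving \<open>e k l\<close> through the products produces the same four boundary terms.\<close>

lemma casimir_diagonal:
  assumes per: "\<And>i j. i \<noteq> j \<Longrightarrow> g (i + int n) (j + int n) = g i j"
    and t: "t > 0"
    and coc: "\<And>i. e k l (g (i + t) i) = e (i + t) i (g k l)
       + (if int n dvd l - (i + t) then g k (l - t) else 0) - (if int n dvd k - i then g (k + t) l else 0)"
  shows "e k l (\<Sum>i=1..int n. e i (i + t) (g (i + t) i)) =
    (\<Sum>i=1..int n. e i (i + t) (e (i + t) i (g k l)))
    + e k (l + t) (g (l + t) l) - e (k - t) l (g k (k - t))
    + e (l - t) l (g k (l - t)) - e k (k + t) (g (k + t) l)"
proof -
  have "e k l (e i (i + t) (g (i + t) i)) = e i (i + t) (e (i + t) i (g k l))
      + (if int n dvd l - (i + t) then e i (i + t) (g k (l - t)) else 0)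
      - (if int n dvd k - (i + 0) then e i (i + t) (g (k + t) l) else 0)
      + (if int n dvd l - (i + 0) then e k (l + t) (g (i + t) i) else 0)
      - (if int n dvd k - (i + t) then e (k - t) l (g (i + t) i) else 0)" for i
    by (subst e_comm) (auto simp: coc algebra_simps)
  moreover have "e (i + int n) (i + int n + t) w = e i (i + t) w" for i w
    using e_per[of i "i + t"] t by (simp add: ac_simps)
  then have "(\<Sum>i=1..int n. if int n dvd l - (i + t) then e i (i + t) (g k (l - t)) else 0) = e (l - t) (l - t + t) (g k (l - t))"
    "(\<Sum>i=1..int n. if int n dvd k - (i + 0) then e i (i + t) (g (k + t) l) else 0) = e (k - 0) (k - 0 + t) (g (k + t) l)"
    by (intro sum_residue_flip; simp)+
  moreover have "g (i + int n + t) (i + int n) = g (i + t) i" for i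
    using per[of "i + t" i] t by (simp add: ac_simps)
  then have "(\<Sum>i=1..int n. if int n dvd l - (i + 0) then e k (l + t) (g (i + t) i) else 0) = e k (l + t) (g (l - 0 + t) (l - 0))"
    "(\<Sum>i=1..int n. if int n dvd k - (i + t) then e (k - t) l (g (i + t) i) else 0) = e (k - t) l (g (k - t + t) (k - t))"
    by (intro sum_residue_flip; simp)+
  ultimately show ?thesis
    by (simp add: e_sum sum.distrib sum_subtractf)
qed

lemma casimir_diagonals:
  assumes per: "\<And>i j. i \<noteq> j \<Longrightarrow> g (i + int n) (j + int n) = g i j"
    and coc: "\<And>i t. t > 0 \<Longrightarrow> e k l (g (i + t) i) = e (i + t) i (g k l)
       + (if int n dvd l - (i + t) then g k (i + l - (i + t)) else 0) - (if int n dvd k - i then g (i + t + k - i) l else 0)"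
  shows "e k l (\<Sum>t=1..N. \<Sum>i=1..int n. e i (i + t) (g (i + t) i)) =
    (\<Sum>t=1..N. \<Sum>i=1..int n. e i (i + t) (e (i + t) i (g k l)))
    + ((\<Sum>t=1..N. e k (l + t) (g (l + t) l)) - (\<Sum>t=1..N. e k (k + t) (g (k + t) l)))
    - ((\<Sum>t=1..N. e (k - t) l (g k (k - t))) - (\<Sum>t=1..N. e (l - t) l (g k (l - t))))"
proof -
  have "e k l (\<Sum>i=1..int n. e i (i + t) (g (i + t) i)) = (\<Sum>i=1..int n. e i (i + t) (e (i + t) i (g k l)))
    + e k (l + t) (g (l + t) l) - e (k - t) l (g k (k - t)) + e (l - t) l (g k (l - t)) - e k (k + t) (g (k + t) l)"
    if t: "t > 0" for t
  proof (rule casimir_diagonal[where g = g])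
    have ix: "i + l - (i + t) = l - t" "i + t + k - i = k + t" for i by simp_all
    show "e k l (g (i + t) i) = e (i + t) i (g k l)
       + (if int n dvd l - (i + t) then g k (l - t) else 0) - (if int n dvd k - i then g (k + t) l else 0)" for i
      using coc[OF t, of i] by (simp only: ix)
  qed (fact per t)+
  then show ?thesis
    unfolding e_sum[of k l _ "{1..N}"] by (simp add: sum.distrib sum_subtractf)
qed

end

locale affgl_level = affgl_rep +
  fixes \<kappa> :: complex
  assumes gam_scalar: "act gam w = scale \<kappa> w" and level_nz: "\<kappa> \<noteq> 0"
begin

text \<open>For \<open>g i j = e i j w\<close> this is the Casimir operator without its Cartan part, applied to \<open>w\<close>. The bound
  \<open>N\<close> cuts off terms in which \<open>g\<close> vanishes for reasons of degree. The second sum is there because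
  \<open>gl\<^sub>n\<close> is not simple: the first sum alone has, in the directions \<open>n dvd k - l\<close>, a commutator with an
  additional multiple of a scalar matrix, and this sum removes it.\<close>

definition casimir :: "int \<Rightarrow> (int \<Rightarrow> int \<Rightarrow> 'a) \<Rightarrow> 'a" where
  "casimir N g = (\<Sum>t=1..N. \<Sum>i=1..int n. e i (i + t) (g (i + t) i))
     - scale (1 / \<kappa>) (\<Sum>s=1..N. S (- (int n * s)) (\<Sum>i=1..int n. g (i + int n * s) i))"

lemma e_diag_shift: "e (i + int n * t) (i + int n * t) w = e i i w - scale (of_int t * \<kappa>) w"
  using e_shift[of i t i w] by (simp add: gam_scalar)

text \<open>A scalar matrix \<open>z\<^sup>-\<^sup>s\<close> is central up to the cocycle.\<close>

lemma S_e_imaginary: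
  "e k l (S (int n * s) w) = S (int n * s) (e k l w) + (if l - k = int n * s then scale (of_int s * \<kappa>) w else 0)"
proof -
  have "e (k + int n * s) l w - e k (l - int n * s) w = (if l - k = int n * s then - scale (of_int s * \<kappa>) w else 0)"
  proof (cases "l - k = int n * s")
    case True
    then have l: "l = k + int n * s" by simp
    show ?thesis using e_diag_shift[of k s w] by (simp add: l)
  next
    case False
    then show ?thesis using e_shift[of k s "l - int n * s" w] by simp
  qed
  then show ?thesis using S_e[of "int n * s" k l w] by (auto simp: algebra_simps)
qed

text \<open>The boundary terms of the Casimir computation telescope to \<open>k - l - 1\<close> brackets, each of which is \<open>G\<close>
  up to a term \<open>\<phi> j\<close> if \<open>n dvd k - l\<close>. Over whole periods the \<open>\<phi> j\<close> add up to multiples of a scalar matrix,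
  which cancel against the correction term.\<close>

lemma telescoped_brackets:
  assumes kl: "l < k" "k - l \<le> N"
    and per: "\<And>i. int n dvd k - l \<Longrightarrow> \<phi> (i + int n) = \<phi> i" and start: "int n dvd k - l \<Longrightarrow> \<phi> l = G"
    and I: "\<And>s. k - l = int n * s \<Longrightarrow> I s = (\<Sum>i=1..int n. \<phi> i)"
  shows "(\<Sum>j\<in>{l<..<k}. G - (if int n dvd k - l then \<phi> j else 0))
     + scale (1 / \<kappa>) (\<Sum>s=1..N. if k - l = int n * s then scale (of_int s * \<kappa>) (I s) else 0)
     = scale (of_int (k - l) - (if int n dvd k - l then 0 else 1)) G"
proof -
  have "(\<Sum>j\<in>{l<..<k}. G) = scale (of_nat (nat (k - l - 1))) G"
    using sum_constant_scale[of G "{l<..<k}"] by (simp add: diff_diff_add)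
  also have "of_nat (nat (k - l - 1)) = (of_int (k - l) - 1 :: complex)"
    using kl by (simp add: of_nat_nat)
  finally have card: "(\<Sum>j\<in>{l<..<k}. G) = scale (of_int (k - l) - 1) G" .
  show ?thesis
  proof (cases "int n dvd k - l")
    case False
    then have "k - l \<noteq> int n * s" for s by auto
    with False card show ?thesis by simp
  next
    case True
    then obtain s where s: "k - l = int n * s" by auto
    have s0: "s > 0" using kl s n_pos by (metis diff_gt_0_iff_gt of_nat_0_le_iff zero_less_mult_pos le_less mult_zero_left less_irrefl)
    have "s \<le> int n * s" using s0 n_pos by simp
    then have "s \<le> N" using s kl by linarith
    then have sN: "s \<in> {1..N}" using s0 by simp
    have "k - l = int n * s' \<longleftrightarrow> s' = s" for s' using s n_pos by auto
    then have 1: "(\<Sum>s=1..N. if k - l = int n * s then scale (of_int s * \<kappa>) (I s) else 0) = scale (of_int s * \<kappa>) (I s)"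
      using sN by simp
    have "(\<Sum>i\<in>{l..<l + int n * int (nat s)}. \<phi> i) = scale (of_nat (nat s)) (\<Sum>i=1..int n. \<phi> i)"
      by (rule sum_periods) (rule per[OF True])
    moreover have "{l..<l + int n * int (nat s)} = insert l {l<..<k}" using s s0 kl by auto
    ultimately have "scale (of_int s) (I s) = G + (\<Sum>j\<in>{l<..<k}. \<phi> j)"
      using s0 start[OF True] I[OF s] by (simp add: of_nat_nat)
    then have h: "scale (1 / \<kappa>) (\<Sum>s=1..N. if k - l = int n * s then scale (of_int s * \<kappa>) (I s) else 0)
        = G + (\<Sum>j\<in>{l<..<k}. \<phi> j)"
      unfolding 1 using level_nz by simp
    show ?thesis
      unfolding h sum_subtractf card using True by (simp add: scale_left_diff_distrib)
  qed
qed

text \<open>The homotopy formula: applying a lowering operator to the Casimir sum of a cocycle \<open>g\<close> returns the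
  Casimir operator on \<open>g k l\<close> together with a term that acts on weight vectors by a number.\<close>

lemma casimir_lower:
  assumes per: "\<And>i j. i \<noteq> j \<Longrightarrow> g (i + int n) (j + int n) = g i j"
    and coc: "\<And>i j k l. i > j \<Longrightarrow> k > l \<Longrightarrow> e k l (g i j) = e i j (g k l)
       + (if int n dvd l - i then g k (j + l - i) else 0) - (if int n dvd k - j then g (i + k - j) l else 0)"
    and bound: "\<And>i j. i - j > N \<Longrightarrow> g i j = 0"
    and kl: "k > l" "k - l \<le> N"
  shows "e k l (casimir N g) = casimir N (\<lambda>i j. e i j (g k l)) + e k k (g k l) - e l l (g k l)
    + scale (of_int (k - l) - (if int n dvd k - l then 0 else 1)) (g k l)"
proof -
  let ?gI = "\<lambda>s. \<Sum>i=1..int n. g (i + int n * s) i"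
  define P where "P j = e k j (g j l)" for j
  define Q where "Q i = e i l (g k i)" for i
  have "e k l (\<Sum>t=1..N. \<Sum>i=1..int n. e i (i + t) (g (i + t) i))
      = (\<Sum>t=1..N. \<Sum>i=1..int n. e i (i + t) (e (i + t) i (g k l)))
      + ((\<Sum>t=1..N. P (l + t)) - (\<Sum>t=1..N. P (k + t)))
      - ((\<Sum>t=1..N. Q (k - t)) - (\<Sum>t=1..N. Q (l - t)))"
    unfolding P_def Q_def by (rule casimir_diagonals[where g = g]) (fact per, rule coc, use kl in simp_all)
  also have "(\<Sum>t=1..N. P (l + t)) - (\<Sum>t=1..N. P (k + t)) = (\<Sum>j\<in>{l<..k}. P j)"
    by (rule telescope_up) (use kl bound in \<open>auto simp: P_def\<close>)
  also have "(\<Sum>t=1..N. Q (k - t)) - (\<Sum>t=1..N. Q (l - t)) = (\<Sum>i\<in>{l..<k}. Q i)"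
    by (rule telescope_down) (use kl bound in \<open>auto simp: Q_def\<close>)
  also have "{l<..k} = insert k {l<..<k}" using kl by auto
  also have "{l..<k} = insert l {l<..<k}" using kl by auto
  finally have root: "e k l (\<Sum>t=1..N. \<Sum>i=1..int n. e i (i + t) (g (i + t) i))
    = (\<Sum>t=1..N. \<Sum>i=1..int n. e i (i + t) (e (i + t) i (g k l)))
      + e k k (g k l) - e l l (g k l) + (\<Sum>j\<in>{l<..<k}. P j - Q j)"
    by (simp add: P_def Q_def sum_subtractf algebra_simps)
  \<comment> \<open>The cocycle identity for the bracket of \<open>E k j\<close> and \<open>E j l\<close>.\<close>
  have PQ: "P j - Q j = g k l - (if int n dvd k - l then g (j + (k - l)) j else 0)" if "j \<in> {l<..<k}" for j
    using coc[of l j j k] that unfolding P_def Q_def by (auto simp: algebra_simps)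
  have heis: "e k l (S (- (int n * s)) (?gI s)) = S (- (int n * s)) (S (int n * s) (g k l))
      - (if k - l = int n * s then scale (of_int s * \<kappa>) (?gI s) else 0)" if s: "s > 0" for s
  proof -
    have "e k l (?gI s) = S (int n * s) (g k l)"
    proof -
      have ns: "int n * s > 0" using s n_pos by simp
      have "e k l (g (i + int n * s) i) = e (i + int n * s) i (g k l)
        + ((if int n dvd l - (i + int n * s) then g k (l - int n * s) else 0) - (if int n dvd k - (i + 0) then g (k + int n * s) l else 0))" for i
      proof -
        have ix: "i + l - (i + int n * s) = l - int n * s" "i + int n * s + k - i = k + int n * s" by simp_all
        show ?thesis using coc[of i "i + int n * s" l k] kl ns unfolding ix by simp
      qed
      then have "e k l (?gI s) = S (int n * s) (g k l) + (g k (l - int n * s) - g (k + int n * s) l)"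
        using sum_residue_flip[of "\<lambda>_. g k (l - int n * s)" l "int n * s"]
          sum_residue_flip[of "\<lambda>_. g (k + int n * s) l" k 0]
        by (simp add: e_sum sum.distrib sum_subtractf S_def)
      moreover have "g (k + int n * s') l' = g k (l' - int n * s')" if "k - l' + int n * s' \<noteq> 0" for s' l'
      proof -
        have "g (k + int n * u) (l' - int n * s' + int n * u) = g k (l' - int n * s')" for u
        proof (induction u rule: int_step_induct[where i = 0])
          case (step u)
          then show ?case using that per[of "k + int n * u" "l' - int n * s' + int n * u"]
            by (simp add: algebra_simps)
        qed simp
        from this[of s'] show ?thesis by simp
      qed
      from this[of l s] have "g (k + int n * s) l = g k (l - int n * s)" using kl ns by simp
      ultimately show ?thesis by simp
    qed
    then show ?thesis
      using S_e_imaginary[of k l "- s" "?gI s"] by (auto simp: algebra_simps)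
  qed
  have "e k l (\<Sum>s=1..N. S (- (int n * s)) (?gI s)) = (\<Sum>s=1..N. S (- (int n * s)) (S (int n * s) (g k l)))
      - (\<Sum>s=1..N. if k - l = int n * s then scale (of_int s * \<kappa>) (?gI s) else 0)"
    unfolding e_sum[of k l _ "{1..N}"] sum_subtractf[symmetric]
    by (rule sum.cong) (auto simp: heis)
  then have "e k l (casimir N g) = casimir N (\<lambda>i j. e i j (g k l)) + e k k (g k l) - e l l (g k l)
     + ((\<Sum>j\<in>{l<..<k}. g k l - (if int n dvd k - l then g (j + (k - l)) j else 0))
     + scale (1 / \<kappa>) (\<Sum>s=1..N. if k - l = int n * s then scale (of_int s * \<kappa>) (?gI s) else 0))"
    using root PQ by (simp add: casimir_def scale_right_diff_distrib scale_right_distrib S_def)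
  also have "(\<Sum>j\<in>{l<..<k}. g k l - (if int n dvd k - l then g (j + (k - l)) j else 0))
     + scale (1 / \<kappa>) (\<Sum>s=1..N. if k - l = int n * s then scale (of_int s * \<kappa>) (?gI s) else 0)
     = scale (of_int (k - l) - (if int n dvd k - l then 0 else 1)) (g k l)"
    by (rule telescoped_brackets)
       (use kl per[of "i + (k - l)" i for i] in \<open>simp_all add: ac_simps\<close>)
  finally show ?thesis .
qed

text \<open>The commutator of the Casimir operator with a raising operator, up to the term that the Cartan part
  would contribute.\<close>

lemma casimir_raise:
  assumes bound: "\<And>i j. i - j > N - (l - k) \<Longrightarrow> e i j w = 0"
    and kl: "k < l" "l - k \<le> N"
  shows "casimir N (\<lambda>i j. e i j (e k l w)) = e k l (casimir N (\<lambda>i j. e i j w)) + e k l (e l l w) - e k l (e k k w)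
    + scale (of_int (l - k) - (if int n dvd l - k then 0 else 1)) (e k l w)"
proof -
  define P where "P j = e k j (e j l w)" for j
  define Q where "Q i = e i l (e k i w)" for i
  have "e k l (\<Sum>t=1..N. \<Sum>i=1..int n. e i (i + t) (e (i + t) i w))
      = (\<Sum>t=1..N. \<Sum>i=1..int n. e i (i + t) (e (i + t) i (e k l w)))
      + ((\<Sum>t=1..N. P (l + t)) - (\<Sum>t=1..N. P (k + t)))
      - ((\<Sum>t=1..N. Q (k - t)) - (\<Sum>t=1..N. Q (l - t)))"
    unfolding P_def Q_def by (rule casimir_diagonals[where g = "\<lambda>i j. e i j w"]) (fact e_per, rule e_comm)
  then have "e k l (\<Sum>t=1..N. \<Sum>i=1..int n. e i (i + t) (e (i + t) i w))
      = (\<Sum>t=1..N. \<Sum>i=1..int n. e i (i + t) (e (i + t) i (e k l w)))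
      - ((\<Sum>t=1..N. P (k + t)) - (\<Sum>t=1..N. P (l + t)))
      + ((\<Sum>t=1..N. Q (l - t)) - (\<Sum>t=1..N. Q (k - t)))"
    by simp
  also have "(\<Sum>t=1..N. P (k + t)) - (\<Sum>t=1..N. P (l + t)) = (\<Sum>j\<in>{k<..l}. P j)"
    by (rule telescope_up) (use kl bound in \<open>auto simp: P_def\<close>)
  also have "(\<Sum>t=1..N. Q (l - t)) - (\<Sum>t=1..N. Q (k - t)) = (\<Sum>i\<in>{k..<l}. Q i)"
    by (rule telescope_down) (use kl bound in \<open>auto simp: Q_def\<close>)
  also have "{k<..l} = insert l {k<..<l}" using kl by auto
  also have "{k..<l} = insert k {k<..<l}" using kl by auto
  finally have root: "e k l (\<Sum>t=1..N. \<Sum>i=1..int n. e i (i + t) (e (i + t) i w))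
    = (\<Sum>t=1..N. \<Sum>i=1..int n. e i (i + t) (e (i + t) i (e k l w)))
      - e k l (e l l w) + e k l (e k k w) - (\<Sum>j\<in>{k<..<l}. P j - Q j)"
    by (simp add: P_def Q_def sum_subtractf algebra_simps)
  have PQ: "P j - Q j = e k l w - (if int n dvd l - k then e (j - (l - k)) j w else 0)" for j
    using e_comm[of k j j l w] dvd_diff_commute[of "int n" k l] unfolding P_def Q_def by (auto simp: algebra_simps)
  have heis: "e k l (S (- (int n * s)) (S (int n * s) w)) = S (- (int n * s)) (S (int n * s) (e k l w))
      + (if l - k = int n * s then scale (of_int s * \<kappa>) (S (- (int n * s)) w) else 0)" if s: "s > 0" for s
  proof -
    have "l - k \<noteq> int n * (- s)"
    proof -
      have "0 < int n * s" using s n_pos by simp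
      then show ?thesis using kl by simp
    qed
    then have "e k l (S (- (int n * s)) x) = S (- (int n * s)) (e k l x)" for x
      using S_e_imaginary[of k l "- s" x] by simp
    then show ?thesis
      using S_e_imaginary[of k l s w] by simp
  qed
  have "e k l (\<Sum>s=1..N. S (- (int n * s)) (S (int n * s) w)) = (\<Sum>s=1..N. S (- (int n * s)) (S (int n * s) (e k l w)))
      + (\<Sum>s=1..N. if l - k = int n * s then scale (of_int s * \<kappa>) (S (- (int n * s)) w) else 0)"
    unfolding e_sum[of k l _ "{1..N}"] sum.distrib[symmetric]
    by (rule sum.cong) (auto simp: heis)
  then have "casimir N (\<lambda>i j. e i j (e k l w)) = e k l (casimir N (\<lambda>i j. e i j w)) + e k l (e l l w) - e k l (e k k w)
     + ((\<Sum>j\<in>{k<..<l}. e k l w - (if int n dvd l - k then e (j - (l - k)) j w else 0))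
     + scale (1 / \<kappa>) (\<Sum>s=1..N. if l - k = int n * s then scale (of_int s * \<kappa>) (S (- (int n * s)) w) else 0))"
    using root PQ by (simp add: casimir_def scale_right_diff_distrib scale_right_distrib S_def[symmetric])
  also have "(\<Sum>j\<in>{k<..<l}. e k l w - (if int n dvd l - k then e (j - (l - k)) j w else 0))
     + scale (1 / \<kappa>) (\<Sum>s=1..N. if l - k = int n * s then scale (of_int s * \<kappa>) (S (- (int n * s)) w) else 0)
     = scale (of_int (l - k) - (if int n dvd l - k then 0 else 1)) (e k l w)"
  proof (rule telescoped_brackets[OF kl])
    show "e (i + int n - (l - k)) (i + int n) w = e (i - (l - k)) i w" for i
      using e_per[of "i - (l - k)" i w] kl by (simp add: algebra_simps)
    show "e (k - (l - k)) k w = e k l w" if "int n dvd l - k"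
    proof -
      from that obtain s where s: "l - k = int n * s" by auto
      then show ?thesis using e_shift[of "k - (l - k)" s k w] kl by (auto simp: algebra_simps split: if_splits)
    qed
    show "S (- (int n * s)) w = (\<Sum>i=1..int n. e (i - (l - k)) i w)" if "l - k = int n * s" for s
      unfolding that by (simp add: S_def)
  qed
  finally show ?thesis .
qed

end

section \<open>Verma modules\<close>

lemma basis_bracket_affgl:
  assumes "single x 1 \<in> affgl n" "single y 1 \<in> affgl n"
  shows "basis_bracket x y \<in> affgl n"
proof -
  have *: "single (Loop k a b) c \<in> affgl n" if "a \<in> {1..n}" "b \<in> {1..n}" for k a b c
    using that by (intro affgl_single) auto
  have "single Gam c \<in> affgl n" for c by (intro affgl_single) auto
  with * assms show ?thesis
    by (cases x; cases y) (auto simp: affgl_def[of n, THEN eqset_imp_iff, of "single (Loop _ _ _) (1::complex)"])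
qed

lemma bracket_affgl [simp]:
  assumes "X \<in> affgl n" "Y \<in> affgl n"
  shows "bracket X Y \<in> affgl n"
proof -
  have "single x 1 \<in> affgl n" if "Z \<in> affgl n" "x \<in> keys Z" for x Z
    using that by (intro affgl_single) (cases x; auto simp: affgl_def)
  then show ?thesis
    unfolding bracket_def using assms by (intro affgl_sum affgl_smul basis_bracket_affgl)
qed

lemma nplus_affgl:
  assumes "n \<ge> 1" "X \<in> nplus n"
  shows "X \<in> affgl n"
  using assms(2) by induction (use assms(1) in simp_all)

locale verma_rep = verma + affgl_rep
begin

abbreviation pc :: "(nat \<Rightarrow> int) \<Rightarrow> 'a set" where
  "pc d \<equiv> piece n scale act v d"

text \<open>The elements of \<open>nplus n\<close> other than the \<open>E n i j\<close> act by iterated combinations and commutators of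
  these.\<close>

lemma act_nplus_closed:
  assumes "subspace P" "\<And>i j w. i < j \<Longrightarrow> w \<in> P \<Longrightarrow> e i j w \<in> P"
    and "X \<in> nplus n" "w \<in> P"
  shows "act X w \<in> P"
  using assms(3,4)
proof (induction X arbitrary: w rule: nplus.induct)
  case (gen i j)
  then show ?case using assms(2) by simp
next
  case (add X Y)
  then show ?case using assms(1) nplus_affgl[OF n_pos] by (simp add: act_add subspace_add)
next
  case (smul X c)
  then show ?case using assms(1) nplus_affgl[OF n_pos] by (simp add: act_smul subspace_scale)
next
  case (bracket X Y)
  then show ?case using assms(1) nplus_affgl[OF n_pos] by (simp add: act_bracket subspace_diff)
qed

lemma generated:
  assumes P: "subspace P" "v \<in> P" "\<And>i j w. i < j \<Longrightarrow> w \<in> P \<Longrightarrow> e i j w \<in> P"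
  shows "w \<in> P"
proof -
  obtain Q where Q: "keys Q \<subseteq> lists (nplus n)" "env_act scale act Q v = w"
    using free unfolding freely_generated_def by blast
  have "foldr act ws v \<in> P" if "ws \<in> lists (nplus n)" for ws
    using that by (induction ws) (use P act_nplus_closed[OF P(1,3)] in auto)
  then show ?thesis
    unfolding Q(2)[symmetric] env_act_def
    by (intro subspace_sum[OF P(1)] subspace_scale[OF P(1)]) (use Q(1) in auto)
qed

lemma verma_induct [case_names zero add scale base raise]:
  assumes "P 0" "\<And>w w'. P w \<Longrightarrow> P w' \<Longrightarrow> P (w + w')" "\<And>c w. P w \<Longrightarrow> P (scale c w)"
    "P v" "\<And>i j w. i < j \<Longrightarrow> P w \<Longrightarrow> P (e i j w)"
  shows "P w"
  using generated[of "{w. P w}" w] assms by (auto simp: subspace_def)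

lemma gam_v: "act gam w = scale (of_nat n + p) w"
  by (induction w rule: verma_induct)
     (simp_all add: act_lin gam_comm level scale_right_distrib scale_left_commute)

lemma subspace_pc: "subspace (pc d)"
  unfolding piece_def by (rule subspace_span)

lemmas pc_closed = subspace_0[OF subspace_pc] subspace_add[OF subspace_pc]
  subspace_scale[OF subspace_pc] subspace_sum[OF subspace_pc] subspace_diff[OF subspace_pc]
  subspace_neg[OF subspace_pc]

lemma raise_pc:
  assumes "i < j" "w \<in> pc d"
  shows "e i j w \<in> pc (\<lambda>r. d r + edeg n i j r)"
  using assms(2) unfolding piece_def[of n scale act v d]
proof (induction rule: span_induct)
  case base
  have "subspace {w. e i j w \<in> pc (\<lambda>r. d r + edeg n i j r)}"
    by (auto simp: subspace_def pc_closed)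
  then show ?case by simp
next
  case (step x)
  then obtain ws where ws: "x = foldr act (map (\<lambda>(i, j). E n i j) ws) v"
    "\<forall>(i, j)\<in>set ws. i < j" "\<forall>r. (\<Sum>(i, j)\<leftarrow>ws. edeg n i j r) = d r" by blast
  show ?case unfolding piece_def
    by (rule span_base, intro CollectI exI[of _ "(i, j) # ws"]) (use ws assms in auto)
qed

lemma v_pc: "v \<in> pc (\<lambda>_. 0)"
  unfolding piece_def by (rule span_base, intro CollectI exI[of _ "[]"]) auto

lemma piece_induct [consumes 1, case_names zero add scale base raise]:
  assumes "w \<in> pc d"
    and zero: "\<And>d. Q d 0" and add: "\<And>d w w'. Q d w \<Longrightarrow> Q d w' \<Longrightarrow> Q d (w + w')"
    and sc: "\<And>d c w. Q d w \<Longrightarrow> Q d (scale c w)"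
    and base: "Q (\<lambda>_. 0) v"
    and raise: "\<And>d i j w. i < j \<Longrightarrow> w \<in> pc d \<Longrightarrow> Q d w \<Longrightarrow> Q (\<lambda>r. d r + edeg n i j r) (e i j w)"
  shows "Q d w"
  using assms(1) unfolding piece_def[of n scale act v d]
proof (induction rule: span_induct)
  case base
  then show ?case using zero add sc by (auto simp: subspace_def)
next
  case (step x)
  then obtain ws where ws: "x = foldr act (map (\<lambda>(i, j). E n i j) ws) v"
    "\<forall>(i, j)\<in>set ws. i < j" "\<forall>r. (\<Sum>(i, j)\<leftarrow>ws. edeg n i j r) = d r" by blast
  have "foldr act (map (\<lambda>(i, j). E n i j) ws) v \<in> pc (\<lambda>r. \<Sum>(i, j)\<leftarrow>ws. edeg n i j r) \<and>
    Q (\<lambda>r. \<Sum>(i, j)\<leftarrow>ws. edeg n i j r) (foldr act (map (\<lambda>(i, j). E n i j) ws) v)"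
    using ws(2)
  proof (induction ws)
    case Nil
    then show ?case using base v_pc by simp
  next
    case (Cons ij ws)
    obtain i j where ij: "ij = (i, j)" by fastforce
    have eq: "(\<lambda>r. \<Sum>(i, j)\<leftarrow>ij # ws. edeg n i j r) = (\<lambda>r. (\<Sum>(i, j)\<leftarrow>ws. edeg n i j r) + edeg n i j r)"
      by (simp add: ij add.commute)
    show ?case
      unfolding eq using Cons raise[of i j] raise_pc[of i j] by (auto simp: ij)
  qed
  moreover have "(\<lambda>r. \<Sum>(i, j)\<leftarrow>ws. edeg n i j r) = d" using ws(3) by auto
  ultimately show ?case using ws(1) by simp
qed

text \<open>Every letter of a word raises the total degree by at least one.\<close>

lemma pc_bounded:
  assumes "w \<in> pc d"
  shows "w = 0 \<or> tdeg n d > 0 \<or> d = (\<lambda>_. 0) \<and> w \<in> span {v}"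
    and "w = 0 \<or> (\<forall>r. r \<notin> {1..n} \<longrightarrow> d r = 0)"
proof -
  show "w = 0 \<or> tdeg n d > 0 \<or> d = (\<lambda>_. 0) \<and> w \<in> span {v}"
    using assms
  proof (induction rule: piece_induct)
    case (raise d i j w)
    then have "w = 0 \<or> tdeg n d \<ge> 0" by auto
    then show ?case using n_pos raise(1) by (auto simp: tdeg_edeg[of n i j])
  qed (auto simp: span_base span_add span_scale)
  show "w = 0 \<or> (\<forall>r. r \<notin> {1..n} \<longrightarrow> d r = 0)"
    using assms by (induction rule: piece_induct) (use edeg_unsupported[OF n_pos] in auto)
qed

lemma pc_negative: "w \<in> pc d \<Longrightarrow> tdeg n d < 0 \<Longrightarrow> w = 0"
  using pc_bounded(1)[of w d] by auto

text \<open>A letter that does not raise is commuted through the word until it meets the generator; the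
  brackets that arise are homogeneous of the right degree.\<close>

lemma e_pc: "w \<in> pc d \<Longrightarrow> e k l w \<in> pc (\<lambda>r. d r + edeg n k l r)"
proof (induction arbitrary: k l rule: piece_induct)
  case base
  show ?case
  proof (cases "k < l")
    case True
    then show ?thesis using raise_pc[OF True v_pc] by simp
  next
    case False
    show ?thesis
    proof (cases "k = l")
      case True
      have "e k k v \<in> pc (\<lambda>_. 0)"
        unfolding e_diag_res[of k] weight[OF res_range[OF n_pos]] level by (simp add: pc_closed v_pc)
      then show ?thesis using True by simp
    qed (use False lower[of l k] in \<open>simp add: pc_closed\<close>)
  qed
next
  case (raise d i j w)
  have "e i j (e k l w) \<in> pc (\<lambda>r. d r + edeg n k l r + edeg n i j r)"
    by (rule raise_pc) (use raise in auto)
  then have 1: "e i j (e k l w) \<in> pc (\<lambda>r. d r + edeg n i j r + edeg n k l r)"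
    by (simp add: ac_simps)
  have 2: "e k (j + l - i) w \<in> pc (\<lambda>r. d r + edeg n i j r + edeg n k l r)" if "int n dvd l - i"
    using raise(3)[of k "j + l - i"] edeg_comp(1)[OF n_pos that, of k j] by (simp add: ac_simps)
  have 3: "e (i + k - j) l w \<in> pc (\<lambda>r. d r + edeg n i j r + edeg n k l r)" if "int n dvd k - j"
    using raise(3)[of "i + k - j" l] edeg_comp(2)[OF n_pos, of j k i l] that
    by (simp add: dvd_diff_commute ac_simps)
  show ?case
    unfolding e_comm[of k l i j] using 1 2 3 by (auto intro!: pc_closed)
qed (simp_all add: pc_closed)

text \<open>The parameters, continued to all indices by \<open>a\<^sub>k\<^sub>+\<^sub>n = a\<^sub>k - p\<close>. As \<open>E\<^sub>k\<^sub>+\<^sub>n\<^sub>,\<^sub>k\<^sub>+\<^sub>n = E\<^sub>k\<^sub>k - \<gamma>\<close> and \<open>\<gamma> = n + p\<close>, the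
  eigenvalue \<open>a\<^sub>k - k\<close> of \<open>E\<^sub>k\<^sub>k\<close> on the generator keeps its form for all integers \<open>k\<close>.\<close>

definition shifted_a :: "int \<Rightarrow> complex" where
  "shifted_a k = a (res n k) - p * of_int ((k - 1) div int n)"

definition weight_at :: "(nat \<Rightarrow> int) \<Rightarrow> int \<Rightarrow> complex" where
  "weight_at d k = shifted_a k - of_int k + of_int (wt n d k)"

lemma e_diag_v: "e k k v = scale (shifted_a k - of_int k) v"
proof -
  let ?t = "(k - 1) div int n"
  have "e k k v = scale (a (res n k) - of_nat (res n k) - of_int ?t * (of_nat n + p)) v"
    unfolding e_diag_res[of k] weight[OF res_range[OF n_pos]] level by (simp add: scale_left_diff_distrib)
  also have "a (res n k) - of_nat (res n k) - of_int ?t * (of_nat n + p) = shifted_a k - of_int (int (res n k) + int n * ?t)"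
    by (simp add: shifted_a_def algebra_simps)
  finally show ?thesis by (simp add: res_decomp[OF n_pos])
qed

lemma weight_pc: "w \<in> pc d \<Longrightarrow> e k k w = scale (weight_at d k) w"
proof (induction rule: piece_induct)
  case base
  show ?case by (simp add: e_diag_v weight_at_def)
next
  case (raise d i j w)
  have "(if int n dvd k - i then e k (j + k - i) w else 0) = (if int n dvd i - k then e i j w else 0)"
  proof (cases "int n dvd k - i")
    case True
    then obtain t where "k - i = int n * t" by auto
    then have "e k (j + k - i) w = e i j w"
      using e_shift[of i t j w] raise(1) by (simp add: algebra_simps)
    then show ?thesis using True by (simp add: dvd_diff_commute)
  qed (simp add: dvd_diff_commute)
  moreover have "(if int n dvd k - j then e (i + k - j) k w else 0) = (if int n dvd j - k then e i j w else 0)"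
  proof (cases "int n dvd k - j")
    case True
    then obtain t where "k - j = int n * t" by auto
    then have "e (i + k - j) k w = e i j w"
      using e_shift[of i t j w] raise(1) by (simp add: algebra_simps)
    then show ?thesis using True by (simp add: dvd_diff_commute)
  qed (simp add: dvd_diff_commute)
  ultimately have "e k k (e i j w) = scale (weight_at d k) (e i j w) + (if int n dvd i - k then e i j w else 0)
      - (if int n dvd j - k then e i j w else 0)"
    using raise(3) by (simp add: e_comm[of k k i j])
  then show ?case
    by (auto simp: weight_at_def wt_edeg[OF n_pos] scale_left_distrib scale_left_diff_distrib algebra_simps)
qed (simp_all add: scale_right_distrib scale_left_commute)

text \<open>The eigenvalue of the Casimir operator in degree \<open>d\<close>. The commutators with \<open>e k l\<close> determine its
  increments, and this is the quadratic function that has them (\<open>casimir_value_add\<close>).\<close>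

definition casimir_value :: "(nat \<Rightarrow> int) \<Rightarrow> complex" where
  "casimir_value d = (\<Sum>r=1..n. of_int (d r) * (shifted_a (int r + 1) - shifted_a (int r)))
     - (\<Sum>k=1..int n. of_int (wt n d k) ^ 2) / 2"

lemma shifted_a_step: "shifted_a (int (res n k) + 1) - shifted_a (int (res n k)) = shifted_a (k + 1) - shifted_a k"
proof -
  have "shifted_a (i + int n * t) = shifted_a i - p * of_int t" for i t
    unfolding shifted_a_def block_shift[OF n_pos] by (simp add: algebra_simps)
  from this[of "int (res n k)" "(k - 1) div int n"] this[of "int (res n k) + 1" "(k - 1) div int n"]
  show ?thesis using res_decomp[OF n_pos, of k] by (simp add: ac_simps)
qed

lemma casimir_linear_edeg:
  "(\<Sum>r=1..n. of_int (edeg n k l r) * (shifted_a (int r + 1) - shifted_a (int r))) = shifted_a l - shifted_a k"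
proof (induction l rule: int_step_induct[where i = k])
  case (step l)
  have "(\<Sum>r=1..n. of_int (edeg n k (l + 1) r) * (shifted_a (int r + 1) - shifted_a (int r)))
    = (\<Sum>r=1..n. of_int (edeg n k l r) * (shifted_a (int r + 1) - shifted_a (int r)))
      + (\<Sum>r=1..n. if res n l = r then shifted_a (int r + 1) - shifted_a (int r) else 0)"
    unfolding sum.distrib[symmetric] by (rule sum.cong) (auto simp: edeg_step distrib_right)
  also have "(\<Sum>r=1..n. if res n l = r then shifted_a (int r + 1) - shifted_a (int r) else 0) = shifted_a (l + 1) - shifted_a l"
    using res_range[OF n_pos, of l] by (simp add: shifted_a_step)
  finally have eq: "(\<Sum>r=1..n. of_int (edeg n k (l + 1) r) * (shifted_a (int r + 1) - shifted_a (int r)))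
    = (\<Sum>r=1..n. of_int (edeg n k l r) * (shifted_a (int r + 1) - shifted_a (int r))) + (shifted_a (l + 1) - shifted_a l)" .
  have "X = s - u \<longleftrightarrow> X + (t - s) = t - u" for X s t u :: complex by (auto simp: algebra_simps)
  then show ?case unfolding eq .
qed simp

text \<open>The quadratic part accounts for the weights in \<open>weight_at\<close> and for the last summand: the square of the
  weight \<open>\<epsilon>\<^sub>k - \<epsilon>\<^sub>l\<close> of \<open>e k l\<close> is two, or zero if \<open>n dvd l - k\<close>.\<close>

lemma casimir_value_add:
  "casimir_value (\<lambda>r. d r + edeg n k l r) = casimir_value d + weight_at d l - weight_at d k
     + of_int (l - k) - (if int n dvd l - k then 0 else 1)"
proof -
  define \<delta> :: "int \<Rightarrow> int \<Rightarrow> complex" where "\<delta> k i = (if int n dvd i - k then 1 else 0)" for k i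
  have wt_per: "wt n d (i + int n) = wt n d i" for i
    using block_shift(2)[OF n_pos, of i 1] block_shift(2)[OF n_pos, of "i - 1" 1] by (simp add: wt_def algebra_simps)
  have \<delta>_per: "\<delta> k (i + int n) = \<delta> k i" for k i
    using dvd_add_left_iff[of "int n" "int n" "i - k"] by (simp add: \<delta>_def algebra_simps)
  have res_sum: "(\<Sum>i=1..int n. \<delta> k i * \<phi> i) = \<phi> k" if "\<And>i. \<phi> (i + int n) = \<phi> i" for k and \<phi> :: "int \<Rightarrow> complex"
    using sum_residue[OF n_pos, of \<phi> k, OF that] by (simp add: \<delta>_def if_distrib[of "\<lambda>x. x * _"] cong: if_cong)
  have "(\<Sum>i=1..int n. of_int (wt n (\<lambda>r. d r + edeg n k l r) i) ^ 2) =
    (\<Sum>i=1..int n. of_int (wt n d i) ^ 2 + 2 * (\<delta> k i * of_int (wt n d i)) - 2 * (\<delta> l i * of_int (wt n d i))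
      + \<delta> k i * \<delta> k i + \<delta> l i * \<delta> l i - 2 * (\<delta> k i * \<delta> l i))"
  proof (rule sum.cong)
    fix i
    have "of_int (wt n (\<lambda>r. d r + edeg n k l r) i) = of_int (wt n d i) + \<delta> k i - \<delta> l i"
      using dvd_diff_commute[of "int n"] by (simp add: wt_edeg[OF n_pos] \<delta>_def)
    then show "of_int (wt n (\<lambda>r. d r + edeg n k l r) i) ^ 2 = of_int (wt n d i) ^ 2 + 2 * (\<delta> k i * of_int (wt n d i)) - 2 * (\<delta> l i * of_int (wt n d i))
      + \<delta> k i * \<delta> k i + \<delta> l i * \<delta> l i - 2 * (\<delta> k i * \<delta> l i)"
      by (simp only:) (simp add: power2_eq_square algebra_simps)
  qed simp
  also have "\<dots> = (\<Sum>i=1..int n. of_int (wt n d i) ^ 2) + 2 * of_int (wt n d k) - 2 * of_int (wt n d l)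
      + \<delta> k k + \<delta> l l - 2 * \<delta> l k"
    unfolding sum.distrib sum_subtractf sum_distrib_left[symmetric]
    by (subst (1 2 3 4 5) res_sum) (simp_all add: wt_per \<delta>_per)
  finally have quad: "(\<Sum>i=1..int n. of_int (wt n (\<lambda>r. d r + edeg n k l r) i) ^ 2) =
    (\<Sum>i=1..int n. of_int (wt n d i) ^ 2) + 2 * (of_int (wt n d k) - of_int (wt n d l) + 1 - \<delta> l k)"
    by (simp add: \<delta>_def)
  have \<delta>: "(if int n dvd l - k then 0 else 1) = 1 - \<delta> l k"
    by (simp add: \<delta>_def dvd_diff_commute)
  have "casimir_value (\<lambda>r. d r + edeg n k l r) =
      (\<Sum>r=1..n. of_int (d r) * (shifted_a (int r + 1) - shifted_a (int r)))
      + (\<Sum>r=1..n. of_int (edeg n k l r) * (shifted_a (int r + 1) - shifted_a (int r)))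
      - (\<Sum>i=1..int n. of_int (wt n (\<lambda>r. d r + edeg n k l r) i) ^ 2) / 2"
    by (simp add: casimir_value_def sum.distrib distrib_right del: wt_add)
  moreover have "L + (s - t) - (A + 2 * (x - y + 1 - z)) / 2
      = L - A / 2 + (s - l + y) - (t - k + x) + (l - k) - (1 - z)" for L A x y z s t l k :: complex
    by (simp add: field_simps)
  ultimately show ?thesis
    unfolding casimir_linear_edeg quad \<delta> casimir_value_def[of d] weight_at_def of_int_diff by simp
qed

lemma casimir_value_0 [simp]: "casimir_value (\<lambda>_. 0) = 0"
  by (simp add: casimir_value_def)

end

section \<open>Generic Verma modules\<close>

lemma alg_independent_linear:
  assumes ind: "alg_independent I x" and I: "finite I"
    and eq: "of_rat c0 + (\<Sum>i\<in>I. of_rat (c i) * x i) = 0"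
  shows "c0 = 0" "i \<in> I \<Longrightarrow> c i = 0"
proof -
  define mon :: "nat \<Rightarrow> (nat \<Rightarrow>\<^sub>0 nat)" where "mon i = single i 1" for i
  have inj: "mon i = mon j \<longleftrightarrow> i = j" "mon i \<noteq> 0" for i j
  proof -
    have "keys (mon i) = {i}" for i by (simp add: mon_def)
    then show "mon i = mon j \<longleftrightarrow> i = j" "mon i \<noteq> 0"
      by (metis singleton_inject, metis insert_not_empty keys_zero)
  qed
  define P :: "(nat \<Rightarrow>\<^sub>0 nat) \<Rightarrow>\<^sub>0 rat"
    where "P = single 0 c0 + (\<Sum>i\<in>I. single (mon i) (c i))"
  have P0: "lookup P 0 = c0"
    using inj(2) by (simp add: P_def lookup_add lookup_sum lookup_single)
  have Pm: "lookup P (mon i) = c i" if "i \<in> I" for i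
    using inj that I by (simp add: P_def lookup_add lookup_sum lookup_single when_def)
  have keys: "keys P \<subseteq> insert 0 (mon ` I)"
  proof
    fix e assume "e \<in> keys P"
    then have "lookup P e \<noteq> 0" by (simp add: in_keys_iff)
    then show "e \<in> insert 0 (mon ` I)"
      by (rule contrapos_np) (auto simp: P_def lookup_add lookup_sum lookup_single when_def intro!: sum.neutral)
  qed
  have "(\<Sum>e\<in>keys P. of_rat (lookup P e) * (\<Prod>i\<in>keys e. x i ^ lookup e i))
      = (\<Sum>e\<in>insert 0 (mon ` I). of_rat (lookup P e) * (\<Prod>i\<in>keys e. x i ^ lookup e i))"
    by (rule sum.mono_neutral_left) (use keys I in \<open>auto simp: in_keys_iff\<close>)
  also have "\<dots> = of_rat c0 + (\<Sum>i\<in>I. of_rat (lookup P (mon i)) * (\<Prod>j\<in>keys (mon i). x j ^ lookup (mon i) j))"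
    using I inj by (subst sum.insert) (auto simp: P0 sum.reindex inj_on_def)
  also have "\<dots> = of_rat c0 + (\<Sum>i\<in>I. of_rat (c i) * x i)"
    using Pm by (intro arg_cong2[of _ _ _ _ "(+)"] sum.cong) (auto simp: mon_def)
  finally have "(\<Sum>e\<in>keys P. of_rat (lookup P e) * (\<Prod>i\<in>keys e. x i ^ lookup e i)) = 0"
    using eq by simp
  moreover have "\<forall>e\<in>keys P. keys e \<subseteq> I"
  proof
    fix e assume "e \<in> keys P"
    then have "e = 0 \<or> (\<exists>i\<in>I. e = mon i)" using keys by auto
    then show "keys e \<subseteq> I" by (auto simp: mon_def split: if_splits)
  qed
  ultimately have "P = 0" using ind unfolding alg_independent_def by blast
  then show "c0 = 0" "i \<in> I \<Longrightarrow> c i = 0" using P0 Pm by auto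
qed

locale generic_verma = verma_rep +
  assumes generic: "generic n a p"
begin

lemma level_nonzero: "of_nat n + p \<noteq> 0"
proof
  assume "of_nat n + p = 0"
  moreover have "(\<Sum>i=0..n. of_rat (if i = 0 then 1 else 0) * (a(0 := p)) i) = (\<Sum>i=0..n. if i = 0 then p else 0)"
    by (rule sum.cong) auto
  ultimately have "of_rat (of_nat n) + (\<Sum>i=0..n. of_rat (if i = 0 then 1 else 0) * (a(0 := p)) i) = 0"
    by simp
  from alg_independent_linear(2)[OF generic[unfolded generic_def] _ this, of 0] show False by simp
qed

sublocale affgl_level scale n act "of_nat n + p"
  by unfold_locales (rule gam_v, rule level_nonzero)

text \<open>Summation by parts, to make the coefficients of \<open>p\<close> and of the \<open>a k\<close> visible.\<close>

lemma casimir_linear_part: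
  "(\<Sum>r=1..n. of_int (d r) * (shifted_a (int r + 1) - shifted_a (int r)))
    = - p * of_int (d n) - (\<Sum>k=1..n. a k * of_int (wt n d (int k)))"
proof -
  have a_lo: "shifted_a (int r) = a r" if "r \<in> {1..n}" for r
    using that by (auto simp: shifted_a_def)
  have a_hi: "shifted_a (int r + 1) = (if r = n then a 1 - p else a (Suc r))" if "r \<in> {1..n}" for r
  proof (cases "r = n")
    case True
    have "(1 + int n * 1 - 1) div int n = 1" "res n (1 + int n * 1) = 1"
      using block_shift[OF n_pos, of 1 1] n_pos res_id[of 1 n] by auto
    then show ?thesis using True by (simp add: shifted_a_def add.commute)
  next
    case False
    then have "shifted_a (int (Suc r)) = a (Suc r)" using that by (intro a_lo) auto
    then show ?thesis using False by (simp add: add.commute)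
  qed
  obtain N where N: "n = Suc N" using n_pos by (cases n) auto
  have wt1: "wt n d 1 = d 1 - d n" 
    using block_shift(2)[OF n_pos, of 0 1] n_pos res_id[of 1 n] res_id[of n n] by (simp add: wt_def)
  have wtS: "wt n d (int (Suc k)) = d (Suc k) - d k" if "k \<in> {1..N}" for k
    using that res_id[of "Suc k" n] res_id[of k n] N by (simp add: wt_def)
  have "(\<Sum>r=1..n. of_int (d r) * shifted_a (int r + 1))
      = (\<Sum>r=1..n. of_int (d r) * (if r = n then a 1 - p else a (Suc r)))"
    by (rule sum.cong) (auto simp: a_hi)
  also have "\<dots> = (\<Sum>r=1..N. of_int (d r) * a (Suc r)) + of_int (d n) * (a 1 - p)"
  proof -
    have "(\<Sum>r=1..N. of_int (d r) * (if r = n then a 1 - p else a (Suc r))) = (\<Sum>r=1..N. of_int (d r) * a (Suc r))"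
      by (rule sum.cong) (use N in auto)
    then show ?thesis unfolding N by simp
  qed
  finally have hi: "(\<Sum>r=1..n. of_int (d r) * shifted_a (int r + 1))
      = (\<Sum>r=1..N. of_int (d r) * a (Suc r)) + of_int (d n) * (a 1 - p)" .
  have split: "(\<Sum>k=1..n. \<phi> k) = \<phi> 1 + (\<Sum>k=1..N. \<phi> (Suc k))" for \<phi> :: "nat \<Rightarrow> complex"
    unfolding N by (subst sum.atLeast_Suc_atMost) (auto simp flip: sum.shift_bounds_cl_Suc_ivl)
  have lo: "(\<Sum>r=1..n. of_int (d r) * shifted_a (int r)) = of_int (d 1) * a 1 + (\<Sum>k=1..N. of_int (d (Suc k)) * a (Suc k))"
  proof -
    have "(\<Sum>k=1..N. of_int (d (Suc k)) * shifted_a (int (Suc k))) = (\<Sum>k=1..N. of_int (d (Suc k)) * a (Suc k))"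
    proof (rule sum.cong)
      fix k assume "k \<in> {1..N}"
      then have "Suc k \<in> {1..n}" using N by auto
      then show "of_int (d (Suc k)) * shifted_a (int (Suc k)) = of_int (d (Suc k)) * a (Suc k)"
        using a_lo[of "Suc k"] by (simp only:)
    qed simp
    moreover have "1 \<in> {1..n}" using n_pos by simp
    ultimately show ?thesis unfolding split using a_lo[of 1] by simp
  qed
  have "(\<Sum>k=1..n. a k * of_int (wt n d (int k))) = a 1 * of_int (d 1 - d n) + (\<Sum>k=1..N. a (Suc k) * of_int (d (Suc k) - d k))"
    unfolding split using wt1 wtS by simp
  also have "\<dots> = a 1 * (of_int (d 1) - of_int (d n)) + (\<Sum>k=1..N. of_int (d (Suc k)) * a (Suc k)) - (\<Sum>k=1..N. of_int (d k) * a (Suc k))"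
    by (simp add: algebra_simps sum_subtractf)
  finally show ?thesis
    unfolding right_diff_distrib sum_subtractf hi lo by (simp add: algebra_simps)
qed

text \<open>By algebraic independence all coefficients of the linear form vanish: \<open>d n = 0\<close>, and \<open>d\<close> does not
  change from one index to the next.\<close>

lemma casimir_value_nonzero:
  assumes supp: "\<And>r. r \<notin> {1..n} \<Longrightarrow> d r = 0" and "casimir_value d = 0"
  shows "d = (\<lambda>_. 0)"
proof -
  define c :: "nat \<Rightarrow> rat" where "c i = (if i = 0 then - of_int (d n) else - of_int (wt n d (int i)))" for i
  define c0 :: rat where "c0 = - (\<Sum>k=1..int n. of_int (wt n d k) ^ 2) / 2"
  have "{0..n} = insert 0 {1..n}" by auto
  then have "(\<Sum>i=0..n. of_rat (c i) * (a(0 := p)) i) = of_rat (c 0) * p + (\<Sum>i=1..n. of_rat (c i) * (a(0 := p)) i)"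
    by simp
  also have "(\<Sum>i=1..n. of_rat (c i) * (a(0 := p)) i) = - (\<Sum>k=1..n. a k * of_int (wt n d (int k)))"
    unfolding sum_negf[symmetric] by (rule sum.cong) (auto simp: c_def of_rat_minus)
  also have "of_rat (c 0) = (- of_int (d n) :: complex)" by (simp add: c_def of_rat_minus)
  finally have "(\<Sum>i=0..n. of_rat (c i) * (a(0 := p)) i)
     = (\<Sum>r=1..n. of_int (d r) * (shifted_a (int r + 1) - shifted_a (int r)))"
    unfolding casimir_linear_part by simp
  moreover have "of_rat c0 = (- (\<Sum>k=1..int n. of_int (wt n d k) ^ 2) / 2 :: complex)"
    by (simp add: c0_def of_rat_minus of_rat_divide of_rat_sum of_rat_power)
  ultimately have "of_rat c0 + (\<Sum>i=0..n. of_rat (c i) * (a(0 := p)) i) = 0"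
    using assms(2) by (simp add: casimir_value_def)
  from alg_independent_linear(2)[OF generic[unfolded generic_def] _ this]
  have c: "c i = 0" if "i \<in> {0..n}" for i using that by simp
  have dn: "d n = 0" using c[of 0] by (simp add: c_def)
  have "d k = 0" if "k \<in> {1..n}" for k
    using that
  proof (induction k)
    case (Suc k)
    have "wt n d (int (Suc k)) = 0" using c[of "Suc k"] Suc.prems by (simp add: c_def)
    moreover have "d (res n (int k)) = 0"
    proof (cases "k = 0")
      case True
      then show ?thesis using dn block_shift(2)[OF n_pos, of 0 1] res_id[of n n] n_pos by simp
    next
      case False
      then show ?thesis using Suc res_id[of k n] by simp
    qed
    ultimately show ?case using res_id[of "Suc k" n] Suc.prems by (simp add: wt_def)
  qed simp
  with supp show ?thesis by (metis ext)
qed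

lemma casimir_linear:
  "casimir N (\<lambda>i j. 0) = 0"
  "casimir N (\<lambda>i j. g i j + g' i j) = casimir N g + casimir N g'"
  "casimir N (\<lambda>i j. scale c (g i j)) = scale c (casimir N g)"
proof -
  show "casimir N (\<lambda>i j. 0) = 0" by (simp add: casimir_def)
  show "casimir N (\<lambda>i j. g i j + g' i j) = casimir N g + casimir N g'"
    by (simp add: casimir_def sum.distrib scale_right_distrib)
  show "casimir N (\<lambda>i j. scale c (g i j)) = scale c (casimir N g)"
    by (simp add: casimir_def scale_sum_right[symmetric] scale_right_diff_distrib scale_left_commute)
qed

lemma casimir_cong:
  assumes "\<And>i j. i > j \<Longrightarrow> g i j = g' i j"
  shows "casimir N g = casimir N g'"
proof -
  have "(\<Sum>i=1..int n. g (i + int n * s) i) = (\<Sum>i=1..int n. g' (i + int n * s) i)" if "s \<in> {1..N}" for s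
    using that n_pos by (intro sum.cong assms) auto
  then show ?thesis
    unfolding casimir_def by (intro arg_cong2[of _ _ _ _ "(-)"] arg_cong[of _ _ "scale _"] sum.cong) (auto simp: assms)
qed

text \<open>Both sides vanish on the generator, and \<open>casimir_raise\<close> and \<open>casimir_value_add\<close> show that they change
  in the same way when a raising operator is applied.\<close>

theorem casimir_scalar:
  assumes "w \<in> pc d" "tdeg n d \<le> N"
  shows "casimir N (\<lambda>i j. e i j w) = scale (casimir_value d) w"
  using assms
proof (induction rule: piece_induct)
  case base
  have "casimir N (\<lambda>i j. e i j v) = casimir N (\<lambda>i j. 0)"
    by (rule casimir_cong) (rule lower)
  then show ?case by (simp add: casimir_linear)
next
  case (raise d k l w)
  then have kl: "k < l" and w: "w \<in> pc d" by auto
  show ?case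
  proof (cases "tdeg n d < 0")
    case True
    then show ?thesis using pc_negative[OF w] by (simp add: casimir_linear)
  next
    case False
    have N: "N \<ge> tdeg n d + (l - k)" using raise.prems n_pos by simp
    have bound: "e i j w = 0" if "i - j > N - (l - k)" for i j
      by (rule pc_negative[OF e_pc[OF w]]) (use that N n_pos in simp)
    have "casimir N (\<lambda>i j. e i j (e k l w)) = e k l (casimir N (\<lambda>i j. e i j w)) + e k l (e l l w) - e k l (e k k w)
      + scale (of_int (l - k) - (if int n dvd l - k then 0 else 1)) (e k l w)"
      by (rule casimir_raise) (use bound kl N False in auto)
    also have "casimir N (\<lambda>i j. e i j w) = scale (casimir_value d) w"
      using raise.IH N kl by auto
    also have "e k l (scale (casimir_value d) w) + e k l (e l l w) - e k l (e k k w)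
      + scale (of_int (l - k) - (if int n dvd l - k then 0 else 1)) (e k l w)
      = scale (casimir_value (\<lambda>r. d r + edeg n k l r)) (e k l w)"
      unfolding casimir_value_add
      by (simp add: weight_pc[OF w] scale_left_distrib scale_left_diff_distrib)
    finally show ?thesis .
  qed
qed (simp_all add: casimir_linear scale_right_distrib scale_left_commute)

text \<open>The Casimir operator kills such a vector, since its products end in a lowering operator; but it acts by a
  number other than zero.\<close>

theorem no_singular:
  assumes "w \<in> pc d" "d \<noteq> (\<lambda>_. 0)" "\<And>i j. i > j \<Longrightarrow> e i j w = 0"
  shows "w = 0"
proof (rule ccontr)
  assume "w \<noteq> 0"
  then have "\<forall>r. r \<notin> {1..n} \<longrightarrow> d r = 0" using pc_bounded(2)[OF assms(1)] by auto
  then have nz: "casimir_value d \<noteq> 0" using casimir_value_nonzero[of d] assms(2) by blast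
  have "scale (casimir_value d) w = casimir (tdeg n d) (\<lambda>i j. e i j w)"
    using casimir_scalar[OF assms(1)] by simp
  also have "\<dots> = casimir (tdeg n d) (\<lambda>i j. 0)"
    by (rule casimir_cong) (rule assms(3))
  finally show False using nz \<open>w \<noteq> 0\<close> by (simp add: casimir_linear)
qed

lemma casimir_pc:
  assumes "\<And>i j. i > j \<Longrightarrow> g i j \<in> pc (\<lambda>r. d r + edeg n i j r)"
  shows "casimir N g \<in> pc d"
proof -
  have 1: "e j i (g i j) \<in> pc d" if "i > j" for i j
  proof -
    have "(\<lambda>r. d r + edeg n i j r + edeg n j i r) = d" by (simp add: edeg_swap[of n i j])
    then show ?thesis using e_pc[OF assms[OF that], of j i] by simp
  qed
  have 2: "S (- (int n * s)) (\<Sum>i=1..int n. g (i + int n * s) i) \<in> pc d" if "s \<ge> 1" for s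
  proof -
    have ns: "int n * s > 0" using that n_pos by simp
    have im: "edeg n (i + int n * s) i r = edeg n (1 + int n * s) 1 r" for i r
    proof (induction i rule: int_step_induct[where i = 1])
      case (step i)
      have "edeg n (i + 1 + int n * s) (i + 1) r = edeg n (i + int n * s) i r"
        using edeg_step[of n "i + int n * s" i r] edeg_step[of n "i + 1 + int n * s" "i + int n * s" r]
          edeg_trans[of n "i + 1 + int n * s" "i + int n * s" r "i + 1"]
          edeg_swap[of n "i + 1 + int n * s" "i + int n * s" r] edeg_step[of n "i + int n * s" "i + int n * s" r]
          block_shift(2)[OF n_pos, of i s] by (auto simp: algebra_simps)
      then show ?case by simp
    qed simp
    have "(\<Sum>i=1..int n. g (i + int n * s) i) \<in> pc (\<lambda>r. d r + edeg n (1 + int n * s) 1 r)"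
    proof (rule pc_closed(4))
      fix i
      have "(\<lambda>r. d r + edeg n (i + int n * s) i r) = (\<lambda>r. d r + edeg n (1 + int n * s) 1 r)"
        unfolding im[of i] ..
      then show "g (i + int n * s) i \<in> pc (\<lambda>r. d r + edeg n (1 + int n * s) 1 r)"
        using assms[of i "i + int n * s"] ns by simp
    qed
    moreover have "(\<lambda>r. d r + edeg n (1 + int n * s) 1 r + edeg n (i - int n * s) i r) = d" for i
    proof -
      have "edeg n (i - int n * s) i r = edeg n i (i + int n * s) r" for r
        using edeg_periodic[OF n_pos, of "i - int n * s" s i r] by simp
      then show ?thesis
        unfolding im[of i, symmetric] using edeg_swap[of n i "i + int n * s"] by simp
    qed
    ultimately have "e (i - int n * s) i (\<Sum>i=1..int n. g (i + int n * s) i) \<in> pc d" for i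
      using e_pc[of _ "\<lambda>r. d r + edeg n (1 + int n * s) 1 r" "i - int n * s" i] by simp
    then show ?thesis
      unfolding S_def by (intro pc_closed(4)) simp
  qed
  show ?thesis
    unfolding casimir_def by (intro pc_closed) (use 1 2 in auto)
qed

text \<open>The Casimir operator as a contracting homotopy: by \<open>casimir_lower\<close>, lowering the Casimir sum of \<open>g\<close>
  multiplies \<open>g k l\<close> by the eigenvalue in the degree of \<open>g k l\<close> plus the increment of the eigenvalue, that
  is, by the eigenvalue in degree \<open>d\<close>.\<close>

theorem integrate_cocycle:
  assumes pc: "\<And>i j. i > j \<Longrightarrow> g i j \<in> pc (\<lambda>r. d r + edeg n i j r)"
    and per: "\<And>i j. i \<noteq> j \<Longrightarrow> g (i + int n) (j + int n) = g i j"
    and coc: "\<And>i j k l. i > j \<Longrightarrow> k > l \<Longrightarrow> e k l (g i j) = e i j (g k l)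
       + (if int n dvd l - i then g k (j + l - i) else 0) - (if int n dvd k - j then g (i + k - j) l else 0)"
    and d: "tdeg n d > 0" "\<And>r. r \<notin> {1..n} \<Longrightarrow> d r = 0"
    and kl: "k > l"
  shows "e k l (scale (1 / casimir_value d) (casimir (tdeg n d) g)) = g k l"
proof -
  let ?\<beta> = "\<lambda>r. d r + edeg n k l r"
  have neg: "g i j = 0" if "i - j > tdeg n d" for i j
    by (rule pc_negative[OF pc]) (use that d n_pos in auto)
  have "d \<noteq> (\<lambda>_. 0)" using d(1) by auto
  then have nz: "casimir_value d \<noteq> 0" using casimir_value_nonzero d(2) by blast
  show ?thesis
  proof (cases "k - l \<le> tdeg n d")
    case False
    have "e k l (casimir (tdeg n d) g) = 0"
      by (rule pc_negative[OF e_pc[OF casimir_pc[OF pc]]]) (use False n_pos in auto)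
    then show ?thesis using False neg by simp
  next
    case True
    note g = pc[OF kl]
    have "e k l (casimir (tdeg n d) g) = casimir (tdeg n d) (\<lambda>i j. e i j (g k l)) + e k k (g k l) - e l l (g k l)
      + scale (of_int (k - l) - (if int n dvd k - l then 0 else 1)) (g k l)"
      by (rule casimir_lower) (fact per coc neg kl True)+
    also have "casimir (tdeg n d) (\<lambda>i j. e i j (g k l)) = scale (casimir_value ?\<beta>) (g k l)"
      by (rule casimir_scalar[OF g]) (use kl n_pos in simp)
    also have "scale (casimir_value ?\<beta>) (g k l) + e k k (g k l) - e l l (g k l)
        + scale (of_int (k - l) - (if int n dvd k - l then 0 else 1)) (g k l)
      = scale (casimir_value (\<lambda>r. ?\<beta> r + edeg n l k r)) (g k l)"
      unfolding casimir_value_add[of ?\<beta>]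
      by (simp add: weight_pc[OF g] scale_left_distrib scale_left_diff_distrib)
    also have "(\<lambda>r. ?\<beta> r + edeg n l k r) = d" by (simp add: edeg_swap[of n k l])
    finally show ?thesis using nz by simp
  qed
qed

text \<open>The vectors \<open>f\<^sub>d\<close> with \<open>f\<^sub>0 = v\<close> and with prescribed ratios \<open>\<xi> k l\<close> between \<open>e k l f\<^sub>d\<close> and the \<open>f\<close> of the
  lower degree. The recursion integrates the cocycle formed by the smaller degrees.\<close>

function family :: "(int \<Rightarrow> int \<Rightarrow> (nat \<Rightarrow> int) \<Rightarrow> complex) \<Rightarrow> (nat \<Rightarrow> int) \<Rightarrow> 'a" where
  "family \<xi> d = (if d = (\<lambda>_. 0) then v
     else if tdeg n d \<le> 0 \<or> (\<exists>r. r \<notin> {1..n} \<and> d r \<noteq> 0) then 0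
     else scale (1 / casimir_value d) (casimir (tdeg n d) (\<lambda>i j. if i > j
       then scale (\<xi> i j (\<lambda>r. d r + edeg n i j r)) (family \<xi> (\<lambda>r. d r + edeg n i j r)) else 0)))"
  by auto
termination
  by (relation "measure (\<lambda>(\<xi>, d). nat (tdeg n d))") (use n_pos in auto)

declare family.simps [simp del]

lemma family_0 [simp]: "family \<xi> (\<lambda>_. 0) = v"
  by (simp add: family.simps)

text \<open>The hypothesis \<open>comm\<close> says that the \<open>-\<xi> k l\<close> are the matrix coefficients of a module with one basis vector
  for each degree. It is what makes the prescribed images a cocycle.\<close>

theorem family_lower:
  assumes per: "\<And>k l d. k > l \<Longrightarrow> \<xi> (k + int n) (l + int n) d = \<xi> k l d"
    and comm: "\<And>i j k l d. i > j \<Longrightarrow> k > l \<Longrightarrow>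
      \<xi> i j (\<lambda>r. d r - edeg n k l r) * \<xi> k l d - \<xi> k l (\<lambda>r. d r - edeg n i j r) * \<xi> i j d
      = (if int n dvd l - i then \<xi> k (j + l - i) d else 0) - (if int n dvd k - j then \<xi> (i + k - j) l d else 0)"
  shows "family \<xi> d \<in> pc d \<and>
    (\<forall>k l. k > l \<longrightarrow> e k l (family \<xi> d) = scale (\<xi> k l (\<lambda>r. d r + edeg n k l r)) (family \<xi> (\<lambda>r. d r + edeg n k l r)))"
proof (induction "nat (tdeg n d)" arbitrary: d rule: less_induct)
  case less
  have neg: "family \<xi> d' = 0" if "tdeg n d' < 0" for d'
    using that by (subst family.simps) auto
  consider "d = (\<lambda>_. 0)" | "d \<noteq> (\<lambda>_. 0)" "tdeg n d \<le> 0" | "d \<noteq> (\<lambda>_. 0)" "\<exists>r. r \<notin> {1..n} \<and> d r \<noteq> 0"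
    | "tdeg n d > 0" "\<And>r. r \<notin> {1..n} \<Longrightarrow> d r = 0" by (meson not_le)
  then show ?case
  proof cases
    case 1
    have "e k l v = 0" "family \<xi> (edeg n k l) = 0" if "k > l" for k l
      using that lower[of l k] n_pos by (auto intro!: neg)
    then show ?thesis using 1 v_pc by simp
  next
    case 2
    then have "family \<xi> d = 0" by (simp add: family.simps)
    moreover have "family \<xi> (\<lambda>r. d r + edeg n k l r) = 0" if "k > l" for k l
      by (rule neg) (use that 2 n_pos in simp)
    ultimately show ?thesis by (simp add: pc_closed)
  next
    case 3
    then have "family \<xi> d = 0" by (simp add: family.simps)
    moreover have "family \<xi> (\<lambda>r. d r + edeg n k l r) = 0" for k l
    proof -
      from 3 obtain r where r: "r \<notin> {1..n}" "d r \<noteq> 0" by auto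
      then have *: "d r + edeg n k l r \<noteq> 0" using edeg_unsupported[OF n_pos r(1)] by simp
      then have "(\<lambda>r. d r + edeg n k l r) \<noteq> (\<lambda>_. 0)" by (metis (mono_tags))
      with * r(1) show ?thesis by (subst family.simps) (metis (mono_tags, lifting))
    qed
    ultimately show ?thesis by (simp add: pc_closed)
  next
    case 4
    let ?d = "\<lambda>i j r. d r + edeg n i j r"
    define g where "g i j = (if i > j then scale (\<xi> i j (?d i j)) (family \<xi> (?d i j)) else 0)" for i j
    have IH: "family \<xi> (?d i j) \<in> pc (?d i j)"
      "k > l \<Longrightarrow> e k l (family \<xi> (?d i j)) = scale (\<xi> k l (\<lambda>r. ?d i j r + edeg n k l r)) (family \<xi> (\<lambda>r. ?d i j r + edeg n k l r))"
      if "i > j" for i j k l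
      using less[of "?d i j"] that 4(1) n_pos by auto
    have f: "family \<xi> d = scale (1 / casimir_value d) (casimir (tdeg n d) g)"
      using 4 unfolding g_def by (subst family.simps) auto
    have pc: "g i j \<in> pc (?d i j)" if "i > j" for i j
      using IH(1)[OF that] that by (simp add: g_def pc_closed)
    have gper: "g (i + int n) (j + int n) = g i j" if "i \<noteq> j" for i j
      using per[of j i] edeg_periodic[OF n_pos, of i 1 j] by (auto simp: g_def)
    have coc: "e k l (g i j) = e i j (g k l)
       + (if int n dvd l - i then g k (j + l - i) else 0) - (if int n dvd k - j then g (i + k - j) l else 0)"
      if ij: "i > j" and kl: "k > l" for i j k l
    proof -
      define d' where "d' = (\<lambda>r. d r + edeg n i j r + edeg n k l r)"
      have d'2: "d' = (\<lambda>r. d r + edeg n k l r + edeg n i j r)" by (auto simp: d'_def)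
      have sub: "(\<lambda>r. d' r - edeg n k l r) = ?d i j" "(\<lambda>r. d' r - edeg n i j r) = ?d k l"
        by (auto simp: d'_def)
      have 1: "e k l (g i j) = scale (\<xi> i j (\<lambda>r. d' r - edeg n k l r) * \<xi> k l d') (family \<xi> d')"
        unfolding sub using IH(2)[OF ij kl] ij by (simp add: g_def d'_def)
      have 2: "e i j (g k l) = scale (\<xi> k l (\<lambda>r. d' r - edeg n i j r) * \<xi> i j d') (family \<xi> d')"
        unfolding sub using IH(2)[OF kl ij] kl by (simp add: g_def d'2)
      have 3: "g k (j + l - i) = scale (\<xi> k (j + l - i) d') (family \<xi> d')" if dv: "int n dvd l - i"
      proof -
        have "?d k (j + l - i) = d'" using edeg_comp(1)[OF n_pos dv, of k j] by (auto simp: d'_def)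
        then show ?thesis using ij kl by (simp add: g_def)
      qed
      have 4: "g (i + k - j) l = scale (\<xi> (i + k - j) l d') (family \<xi> d')" if dv: "int n dvd k - j"
      proof -
        have "int n dvd j - k" using dv by (simp add: dvd_diff_commute)
        then have "?d (i + k - j) l = d'" using edeg_comp(2)[OF n_pos, of j k i l] by (auto simp: d'_def)
        then show ?thesis using ij kl by (simp add: g_def)
      qed
      have "scale (\<xi> i j (\<lambda>r. d' r - edeg n k l r) * \<xi> k l d' - \<xi> k l (\<lambda>r. d' r - edeg n i j r) * \<xi> i j d') (family \<xi> d')
        = scale ((if int n dvd l - i then \<xi> k (j + l - i) d' else 0) - (if int n dvd k - j then \<xi> (i + k - j) l d' else 0)) (family \<xi> d')"
        by (simp only: comm[OF ij kl])
      then have "e k l (g i j) - e i j (g k l) = (if int n dvd l - i then g k (j + l - i) else 0) - (if int n dvd k - j then g (i + k - j) l else 0)"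
        unfolding 1 2 scale_left_diff_distrib using 3 4 by auto
      then show ?thesis by (simp add: algebra_simps)
    qed
    have "e k l (family \<xi> d) = g k l" if "k > l" for k l
      unfolding f by (rule integrate_cocycle) (fact pc gper coc 4 that)+
    moreover have "family \<xi> d \<in> pc d" unfolding f by (intro pc_closed casimir_pc pc)
    ultimately show ?thesis by (simp add: g_def)
  qed
qed

end

section \<open>The universal property of Verma modules\<close>

lemma poly_mapping_decomp: "x = (\<Sum>k\<in>keys x. single k (lookup x k))"
  by (intro poly_mapping_eqI) (auto simp: lookup_sum lookup_single when_def in_keys_iff)

lemma additive_ext:
  fixes f g :: "('k \<Rightarrow>\<^sub>0 'a::ab_group_add) \<Rightarrow> 'b::ab_group_add"
  assumes f: "\<And>G H. f (G + H) = f G + f H" and g: "\<And>G H. g (G + H) = g G + g H"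
    and eq: "\<And>k c. f (single k c) = g (single k c)"
  shows "f G = g G"
proof -
  have 0: "f 0 = 0" "g 0 = 0" using f[of 0 0] g[of 0 0] by simp_all
  have "f (\<Sum>k\<in>A. single k (h k)) = g (\<Sum>k\<in>A. single k (h k))" for A h
    by (induction A rule: infinite_finite_induct) (simp_all add: 0 f g eq)
  then show ?thesis using poly_mapping_decomp[of G] by metis
qed

lemma affgl_induct [consumes 2, case_names zero add smul E gam]:
  assumes n: "n \<ge> 1" and X: "X \<in> affgl n"
    and 0: "P 0" and add: "\<And>X Y. X \<in> affgl n \<Longrightarrow> Y \<in> affgl n \<Longrightarrow> P X \<Longrightarrow> P Y \<Longrightarrow> P (X + Y)"
    and smul: "\<And>c X. X \<in> affgl n \<Longrightarrow> P X \<Longrightarrow> P (smul c X)"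
    and E: "\<And>i j. P (E n i j)" and gam: "P gam"
  shows "P X"
proof -
  have one: "P (single x (h x)) \<and> single x (h x) \<in> affgl n"
    if "x \<in> keys X" for x h
  proof (cases x)
    case (Loop k a b)
    then have "a \<in> {1..n}" "b \<in> {1..n}" using X that by (auto simp: affgl_def)
    then show ?thesis unfolding Loop Loop_eq_E[OF \<open>a \<in> {1..n}\<close> \<open>b \<in> {1..n}\<close>] using n E smul by simp
  next
    case Gam
    have "single x (h x) = smul (h x) gam" by (simp add: Gam gam_def)
    then show ?thesis using smul gam by simp
  qed
  have "P (\<Sum>x\<in>A. single x (h x)) \<and> (\<Sum>x\<in>A. single x (h x)) \<in> affgl n"
    if "A \<subseteq> keys X" for A h
    using finite_subset[OF that finite_keys] that
    by (induction A rule: finite_induct) (use 0 one add in auto)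
  from this[of "keys X" "lookup X"] show ?thesis
    using poly_mapping_decomp[of X] by simp
qed

context affgl_module
begin

lemma env_act_superset:
  "finite S \<Longrightarrow> keys P \<subseteq> S \<Longrightarrow>
    env_act scale act P v = (\<Sum>w\<in>S. scale (lookup P w) (foldr act w v))"
  unfolding env_act_def by (rule sum.mono_neutral_left) (auto simp: in_keys_iff)

lemma env_act_add: "env_act scale act (P + Q) v = env_act scale act P v + env_act scale act Q v"
proof -
  let ?S = "keys P \<union> keys Q"
  have "keys (P + Q) \<subseteq> ?S" by (rule Poly_Mapping.keys_add)
  then show ?thesis
    by (subst (1 2 3) env_act_superset[of ?S]) (auto simp: lookup_add scale_left_distrib sum.distrib)
qed

lemma env_act_single: "env_act scale act (single w c) v = scale c (foldr act w v)"
  by (subst env_act_superset[of "{w}"]) auto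

lemma env_act_zero: "env_act scale act 0 v = 0"
  by (simp add: env_act_def)

lemma env_act_diff: "env_act scale act (P - Q) v = env_act scale act P v - env_act scale act Q v"
  using env_act_add[of "P - Q" Q v] by simp

lemma env_act_sum: "env_act scale act (sum f A) v = (\<Sum>i\<in>A. env_act scale act (f i) v)"
  by (induction A rule: infinite_finite_induct) (auto simp: env_act_zero env_act_add)

end

lemma (in affgl_rep) foldr_lin:
  assumes "ws \<in> lists (affgl n)"
  shows "foldr act ws (x + y) = foldr act ws x + foldr act ws y"
    "foldr act ws (scale c x) = scale c (foldr act ws x)"
    "foldr act ws (x - y) = foldr act ws x - foldr act ws y"
  using assms by (induction ws) (auto simp: act_lin)

lemma (in affgl_rep) env_ideal_zero:
  assumes "P \<in> env_ideal L" "L \<subseteq> affgl n"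
  shows "env_act scale act P v = 0"
  using assms(1)
proof induction
  case (add_rel u w x y c)
  then have "u \<in> lists (affgl n)" "x \<in> affgl n" "y \<in> affgl n" using assms(2) by auto
  then show ?case
    by (simp add: env_act_diff env_act_single act_add foldr_lin scale_right_distrib)
next
  case (smul_rel u w x k c)
  then have "u \<in> lists (affgl n)" "x \<in> affgl n" using assms(2) by auto
  then show ?case
    by (simp add: env_act_diff env_act_single act_smul foldr_lin)
next
  case (bracket_rel u w x y c)
  then have "u \<in> lists (affgl n)" "x \<in> affgl n" "y \<in> affgl n" using assms(2) by auto
  then show ?case
    by (simp add: env_act_diff env_act_single act_bracket foldr_lin scale_right_diff_distrib)
qed (simp_all add: env_act_zero env_act_add)

text \<open>Freeness makes \<open>u v \<mapsto> u F\<close> well defined, and it commutes with raising operators by construction.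
  For the other operators, both sides obey the same commutation rules with raising operators and agree on
  the generator.\<close>

theorem (in verma_rep) universal_property:
  fixes sW :: "complex \<Rightarrow> 'w::ab_group_add \<Rightarrow> 'w"
  assumes N: "affgl_rep sW n T"
    and F_lower: "\<And>i j. i < j \<Longrightarrow> T (E n j i) F = 0"
    and F_weight: "\<And>k. k \<in> {1..n} \<Longrightarrow> T (E n (int k) (int k)) F = sW (a k - of_nat k) F"
    and F_level: "T gam F = sW (of_nat n + p) F"
  shows "\<exists>\<phi>. Vector_Spaces.linear scale sW \<phi> \<and> \<phi> v = F \<and> (\<forall>X\<in>affgl n. \<forall>w. \<phi> (act X w) = T X (\<phi> w))"
proof -
  interpret N: affgl_rep sW n T by fact
  define word where "word w = (SOME P. keys P \<subseteq> lists (nplus n) \<and> env_act scale act P v = w)" for w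
  have word: "keys (word w) \<subseteq> lists (nplus n)" "env_act scale act (word w) v = w" for w
  proof -
    have "\<exists>P. keys P \<subseteq> lists (nplus n) \<and> env_act scale act P v = w"
      using free unfolding freely_generated_def by blast
    from someI_ex[OF this] show "keys (word w) \<subseteq> lists (nplus n)" "env_act scale act (word w) v = w"
      by (simp_all add: word_def)
  qed
  define \<phi> where "\<phi> w = env_act sW T (word w) F" for w
  have \<phi>: "\<phi> (env_act scale act P v) = env_act sW T P F" if P: "keys P \<subseteq> lists (nplus n)" for P
  proof -
    let ?Q = "word (env_act scale act P v)"
    have "keys (?Q - P) \<subseteq> lists (nplus n)"
      using keys_diff[of ?Q P] P word(1) by blast
    moreover have "env_act scale act (?Q - P) v = 0" by (simp add: env_act_diff word)
    ultimately have "?Q - P \<in> env_ideal (nplus n)"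
      using free unfolding freely_generated_def by blast
    then have "env_act sW T (?Q - P) F = 0"
      by (rule N.env_ideal_zero) (use nplus_affgl[OF n_pos] in auto)
    then show ?thesis by (simp add: \<phi>_def N.env_act_diff)
  qed
  have add: "\<phi> (w + w') = \<phi> w + \<phi> w'" for w w'
  proof -
    have "keys (word w + word w') \<subseteq> lists (nplus n)"
      using Poly_Mapping.keys_add[of "word w" "word w'"] word(1) by blast
    from \<phi>[OF this] show ?thesis
      by (simp add: env_act_add word N.env_act_add) (simp add: \<phi>_def)
  qed
  have sc: "\<phi> (scale c w) = sW c (\<phi> w)" for c w
  proof -
    define P where "P = (\<Sum>ws\<in>keys (word w). single ws (c * lookup (word w) ws))"
    have "keys P \<subseteq> lists (nplus n)"
    proof
      fix ws assume "ws \<in> keys P"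
      then have "ws \<in> keys (word w)"
        by (auto simp: P_def in_keys_iff lookup_sum lookup_single when_def split: if_splits)
      then show "ws \<in> lists (nplus n)" using word(1) by blast
    qed
    moreover have "env_act scale act P v = scale c w"
      unfolding P_def env_act_sum env_act_single
      using word(2)[of w] by (simp add: env_act_def flip: scale_scale scale_sum_right)
    moreover have "env_act sW T P F = sW c (\<phi> w)"
      unfolding P_def N.env_act_sum N.env_act_single
      by (simp add: \<phi>_def env_act_def flip: N.scale_scale N.scale_sum_right)
    ultimately show ?thesis using \<phi> by metis
  qed
  have lin: "Vector_Spaces.linear scale sW \<phi>"
    by (intro Vector_Spaces.linear.intro module_hom.intro module_hom_axioms.intro
      vector_space_axioms N.vector_space_axioms module_axioms N.module_axioms add sc)
  have \<phi>0: "\<phi> 0 = 0" using sc[of 0 0] by simp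
  have neg: "\<phi> (- w) = - \<phi> w" "\<phi> (w - w') = \<phi> w - \<phi> w'" for w w'
  proof -
    show "\<phi> (- w) = - \<phi> w" using add[of w "- w"] \<phi>0 by (simp add: eq_neg_iff_add_eq_0 add.commute)
    show "\<phi> (w - w') = \<phi> w - \<phi> w'" using add[of "w - w'" w'] by simp
  qed
  have "\<phi> (env_act scale act (single [] 1) v) = F"
    by (subst \<phi>) (auto simp: N.env_act_single)
  then have \<phi>v: "\<phi> v = F" by (simp add: env_act_single)
  have raise: "\<phi> (e i j w) = T (E n i j) (\<phi> w)" if "i < j" for i j w
  proof -
    define P where "P = (\<Sum>ws\<in>keys (word w). single (E n i j # ws) (lookup (word w) ws))"
    have "keys P \<subseteq> lists (nplus n)"
    proof
      fix ws' assume "ws' \<in> keys P"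
      then have "(\<Sum>ws\<in>keys (word w). lookup (word w) ws when E n i j # ws = ws') \<noteq> 0"
        by (simp add: P_def in_keys_iff lookup_sum lookup_single)
      then obtain ws where ws: "ws \<in> keys (word w)" "(lookup (word w) ws when E n i j # ws = ws') \<noteq> 0"
        by (rule sum.not_neutral_contains_not_neutral)
      then have "E n i j # ws = ws'" by (auto simp: when_def split: if_splits)
      moreover have "ws \<in> lists (nplus n)" using ws(1) word(1)[of w] by blast
      ultimately show "ws' \<in> lists (nplus n)" using nplus.gen[OF that, of n] by auto
    qed
    moreover have "env_act scale act P v = e i j w"
      using arg_cong[OF word(2)[of w], of "e i j"]
      unfolding P_def env_act_sum env_act_single by (simp add: env_act_def e_sum)
    moreover have "env_act sW T P F = T (E n i j) (\<phi> w)"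
      unfolding P_def N.env_act_sum N.env_act_single by (simp add: \<phi>_def env_act_def N.e_sum)
    ultimately show ?thesis using \<phi> by metis
  qed
  have gam: "\<phi> (act gam w) = T gam (\<phi> w)" for w
  proof -
    have "T gam (\<phi> w) = sW (of_nat n + p) (\<phi> w)"
      by (induction w rule: verma_induct)
        (simp_all add: \<phi>0 add sc \<phi>v raise N.act_lin N.gam_comm N.scale_right_distrib N.scale_left_commute F_level)
    then show ?thesis by (simp add: gam_v sc)
  qed
  have all: "\<phi> (e k l w) = T (E n k l) (\<phi> w)" for k l w
  proof (induction w arbitrary: k l rule: verma_induct)
    case base
    consider "k < l" | "l < k" | "k = l" by linarith
    then show ?case
    proof cases
      case 3
      show ?thesis
        unfolding 3 e_diag_res[of l] N.e_diag_res[of l] neg sc \<phi>v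
          weight[OF res_range[OF n_pos]] level F_weight[OF res_range[OF n_pos]] F_level
        by (simp add: sc \<phi>v)
    qed (use raise lower F_lower \<phi>v \<phi>0 in simp_all)
  next
    case (raise i j w)
    then show ?case
      by (simp add: e_comm[of k l i j] N.e_comm[of k l i j] add neg \<phi>0 \<open>\<And>w j i. i < j \<Longrightarrow> \<phi> (e i j w) = T (E n i j) (\<phi> w)\<close>)
  qed (simp_all add: \<phi>0 add sc)
  have "\<phi> (act X w) = T X (\<phi> w)" if "X \<in> affgl n" for X w
    using n_pos that
  proof (induction X rule: affgl_induct)
    case (add X Y)
    then show ?case using \<open>\<And>w w'. \<phi> (w + w') = \<phi> w + \<phi> w'\<close> by (simp add: act_add N.act_add)
  qed (simp_all add: \<phi>0 sc act_smul N.act_smul all gam)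
  then show ?thesis using lin \<phi>v by blast
qed

text \<open>The bracket axiom is bilinear, so the \<open>E n i j\<close> and \<open>\<gamma>\<close> suffice; on the former the bracket is known in
  closed form.\<close>

lemma affgl_repI:
  assumes n: "n \<ge> 1" and vs: "vector_space sW"
    and lin: "\<And>X. X \<in> affgl n \<Longrightarrow> Vector_Spaces.linear sW sW (T X)"
    and add: "\<And>X Y w. X \<in> affgl n \<Longrightarrow> Y \<in> affgl n \<Longrightarrow> T (X + Y) w = T X w + T Y w"
    and smul: "\<And>X c w. X \<in> affgl n \<Longrightarrow> T (smul c X) w = sW c (T X w)"
    and comm: "\<And>i j k l w. T (E n i j) (T (E n k l) w) = T (E n k l) (T (E n i j) w)
       + (if int n dvd j - k then T (E n i (l + j - k)) w else 0)
       - (if int n dvd i - l then T (E n (k + i - l) j) w else 0)"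
    and gam: "\<And>i j w. T gam (T (E n i j) w) = T (E n i j) (T gam w)"
  shows "affgl_rep sW n T"
proof -
  interpret vector_space sW by fact
  have T0: "T 0 w = 0" for w using add[of 0 0 w] by simp
  have Tdiff: "T (X - Y) w = T X w - T Y w" if "X \<in> affgl n" "Y \<in> affgl n" for X Y w
    using add[of "X - Y" Y w] that by simp
  have tl: "T X (w + w') = T X w + T X w'" "T X (sW c w) = sW c (T X w)" "T X 0 = 0" if "X \<in> affgl n" for X w w' c
  proof -
    interpret l: Vector_Spaces.linear sW sW "T X" using lin[OF that] .
    show "T X (w + w') = T X w + T X w'" "T X (sW c w) = sW c (T X w)" "T X 0 = 0"
      by (simp_all add: l.add l.scale l.zero)
  qed
  have bsmul: "bracket (smul c X) Y = smul c (bracket X Y)" "bracket Y (smul c X) = smul c (bracket Y X)" for c X Y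
  proof -
    have smul_sum: "smul c (sum f A) = (\<Sum>i\<in>A. smul c (f i))" for f :: "aff_basis \<Rightarrow> affgl" and A
      by (induction A rule: infinite_finite_induct) (auto simp: smul_distribs)
    show "bracket (smul c X) Y = smul c (bracket X Y)"
      using keys_smul[of c X]
      by (subst (1 2) bracket_superset[of "keys X" _ "keys Y"]) (simp_all add: smul_sum ac_simps)
    show "bracket Y (smul c X) = smul c (bracket Y X)"
      using keys_smul[of c X]
      by (subst (1 2) bracket_superset[of "keys Y" _ "keys X"]) (simp_all add: smul_sum ac_simps)
  qed
  have bgam: "bracket gam Y = 0" "bracket Y gam = 0" for Y
    by (simp_all add: bracket_def gam_def)
  have "T (bracket X Y) w = T X (T Y w) - T Y (T X w)" if X: "X \<in> affgl n" and Y: "Y \<in> affgl n" for X Y w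
    using n X
  proof (induction X rule: affgl_induct)
    case (E i j)
    show ?case using n Y
    proof (induction Y rule: affgl_induct)
      case (E k l)
      show ?case using comm[of i j k l w] n by (simp add: bracket_E[OF n] Tdiff T0)
    qed (use n in \<open>simp_all add: T0 tl bracket_add add bsmul smul bgam gam scale_right_diff_distrib\<close>)
  next
    case gam
    have "T gam (T Y w) = T Y (T gam w)" using n Y
      by (induction Y rule: affgl_induct) (use assms(7) in \<open>simp_all add: T0 tl add smul\<close>)
    then show ?case by (simp add: bgam T0)
  qed (use Y in \<open>simp_all add: T0 tl bracket_add add bsmul smul scale_right_diff_distrib\<close>)
  then show ?thesis
    using n vs lin add smul tl by (unfold_locales) auto
qed

section \<open>The completed tensor product\<close>

lemma lookup_map_zero [simp]: "f 0 = 0 \<Longrightarrow> lookup (Poly_Mapping.map f x) k = f (lookup x k)"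
  by (simp add: Poly_Mapping.map.rep_eq when_def)

lemma (in vector_space) linear_intro:
  assumes "\<And>x y. f (x + y) = f x + f y" "\<And>c x. f (scale c x) = scale c (f x)"
  shows "Vector_Spaces.linear scale scale f"
  by (intro Vector_Spaces.linear.intro module_hom.intro module_hom_axioms.intro
      vector_space_axioms module_axioms assms)

context affgl_rep
begin

lemma gam_lin [simp]:
  "act gam (w + w') = act gam w + act gam w'" "act gam (scale c w) = scale c (act gam w)" "act gam 0 = 0"
  by (simp_all add: act_lin)

lemma lookup_tens_scale [simp]:
  "lookup (tens_scale scale c G) b = scale c (lookup G b)"
  by (simp add: tens_scale_def)

lemma tens_scale_single [simp]: "tens_scale scale c (single b w) = single b (scale c w)"
  by (rule poly_mapping_eqI) (simp add: lookup_single when_def)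

lemma tens_scale_vs: "vector_space (tens_scale scale)"
  by unfold_locales (auto intro!: poly_mapping_eqI simp: lookup_add scale_right_distrib scale_left_distrib)

lemma coefficient_rep: "affgl_rep (tens_scale scale) n (\<lambda>Y. Poly_Mapping.map (act Y))"
proof (rule affgl_repI[OF n_pos tens_scale_vs])
  interpret vs: vector_space "tens_scale scale" by (rule tens_scale_vs)
  fix X assume "X \<in> affgl n"
  then show "Vector_Spaces.linear (tens_scale scale) (tens_scale scale) (Poly_Mapping.map (act X))"
    by (intro vs.linear_intro poly_mapping_eqI) (simp_all add: act_lin lookup_add)
next
  fix i j k l w
  show "Poly_Mapping.map (e i j) (Poly_Mapping.map (e k l) w) = Poly_Mapping.map (e k l) (Poly_Mapping.map (e i j) w)
       + (if int n dvd j - k then Poly_Mapping.map (e i (l + j - k)) w else 0)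
       - (if int n dvd i - l then Poly_Mapping.map (e (k + i - l) j) w else 0)"
    by (rule poly_mapping_eqI) (simp add: lookup_add lookup_minus e_comm[of i j k l])
qed (auto intro!: poly_mapping_eqI simp: act_lin lookup_add act_add act_smul gam_comm)

lemma hat_act_superset:
  assumes "finite A" "keys X \<subseteq> A"
  shows "hat_act n act X f d = (\<Sum>x\<in>A. act (single x (lookup X x)) (f (\<lambda>r. d r - basis_deg n x r)))"
  unfolding hat_act_def
  by (rule sum.mono_neutral_left) (use assms in \<open>auto simp: in_keys_iff\<close>)

lemma key_affgl: "X \<in> affgl n \<Longrightarrow> x \<in> keys X \<Longrightarrow> single x c \<in> affgl n"
  by (rule affgl_single, cases x) (auto simp: affgl_def)

lemma hat_act_add:
  assumes "X \<in> affgl n" "Y \<in> affgl n"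
  shows "hat_act n act (X + Y) f d = hat_act n act X f d + hat_act n act Y f d"
proof -
  let ?A = "keys X \<union> keys Y"
  have *: "keys (X + Y) \<subseteq> ?A" by (rule Poly_Mapping.keys_add)
  have "hat_act n act (X + Y) f d = (\<Sum>x\<in>?A. act (single x (lookup X x)) (f (\<lambda>r. d r - basis_deg n x r))
     + act (single x (lookup Y x)) (f (\<lambda>r. d r - basis_deg n x r)))"
    unfolding hat_act_superset[OF _ *, simplified]
    by (rule sum.cong) (use key_affgl assms in \<open>auto simp: lookup_add single_add act_add\<close>)
  also have "\<dots> = hat_act n act X f d + hat_act n act Y f d"
    by (simp add: sum.distrib hat_act_superset[of ?A])
  finally show ?thesis .
qed

lemma hat_act_single: "hat_act n act (single x c) f d = act (single x c) (f (\<lambda>r. d r - basis_deg n x r))"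
  by (subst hat_act_superset[of "{x}"]) auto

lemma hat_act_smul:
  assumes "X \<in> affgl n"
  shows "hat_act n act (smul c X) f d = scale c (hat_act n act X f d)"
proof -
  have "hat_act n act (smul c X) f d = (\<Sum>x\<in>keys X. act (smul c (single x (lookup X x))) (f (\<lambda>r. d r - basis_deg n x r)))"
    by (subst hat_act_superset[OF _ keys_smul]) simp_all
  also have "\<dots> = scale c (hat_act n act X f d)"
    unfolding hat_act_def scale_sum_right
    by (rule sum.cong) (use key_affgl[OF assms] in \<open>auto simp: act_smul simp del: smul_simps\<close>)
  finally show ?thesis .
qed

lemma hat_act_gam [simp]: "hat_act n act gam f d = act gam (f d)"
  by (simp add: gam_def hat_act_single)

lemma hat_act_E [simp]: "hat_act n act (E n i j) f d = e i j (f (\<lambda>r. d r - edeg n i j r))"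
proof -
  let ?L = "Loop ((j - 1) div int n - (i - 1) div int n) (res n i) (res n j)"
  let ?c = "if i = j then of_int ((i - 1) div int n) else 0 :: complex"
  have r: "res n i \<in> {1..n}" "res n j \<in> {1..n}" using res_range[OF n_pos] by auto
  have L: "single ?L 1 \<in> affgl n" using r by (intro affgl_single) auto
  have E: "E n i j = single ?L 1 + smul (- ?c) gam"
    by (auto simp: E_eq[OF n_pos] gam_def single_uminus)
  have "basis_deg n ?L r = edeg n i j r" for r
  proof -
    let ?q = "\<lambda>i. (i - 1) div int n"
    have "edeg n i j r = edeg n (int (res n i) + int n * ?q i) (int (res n j) + int n * (?q j - ?q i) + int n * ?q i) r"
      using res_decomp[OF n_pos, of i] res_decomp[OF n_pos, of j] by (simp add: algebra_simps)
    then show ?thesis by (simp add: edeg_periodic[OF n_pos])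
  qed
  then have "hat_act n act (E n i j) f d = act (single ?L 1) (f (\<lambda>r. d r - edeg n i j r)) + scale (- ?c) (act gam (f d))"
    unfolding E using L by (simp add: hat_act_add hat_act_smul hat_act_single)
  also have "scale (- ?c) (act gam (f d)) = scale (- ?c) (act gam (f (\<lambda>r. d r - edeg n i j r)))"
    by auto
  also have "act (single ?L 1) w + scale (- ?c) (act gam w) = e i j w" for w
    unfolding E using L by (simp only: act_add act_smul gam_affgl affgl_smul)
  finally show ?thesis .
qed

lemma hat_act_lin:
  assumes "X \<in> affgl n"
  shows "hat_act n act X (\<lambda>d. f d + g d) d = hat_act n act X f d + hat_act n act X g d"
    "hat_act n act X (\<lambda>d. scale c (f d)) d = scale c (hat_act n act X f d)"
  unfolding hat_act_def using key_affgl[OF assms]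
  by (auto simp: act_lin sum.distrib scale_sum_right intro!: sum.cong)

lemma deg_comp:
  "int n dvd j - k \<Longrightarrow> (\<lambda>r. d r - edeg n i j r - edeg n k l r) = (\<lambda>r. d r - edeg n i (l + j - k) r)"
  "int n dvd i - l \<Longrightarrow> (\<lambda>r. d r - edeg n i j r - edeg n k l r) = (\<lambda>r. d r - edeg n (k + i - l) j r)"
  using edeg_comp(1)[OF n_pos, of j k i l] edeg_comp(2)[OF n_pos, of l i k j]
  by (auto simp: dvd_diff_commute diff_diff_eq add.commute)

end

lemma tens_superset:
  assumes "vector_space scale" "finite A" "keys x \<subseteq> A"
  shows "tens scale w x = (\<Sum>b\<in>A. single b (scale (lookup x b) w))"
proof -
  interpret vector_space scale by fact
  show ?thesis unfolding tens_def
    by (rule sum.mono_neutral_left) (use assms in \<open>auto simp: in_keys_iff\<close>)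
qed

lemma V_act_superset:
  assumes "finite A" "keys X \<subseteq> A"
  shows "V_act n p m X (single b 1) = (\<Sum>u\<in>A. smul (lookup X u) (V_basis n p m u b))"
proof -
  have "V_act n p m X (single b 1) = (\<Sum>u\<in>keys X. smul (lookup X u) (V_basis n p m u b))"
    by (simp add: V_act_def)
  also have "\<dots> = (\<Sum>u\<in>A. smul (lookup X u) (V_basis n p m u b))"
    by (rule sum.mono_neutral_left) (use assms in \<open>auto simp: in_keys_iff\<close>)
  finally show ?thesis .
qed

lemma V_act_add: "V_act n p m (X + Y) (single b 1) = V_act n p m X (single b 1) + V_act n p m Y (single b 1)"
proof -
  let ?A = "keys X \<union> keys Y"
  have "keys (X + Y) \<subseteq> ?A" by (rule Poly_Mapping.keys_add)
  then show ?thesis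
    by (subst (1 2 3) V_act_superset[of ?A]) (auto simp: lookup_add smul_distribs sum.distrib)
qed

lemma smul_sum: "smul c (sum f A) = (\<Sum>i\<in>A. smul c (f i))"
  by (induction A rule: infinite_finite_induct) (auto simp: smul_distribs)

lemma V_act_smul: "V_act n p m (smul c X) (single b 1) = smul c (V_act n p m X (single b 1))"
  using keys_smul[of c X] by (subst (1 2) V_act_superset[of "keys X"]) (auto simp: smul_sum)

text \<open>The scalar part of the action on \<open>V\<close> is \<open>-m\<close> times a character of the Lie algebra, and this is its
  value on \<open>E n i j\<close> with \<open>i - j = k\<close>.\<close>

definition char_coeff :: "nat \<Rightarrow> complex \<Rightarrow> int \<Rightarrow> complex" where
  "char_coeff n p k = (if k = 0 then 1
     else if k > 0 \<and> int n dvd k then (-1) ^ nat (k - 1) * (of_nat n / p) else 0)"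

definition exp_shift :: "nat \<Rightarrow> int \<Rightarrow> int \<Rightarrow> exps \<Rightarrow> exps" where
  "exp_shift n i j b = (\<lambda>r. b r + (if r = res n i then 1 else 0) - (if r = res n j then 1 else 0))"

lemma V_E_eq: "V_E n p m i j b = single (exp_shift n i j b) ((-1) powi (i - j) * b (res n j))
    - single b (m * char_coeff n p (i - j))"
  by (simp add: V_E_def y_dy_def exp_shift_def char_coeff_def)

context affgl_rep
begin

text \<open>The summand \<open>1 \<otimes> X\<close> of the action on the tensor product.\<close>

definition V_part :: "complex \<Rightarrow> complex \<Rightarrow> affgl \<Rightarrow> (exps \<Rightarrow>\<^sub>0 'a) \<Rightarrow> (exps \<Rightarrow>\<^sub>0 'a)" where
  "V_part p m X G = (\<Sum>b\<in>keys G. tens scale (lookup G b) (V_act n p m X (single b 1)))"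

lemmas tens_sup = tens_superset[OF vector_space_axioms]

lemma tens_add:
  "tens scale (w + w') x = tens scale w x + tens scale w' x"
  "tens scale w (x + y) = tens scale w x + tens scale w y"
proof -
  show "tens scale (w + w') x = tens scale w x + tens scale w' x"
    by (simp add: tens_def scale_right_distrib single_add sum.distrib)
  let ?A = "keys x \<union> keys y"
  have "keys (x + y) \<subseteq> ?A" by (rule Poly_Mapping.keys_add)
  then show "tens scale w (x + y) = tens scale w x + tens scale w y"
    by (subst (1 2 3) tens_sup[of ?A]) (auto simp: lookup_add scale_left_distrib single_add sum.distrib)
qed

lemma tens_zero [simp]: "tens scale 0 x = 0" "tens scale w 0 = 0"
  by (simp_all add: tens_def)

lemma tens_single [simp]: "tens scale w (single b c) = single b (scale c w)"
  by (subst tens_sup[of "{b}"]) auto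

lemma tens_diff: "tens scale w (x - y) = tens scale w x - tens scale w y"
  using tens_add(2)[of w "x - y" y] by simp

lemma tens_smul: "tens scale w (smul c x) = tens_scale scale c (tens scale w x)"
proof -
  have "tens scale w (smul c x) = (\<Sum>b\<in>keys x. single b (scale (c * lookup x b) w))"
    using keys_smul[of c x] by (subst tens_sup[of "keys x"]) auto
  then show ?thesis
    by (intro poly_mapping_eqI) (simp add: tens_def lookup_sum lookup_single scale_sum_right when_def if_distrib[of "scale _"] cong: if_cong)
qed

lemma tens_scale_tens: "tens scale (scale c w) x = tens_scale scale c (tens scale w x)"
  by (intro poly_mapping_eqI)
     (simp add: tens_def lookup_sum lookup_single scale_sum_right when_def if_distrib[of "scale _"] mult.commute cong: if_cong)

lemma V_part_superset:
  assumes "finite A" "keys G \<subseteq> A"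
  shows "V_part p m X G = (\<Sum>b\<in>A. tens scale (lookup G b) (V_act n p m X (single b 1)))"
  unfolding V_part_def by (rule sum.mono_neutral_left) (use assms in \<open>auto simp: in_keys_iff\<close>)

lemma V_part_add [simp]: "V_part p m X (G + H) = V_part p m X G + V_part p m X H"
proof -
  let ?A = "keys G \<union> keys H"
  have "keys (G + H) \<subseteq> ?A" by (rule Poly_Mapping.keys_add)
  then show ?thesis
    by (subst (1 2 3) V_part_superset[of ?A]) (auto simp: lookup_add tens_add sum.distrib)
qed

lemma V_part_zero [simp]: "V_part p m X 0 = 0"
  by (simp add: V_part_def)

lemma V_part_diff [simp]: "V_part p m X (G - H) = V_part p m X G - V_part p m X H"
  using V_part_add[of p m X "G - H" H] by (simp del: V_part_add)

lemma V_part_single: "V_part p m X (single b w) = tens scale w (V_act n p m X (single b 1))"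
  by (subst V_part_superset[of "{b}"]) auto

lemma tens_scale_add: "tens_scale scale c (G + H) = tens_scale scale c G + tens_scale scale c H"
  by (rule poly_mapping_eqI) (simp add: lookup_add scale_right_distrib)

lemma V_part_scale: "V_part p m X (tens_scale scale c G) = tens_scale scale c (V_part p m X G)"
  by (rule additive_ext[where G = G]) (simp_all add: tens_scale_add V_part_single tens_scale_tens)

lemma V_part_add_left: "V_part p m (X + Y) G = V_part p m X G + V_part p m Y G"
  by (simp add: V_part_def V_act_add tens_add sum.distrib)

lemma tens_scale_sum: "tens_scale scale c (sum f A) = (\<Sum>i\<in>A. tens_scale scale c (f i))"
  by (rule poly_mapping_eqI) (simp add: lookup_sum scale_sum_right)

lemma V_part_smul_left: "V_part p m (smul c X) G = tens_scale scale c (V_part p m X G)"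
  by (simp add: V_part_def V_act_smul tens_smul tens_scale_sum)

lemma V_part_gam [simp]: "V_part p m gam G = 0"
  by (simp add: V_part_def V_act_E(2)[OF n_pos])

lemma V_part_E_single:
  "V_part p m (E n i j) (single b w) =
     single (exp_shift n i j b) (scale ((-1) powi (i - j) * b (res n j)) w)
     - single b (scale (m * char_coeff n p (i - j)) w)"
  by (simp add: V_part_single V_act_E(1)[OF n_pos] V_E_eq tens_diff)

lemma exp_shift_comp:
  "res n j = res n k \<Longrightarrow> exp_shift n i j (exp_shift n k l b) = exp_shift n i l b"
  "res n i = res n l \<Longrightarrow> exp_shift n i j (exp_shift n k l b) = exp_shift n k j b"
  "exp_shift n i j (exp_shift n k l b) = exp_shift n k l (exp_shift n i j b)"
  by (auto simp: exp_shift_def)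

lemma single_lin:
  "single k (x + y) = single k x + single k (y :: 'a)"
  "single k (x - y) = single k x - single k (y :: 'a)"
  by (simp_all add: single_add single_diff)

text \<open>\<open>V\<close> is a module. The operators \<open>\<plusminus>y\<^sub>i \<partial>\<^sub>j\<close> satisfy the relations since the signs are multiplicative in
  \<open>i - j\<close>; the scalar parts cancel from the commutator, and on the right-hand side they are zero or cancel
  each other.\<close>

lemma V_part_comm:
  "V_part p m (E n i j) (V_part p m (E n k l) G) = V_part p m (E n k l) (V_part p m (E n i j) G)
     + (if int n dvd j - k then V_part p m (E n i (l + j - k)) G else 0)
     - (if int n dvd i - l then V_part p m (E n (k + i - l) j) G else 0)"
proof (rule additive_ext[where G = G])
  fix b :: exps and w :: 'a
  define s where "s i j = ((-1) powi (i - j) :: complex)" for i j :: int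
  define \<chi> where "\<chi> k = m * char_coeff n p k" for k
  define B where "B = exp_shift n i j (exp_shift n k l b)"
  have dv: "int n dvd j - k \<longleftrightarrow> res n j = res n k" "int n dvd i - l \<longleftrightarrow> res n i = res n l"
    using res_eq_iff[OF n_pos] by auto
  have VV: "V_part p m (E n i j) (V_part p m (E n k l) (single b w)) =
     single (exp_shift n i j (exp_shift n k l b)) (scale (s i j * exp_shift n k l b (res n j) * (s k l * b (res n l))) w)
     - single (exp_shift n k l b) (scale (\<chi> (i - j) * (s k l * b (res n l))) w)
     - single (exp_shift n i j b) (scale (s i j * b (res n j) * \<chi> (k - l)) w)
     + single b (scale (\<chi> (i - j) * \<chi> (k - l)) w)" for i j k l
    by (simp add: V_part_E_single s_def \<chi>_def)
  have diff: "V_part p m (E n i j) (V_part p m (E n k l) (single b w))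
       - V_part p m (E n k l) (V_part p m (E n i j) (single b w))
      = single B (scale (s i j * s k l * ((if res n j = res n k then b (res n l) else 0) - (if res n i = res n l then b (res n j) else 0))) w)"
  proof -
    have "exp_shift n k l (exp_shift n i j b) = B" unfolding B_def by (rule exp_shift_comp(3))
    moreover have "s i j * exp_shift n k l b (res n j) * (s k l * b (res n l)) - s k l * exp_shift n i j b (res n l) * (s i j * b (res n j))
      = s i j * s k l * ((if res n j = res n k then b (res n l) else 0) - (if res n i = res n l then b (res n j) else 0))"
      by (auto simp: exp_shift_def algebra_simps)
    ultimately show ?thesis
      unfolding VV[of i j k l] VV[of k l i j] B_def[symmetric]
      by (simp add: mult.commute flip: single_lin scale_left_diff_distrib)
  qed
  have s_eq: "s i (l + j - k) = s i j * s k l" "s (k + i - l) j = s i j * s k l"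
    by (auto simp: s_def power_int_add[symmetric] power_int_minus_left algebra_simps)
  have \<chi>0: "\<chi> (i - j + (k - l)) = 0" if "res n j = res n k \<longleftrightarrow> res n i \<noteq> res n l"
  proof -
    have "\<not> int n dvd (i - l) - (j - k)"
      using that dvd_diff[of "int n" "i - l" "(i - l) - (j - k)"] dvd_add[of "int n" "(i - l) - (j - k)" "j - k"] dv by auto
    then have "\<not> int n dvd i - j + (k - l)" by (simp add: algebra_simps)
    then show ?thesis by (auto simp: \<chi>_def char_coeff_def)
  qed
  have 1: "V_part p m (E n i (l + j - k)) (single b w) = single B (scale (s i j * s k l * b (res n l)) w)
      - single b (scale (\<chi> (i - j + (k - l))) w)" if "res n j = res n k"
  proof -
    have "int n dvd (l + j - k) - l" using that dv by simp
    then have r: "res n (l + j - k) = res n l" using res_eq_iff[OF n_pos] by blast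
    then have "exp_shift n i (l + j - k) b = B"
      using exp_shift_comp(1)[OF that] by (simp add: B_def exp_shift_def)
    moreover have ix: "i - (l + j - k) = i - j + (k - l)" by simp
    ultimately show ?thesis
      unfolding V_part_E_single unfolding s_def[symmetric] s_eq r \<chi>_def[symmetric] unfolding ix by simp
  qed
  have 2: "V_part p m (E n (k + i - l) j) (single b w) = single B (scale (s i j * s k l * b (res n j)) w)
      - single b (scale (\<chi> (i - j + (k - l))) w)" if "res n i = res n l"
  proof -
    have "int n dvd (k + i - l) - k" using that dv by simp
    then have r: "res n (k + i - l) = res n k" using res_eq_iff[OF n_pos] by blast
    then have "exp_shift n (k + i - l) j b = B"
      using exp_shift_comp(2)[OF that] by (simp add: B_def exp_shift_def)
    moreover have ix: "k + i - l - j = i - j + (k - l)" by simp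
    ultimately show ?thesis
      unfolding V_part_E_single unfolding s_def[symmetric] s_eq r \<chi>_def[symmetric] unfolding ix by simp
  qed
  have "single B (scale (s i j * s k l * ((if res n j = res n k then b (res n l) else 0) - (if res n i = res n l then b (res n j) else 0))) w)
    = (if int n dvd j - k then V_part p m (E n i (l + j - k)) (single b w) else 0)
     - (if int n dvd i - l then V_part p m (E n (k + i - l) j) (single b w) else 0)"
    unfolding dv using 1 2 \<chi>0 
    by (auto simp: right_diff_distrib scale_left_diff_distrib single_lin)
  with diff show "V_part p m (E n i j) (V_part p m (E n k l) (single b w)) = V_part p m (E n k l) (V_part p m (E n i j) (single b w))
     + (if int n dvd j - k then V_part p m (E n i (l + j - k)) (single b w) else 0)
     - (if int n dvd i - l then V_part p m (E n (k + i - l) j) (single b w) else 0)"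
    by (simp add: algebra_simps)
qed (auto simp: algebra_simps)

lemma map_act_single: "X \<in> affgl n \<Longrightarrow> Poly_Mapping.map (act X) (single b w) = single b (act X w)"
  by (rule poly_mapping_eqI) (simp add: act_lin lookup_single when_def)

lemma map_act_add: "X \<in> affgl n \<Longrightarrow> Poly_Mapping.map (act X) (G + H) = Poly_Mapping.map (act X) G + Poly_Mapping.map (act X) H"
  by (rule poly_mapping_eqI) (simp add: act_lin lookup_add)

lemma map_act_tens:
  assumes "X \<in> affgl n"
  shows "Poly_Mapping.map (act X) (tens scale w x) = tens scale (act X w) x"
  by (rule poly_mapping_eqI)
    (use assms in \<open>simp add: tens_def act_lin lookup_sum lookup_single act_sum when_def if_distrib[of "act X"] cong: if_cong\<close>)

lemma V_part_map_act:
  assumes "X \<in> affgl n"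
  shows "V_part p m Y (Poly_Mapping.map (act X) G) = Poly_Mapping.map (act X) (V_part p m Y G)"
  by (rule additive_ext[where G = G])
     (use assms in \<open>simp_all add: map_act_add map_act_single V_part_single map_act_tens\<close>)

lemma tens_act_eq:
  "tens_act n p m scale act X F d = hat_act n (\<lambda>Y. Poly_Mapping.map (act Y)) X F d + V_part p m X (F d)"
  by (simp add: tens_act_def V_part_def)

interpretation C: affgl_rep "tens_scale scale" n "\<lambda>Y. Poly_Mapping.map (act Y)"
  by (rule coefficient_rep)

lemma tens_act_E:
  "tens_act n p m scale act (E n i j) F d = Poly_Mapping.map (e i j) (F (\<lambda>r. d r - edeg n i j r)) + V_part p m (E n i j) (F d)"
  by (simp add: tens_act_eq C.hat_act_E)

lemma tens_act_gam: "tens_act n p m scale act gam F d = Poly_Mapping.map (act gam) (F d)"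
  by (simp add: tens_act_eq C.hat_act_gam)

lemma tens_family_vs: "vector_space (\<lambda>c F d. tens_scale scale c (F d))"
  by unfold_locales (auto simp: fun_eq_iff tens_scale_add C.scale_left_distrib)

text \<open>Each of the two summands of the action satisfies the relations, and they commute with each other.\<close>

theorem tensor_rep: "affgl_rep (\<lambda>c F d. tens_scale scale c (F d)) n (tens_act n p m scale act)"
proof (rule affgl_repI[OF n_pos tens_family_vs])
  interpret vs: vector_space "\<lambda>c F d. tens_scale scale c (F d)" by (rule tens_family_vs)
  let ?T = "tens_act n p m scale act"
  fix X assume X: "X \<in> affgl n"
  show "Vector_Spaces.linear (\<lambda>c F d. tens_scale scale c (F d)) (\<lambda>c F d. tens_scale scale c (F d)) (?T X)"
    by (rule vs.linear_intro)
      (auto simp: fun_eq_iff tens_act_eq plus_fun_def C.hat_act_lin[OF X] V_part_scale tens_scale_add)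
  fix c w
  show "?T (smul c X) w = (\<lambda>d. tens_scale scale c (?T X w d))"
    by (auto simp: fun_eq_iff tens_act_eq C.hat_act_smul[OF X] V_part_smul_left tens_scale_add)
  fix Y assume Y: "Y \<in> affgl n"
  show "?T (X + Y) w = ?T X w + ?T Y w"
    by (auto simp: fun_eq_iff tens_act_eq C.hat_act_add[OF X Y] V_part_add_left)
next
  let ?T = "tens_act n p m scale act"
  fix i j k l w
  show "?T gam (?T (E n i j) w) = ?T (E n i j) (?T gam w)"
    by (auto simp: fun_eq_iff tens_act_E tens_act_gam map_act_add C.gam_comm V_part_map_act)
  let ?m = "\<lambda>i j. Poly_Mapping.map (e i j)"
  show "?T (E n i j) (?T (E n k l) w) = ?T (E n k l) (?T (E n i j) w)
       + (if int n dvd j - k then ?T (E n i (l + j - k)) w else 0)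
       - (if int n dvd i - l then ?T (E n (k + i - l) j) w else 0)"
  proof
    fix d
    have d1: "(\<lambda>r. d r - edeg n k l r - edeg n i j r) = (\<lambda>r. d r - edeg n i j r - edeg n k l r)"
      by (auto simp: algebra_simps)
    show "?T (E n i j) (?T (E n k l) w) d = (?T (E n k l) (?T (E n i j) w)
       + (if int n dvd j - k then ?T (E n i (l + j - k)) w else 0)
       - (if int n dvd i - l then ?T (E n (k + i - l) j) w else 0)) d"
      using deg_comp(1)[of j k d i l] deg_comp(2)[of i l d j k]
      by (auto simp: tens_act_E map_act_add V_part_map_act C.e_comm[of i j k l] V_part_comm[of p m i j k l] d1 algebra_simps)
  qed
qed

end

section \<open>The intertwiner\<close>

lemma wt_periodic:
  assumes "n \<ge> 1" "res n i = res n j"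
  shows "wt n d i = wt n d j"
proof -
  have "int n dvd i - j" using assms res_eq_iff by blast
  then have "int n dvd (i - 1) - (j - 1)" by simp
  then have "res n (i - 1) = res n (j - 1)" using res_eq_iff[OF assms(1)] by blast
  then show ?thesis using assms(2) by (simp add: wt_def)
qed

lemma wt_res: "n \<ge> 1 \<Longrightarrow> wt n d (int (res n k)) = wt n d k"
  using wt_periodic[of n "int (res n k)" k d] res_range[of n k] res_id[of "res n k" n] by simp

context affgl_rep
begin

lemma V_part_sum: "V_part p m X (sum f A) = (\<Sum>i\<in>A. V_part p m X (f i))"
  by (induction A rule: infinite_finite_induct) auto

lemma V_part_diag:
  "lookup (V_part p m (E n k k) G) b = scale (b (res n k) - m) (lookup G b)"
proof (rule additive_ext[where G = G])
  fix b' :: exps and w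
  have "exp_shift n k k b' = b'" by (simp add: exp_shift_def)
  then show "lookup (V_part p m (E n k k) (single b' w)) b
      = scale (b (res n k) - m) (lookup (single b' w) b)"
    by (simp add: V_part_E_single char_coeff_def lookup_minus lookup_single when_def scale_left_diff_distrib)
qed (simp_all add: lookup_add scale_right_distrib)

end

locale verma_pair =
  M: generic_verma scale n act v a p + M': verma_rep scale' n act' v' a' p
  for scale :: "complex \<Rightarrow> 'a::ab_group_add \<Rightarrow> 'a" and n and act and v and a and p
    and scale' :: "complex \<Rightarrow> 'b::ab_group_add \<Rightarrow> 'b" and act' and v' and a' +
  fixes m :: complex
begin

definition top_exp :: exps where
  "top_exp = (\<lambda>k. if k \<in> {1..n} then a' k - a k + m else 0)"

text \<open>The exponents of the weight that a vector of degree \<open>d\<close> in \<open>M\<close> leaves to the second factor.\<close>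

definition expo :: "(nat \<Rightarrow> int) \<Rightarrow> exps" where
  "expo d = (\<lambda>r. if r \<in> {1..n} then top_exp r - of_int (wt n d (int r)) else 0)"

text \<open>Minus the matrix coefficient of \<open>E n k l\<close> on the symbol with exponents \<open>expo d\<close>. The sum of the
  \<open>f\<^sub>d \<otimes> y\<^sup>b\<close> with \<open>b = expo d\<close> is singular precisely if, for \<open>k > l\<close>, \<open>e k l\<close> maps the \<open>f\<close> of degree
  \<open>d - edeg n k l\<close> to \<open>lowering_coeff k l d\<close> times \<open>f\<^sub>d\<close>.\<close>

definition lowering_coeff :: "int \<Rightarrow> int \<Rightarrow> (nat \<Rightarrow> int) \<Rightarrow> complex" where
  "lowering_coeff k l d = m * char_coeff n p (k - l) - (-1) powi (k - l) * expo d (res n l)"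

definition singular :: "(nat \<Rightarrow> int) \<Rightarrow> (exps \<Rightarrow>\<^sub>0 'a)" where
  "singular d = single (expo d) (M.family lowering_coeff d)"

abbreviation "intertwiner \<equiv> is_intertwiner n p m scale' act' scale act v"

abbreviation "A_op \<equiv> is_A_op n p m scale' act' v' scale act v"

abbreviation T where "T \<equiv> tens_act n p m scale act"

lemmas n_pos = M.n_pos

lemma expo_res: "expo d (res n l) = top_exp (res n l) - of_int (wt n d l)"
  using res_range[OF n_pos, of l] by (simp add: expo_def wt_res[OF n_pos])

lemma dvd_res: "int n dvd k - l \<longleftrightarrow> res n k = res n l"
  using res_eq_iff[OF n_pos] by simp

lemma expo_diff: "expo (\<lambda>r. d r - edeg n k l r) (res n j)
    = expo d (res n j) + (if res n k = res n j then 1 else 0) - (if res n l = res n j then 1 else 0)"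
  by (auto simp: expo_res wt_edeg[OF n_pos] dvd_res)

lemma expo_shift: "exp_shift n k l (expo d) = expo (\<lambda>r. d r - edeg n k l r)"
proof
  fix r
  show "exp_shift n k l (expo d) r = expo (\<lambda>r. d r - edeg n k l r) r"
  proof (cases "r \<in> {1..n}")
    case True
    then show ?thesis using expo_diff[of d k l "int r"] by (auto simp: exp_shift_def)
  next
    case False
    then have "r \<noteq> res n k" "r \<noteq> res n l" using res_range[OF n_pos] by metis+
    then show ?thesis unfolding exp_shift_def expo_def if_not_P[OF False] by simp
  qed
qed

text \<open>The relations of \<open>V\<close>, read off on the symbols with exponents \<open>expo d\<close>.\<close>

lemma lowering_coeff_comm:
  "lowering_coeff i j (\<lambda>r. d r - edeg n k l r) * lowering_coeff k l d - lowering_coeff k l (\<lambda>r. d r - edeg n i j r) * lowering_coeff i j d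
    = (if int n dvd l - i then lowering_coeff k (j + l - i) d else 0) - (if int n dvd k - j then lowering_coeff (i + k - j) l d else 0)"
proof -
  define s where "s i j = ((-1) powi (i - j) :: complex)" for i j :: int
  define \<chi> where "\<chi> k = m * char_coeff n p k" for k
  define x where "x j = expo d (res n j)" for j
  define \<delta> where "\<delta> i j = (if res n i = res n j then 1 else 0 :: complex)" for i j
  have lc: "lowering_coeff i j d = \<chi> (i - j) - s i j * x j" for i j
    by (simp add: lowering_coeff_def s_def \<chi>_def x_def)
  have lc_diff: "lowering_coeff i j (\<lambda>r. d r - edeg n k l r) = \<chi> (i - j) - s i j * (x j + \<delta> k j - \<delta> l j)" for i j k l
    by (simp add: lowering_coeff_def s_def \<chi>_def x_def expo_diff \<delta>_def)
  have \<chi>0: "\<chi> (i - j) * (\<delta> i l - \<delta> j l) = 0" for i j l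
  proof (cases "res n i = res n j")
    case False
    then have "\<not> int n dvd i - j" by (simp add: dvd_res)
    then show ?thesis by (auto simp: \<chi>_def char_coeff_def)
  qed (simp add: \<delta>_def)
  have \<delta>x: "\<delta> l j * x l = \<delta> j l * x j" for l j by (auto simp: \<delta>_def x_def)
  have sym: "\<delta> i j = \<delta> j i" for i j by (simp add: \<delta>_def)
  have lhs: "lowering_coeff i j (\<lambda>r. d r - edeg n k l r) * lowering_coeff k l d - lowering_coeff k l (\<lambda>r. d r - edeg n i j r) * lowering_coeff i j d
     = s i j * s k l * (\<delta> k j * x l - \<delta> i l * x j)"
  proof -
    have "(\<chi> (i - j) - s i j * (x j + \<delta> k j - \<delta> l j)) * (\<chi> (k - l) - s k l * x l)
        - (\<chi> (k - l) - s k l * (x l + \<delta> i l - \<delta> j l)) * (\<chi> (i - j) - s i j * x j)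
      = s i j * s k l * (\<delta> k j * x l - \<delta> i l * x j) - s i j * s k l * (\<delta> l j * x l - \<delta> j l * x j)
        - s i j * (\<chi> (k - l) * (\<delta> k j - \<delta> l j)) + s k l * (\<chi> (i - j) * (\<delta> i l - \<delta> j l))"
      by (simp add: algebra_simps)
    then show ?thesis unfolding lc lc_diff \<chi>0 \<delta>x by simp
  qed
  have s_eq: "s k (j + l - i) = s i j * s k l" "s (i + k - j) l = s i j * s k l"
    by (auto simp: s_def power_int_add[symmetric] power_int_minus_left algebra_simps)
  have \<chi>1: "\<chi> (i - j + (k - l)) * (\<delta> i l - \<delta> k j) = 0"
  proof (cases "res n j = res n k \<longleftrightarrow> res n i = res n l")
    case False
    then have "\<not> int n dvd (i - l) - (j - k)"
      using dvd_diff[of "int n" "i - l" "(i - l) - (j - k)"] dvd_add[of "int n" "(i - l) - (j - k)" "j - k"] dvd_res by auto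
    then have "\<not> int n dvd i - j + (k - l)" by (simp add: algebra_simps)
    then show ?thesis by (auto simp: \<chi>_def char_coeff_def)
  qed (auto simp: \<delta>_def)
  have 1: "(if int n dvd l - i then lowering_coeff k (j + l - i) d else 0) = \<delta> i l * (\<chi> (i - j + (k - l)) - s i j * s k l * x j)"
  proof (cases "res n i = res n l")
    case True
    then have "int n dvd l - i" by (simp add: dvd_res)
    then have "int n dvd (j + l - i) - j" by simp
    then have "x (j + l - i) = x j" unfolding dvd_res by (simp add: x_def)
    moreover have ix: "k - (j + l - i) = i - j + (k - l)" by simp
    ultimately show ?thesis using True \<open>int n dvd l - i\<close> unfolding lc s_eq ix by (simp add: \<delta>_def)
  qed (simp add: dvd_res \<delta>_def eq_commute)
  have 2: "(if int n dvd k - j then lowering_coeff (i + k - j) l d else 0) = \<delta> k j * (\<chi> (i - j + (k - l)) - s i j * s k l * x l)"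
  proof -
    have "i + k - j - l = i - j + (k - l)" by simp
    then show ?thesis unfolding lc s_eq by (simp only:) (simp add: \<delta>_def dvd_res)
  qed
  show ?thesis unfolding lhs 1 2 using \<chi>1 by algebra
qed

lemma family_pc: "M.family lowering_coeff d \<in> M.pc d"
  and family_e: "k > l \<Longrightarrow> M.e k l (M.family lowering_coeff d) = scale (lowering_coeff k l (\<lambda>r. d r + edeg n k l r)) (M.family lowering_coeff (\<lambda>r. d r + edeg n k l r))"
proof -
  have "lowering_coeff (k + int n) (l + int n) d = lowering_coeff k l d" for k l d
    using block_shift(2)[OF n_pos, of l 1] by (simp add: lowering_coeff_def)
  from M.family_lower[of lowering_coeff, OF this lowering_coeff_comm]
  show "M.family lowering_coeff d \<in> M.pc d"
    "k > l \<Longrightarrow> M.e k l (M.family lowering_coeff d) = scale (lowering_coeff k l (\<lambda>r. d r + edeg n k l r)) (M.family lowering_coeff (\<lambda>r. d r + edeg n k l r))"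
    by blast+
qed

lemma singular_lower:
  assumes "k > l"
  shows "T (E n k l) singular = 0"
proof
  fix d
  let ?d = "\<lambda>r. d r - edeg n k l r"
  have "T (E n k l) singular d = single (expo ?d) (M.e k l (M.family lowering_coeff ?d))
     + (single (expo ?d) (scale ((-1) powi (k - l) * expo d (res n l)) (M.family lowering_coeff d))
     - single (expo d) (scale (m * char_coeff n p (k - l)) (M.family lowering_coeff d)))"
    by (simp add: M.tens_act_E singular_def M.map_act_single M.V_part_E_single expo_shift)
  also have "single (expo d) (scale (m * char_coeff n p (k - l)) (M.family lowering_coeff d))
      = single (expo ?d) (scale (m * char_coeff n p (k - l)) (M.family lowering_coeff d))"
  proof (cases "res n k = res n l")
    case True
    then have "exp_shift n k l (expo d) = expo d" by (auto simp: exp_shift_def)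
    then show ?thesis by (simp add: expo_shift)
  next
    case False
    then have "\<not> int n dvd k - l" by (simp add: dvd_res)
    then have "char_coeff n p (k - l) = 0" by (auto simp: char_coeff_def)
    then show ?thesis by simp
  qed
  also have "M.e k l (M.family lowering_coeff ?d) = scale (lowering_coeff k l d) (M.family lowering_coeff d)"
    using family_e[OF assms, of ?d] by simp
  also have "scale (lowering_coeff k l d) (M.family lowering_coeff d) = scale (m * char_coeff n p (k - l)) (M.family lowering_coeff d)
      - scale ((-1) powi (k - l) * expo d (res n l)) (M.family lowering_coeff d)"
    unfolding lowering_coeff_def[of k l d] by (rule M.scale_left_diff_distrib)
  finally show "T (E n k l) singular d = 0 d"
    by (simp add: single_diff)
qed

lemma singular_weight:
  assumes "k \<in> {1..n}"
  shows "T (E n (int k) (int k)) singular d = tens_scale scale (a' k - of_nat k) (singular d)"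
proof -
  have "M.shifted_a (int k) = a k" using assms by (auto simp: M.shifted_a_def)
  then have "M.e (int k) (int k) (M.family lowering_coeff d) = scale (a k - of_nat k + of_int (wt n d (int k))) (M.family lowering_coeff d)"
    using M.weight_pc[OF family_pc, of "int k" d] by (simp add: M.weight_at_def)
  moreover have "exp_shift n (int k) (int k) (expo d) = expo d" by (simp add: exp_shift_def)
  moreover have "expo d k = a' k - a k + m - of_int (wt n d (int k))"
    using assms by (simp add: expo_def top_exp_def)
  ultimately show ?thesis
    using assms
    by (simp add: M.tens_act_E singular_def M.map_act_single M.V_part_E_single char_coeff_def
        flip: single_add single_diff M.scale_left_distrib M.scale_left_diff_distrib)
qed

lemma singular_level: "T gam singular d = tens_scale scale (of_nat n + p) (singular d)"
  by (simp add: M.tens_act_gam singular_def M.map_act_single M.gam_v)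

lemma singular_0: "singular (\<lambda>_. 0) = single top_exp v"
proof -
  have "expo (\<lambda>_. 0) = top_exp" by (auto simp: expo_def top_exp_def wt_def)
  then show ?thesis by (simp add: singular_def)
qed

sublocale W: affgl_rep "\<lambda>c F d. tens_scale scale c (F d)" n T
  by (rule M.tensor_rep)

lemma tens_completion_iff:
  "F \<in> tens_completion n scale act v \<longleftrightarrow>
    (\<forall>d b. lookup (F d) b \<in> M.pc d \<and> (b \<notin> exps n \<longrightarrow> lookup (F d) b = 0))"
  unfolding tens_completion_def by (auto simp: in_keys_iff subset_iff) 

lemma exp_shift_exps:
  assumes "b \<in> exps n"
  shows "exp_shift n i j b \<in> exps n"
proof -
  have "r \<noteq> res n i \<and> r \<noteq> res n j" if "r \<notin> {1..n}" for r using that res_range[OF n_pos] by metis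
  then show ?thesis using assms by (auto simp: exps_def exp_shift_def)
qed

text \<open>The universal property yields families without any condition on their values; the conditions that
  define the completion are inherited from the singular vector.\<close>

lemma completion_closed:
  assumes F: "F \<in> tens_completion n scale act v"
  shows "T (E n i j) F \<in> tens_completion n scale act v"
  unfolding tens_completion_iff
proof (intro allI)
  fix d b
  let ?d = "\<lambda>r. d r - edeg n i j r"
  note F' = F[unfolded tens_completion_iff, rule_format]
  have 1: "M.e i j (lookup (F ?d) b) \<in> M.pc d" "b \<notin> exps n \<Longrightarrow> lookup (F ?d) b = 0"
    using M.e_pc[of "lookup (F ?d) b" ?d i j] F'[of ?d b] by simp_all
  have single: "lookup (single b' w) b \<in> M.pc d \<and> (b \<notin> exps n \<longrightarrow> lookup (single b' w) b = 0)"
    if "w \<in> M.pc d" "b' \<in> exps n" for b' w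
    using that by (auto simp: lookup_single when_def M.pc_closed)
  have V: "M.V_part p m (E n i j) (F d) = (\<Sum>b\<in>keys (F d). M.V_part p m (E n i j) (single b (lookup (F d) b)))"
    using poly_mapping_decomp[of "F d"] by (metis M.V_part_sum)
  have 2: "lookup (M.V_part p m (E n i j) (F d)) b \<in> M.pc d \<and>
     (b \<notin> exps n \<longrightarrow> lookup (M.V_part p m (E n i j) (F d)) b = 0)"
  proof -
    have "lookup (M.V_part p m (E n i j) (single b' (lookup (F d) b'))) b \<in> M.pc d \<and>
      (b \<notin> exps n \<longrightarrow> lookup (M.V_part p m (E n i j) (single b' (lookup (F d) b'))) b = 0)"
      if "b' \<in> keys (F d)" for b'
    proof -
      have b': "b' \<in> exps n" using that F'[of d b'] by (auto simp: in_keys_iff)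
      note sc = M.pc_closed(3)[OF conjunct1[OF F'[of d b']]]
      show ?thesis
        unfolding M.V_part_E_single lookup_minus
        using single[OF sc exp_shift_exps[OF b']] single[OF sc b'] by (auto intro: M.pc_closed(5))
    qed
    then show ?thesis unfolding V lookup_sum by (auto intro!: M.pc_closed(4) sum.neutral)
  qed
  show "lookup (T (E n i j) F d) b \<in> M.pc d \<and> (b \<notin> exps n \<longrightarrow> lookup (T (E n i j) F d) b = 0)"
    using 1 2 by (auto simp: M.tens_act_E lookup_add M.pc_closed)
qed

lemma singular_completion: "singular \<in> tens_completion n scale act v"
proof -
  have "expo d \<in> exps n" for d by (auto simp: exps_def expo_def)
  then show ?thesis unfolding tens_completion_iff singular_def
    using family_pc by (auto simp: lookup_single when_def M.pc_closed)
qed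

lemma intertwiner_exists:
  "\<exists>\<Phi>. intertwiner \<Phi> \<and> \<Phi> v' = singular"
proof -
  have weight: "T (E n (int k) (int k)) singular = (\<lambda>d. tens_scale scale (a' k - of_nat k) (singular d))" if "k \<in> {1..n}" for k
    using singular_weight[OF that] by (intro ext)
  have level: "T gam singular = (\<lambda>d. tens_scale scale (of_nat n + p) (singular d))"
    using singular_level by (intro ext)
  obtain \<phi> where \<phi>: "Vector_Spaces.linear scale' (\<lambda>c F d. tens_scale scale c (F d)) \<phi>" "\<phi> v' = singular"
    "\<forall>X\<in>affgl n. \<forall>w. \<phi> (act' X w) = T X (\<phi> w)"
    using M'.universal_property[OF W.affgl_rep_axioms, of singular] singular_lower weight level by blast
  interpret l: Vector_Spaces.linear scale' "\<lambda>c F d. tens_scale scale c (F d)" \<phi> by (rule \<phi>(1))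
  interpret ts: vector_space "tens_scale scale" by (rule M.tens_scale_vs)
  have "Vector_Spaces.linear scale' (tens_scale scale) (\<lambda>w. \<phi> w d)" for d
    by (intro Vector_Spaces.linear.intro module_hom.intro module_hom_axioms.intro
      M'.vector_space_axioms ts.vector_space_axioms M'.module_axioms ts.module_axioms) (simp_all add: l.add l.scale)
  moreover have "\<phi> w \<in> tens_completion n scale act v" for w
  proof (induction w rule: M'.verma_induct)
    case zero
    then show ?case by (simp add: tens_completion_iff l.zero M.pc_closed)
  next
    case (add w w')
    then show ?case by (auto simp: tens_completion_iff l.add lookup_add M.pc_closed)
  next
    case (scale c w)
    then show ?case by (auto simp: tens_completion_iff l.scale M.pc_closed)
  next
    case base
    then show ?case using singular_completion \<phi>(2) by simp
  next
    case (raise i j w)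
    then show ?case using \<phi>(3) completion_closed by simp
  qed
  ultimately show ?thesis using \<phi> unfolding is_intertwiner_def by blast
qed

text \<open>In the lowest degree in which \<open>H\<close> does not vanish, the second factor contributes nothing to the lowered
  vector, so the coefficients of \<open>H\<close> are singular vectors of \<open>M\<close>.\<close>

lemma no_singular_tensor:
  assumes H: "H \<in> tens_completion n scale act v" and H0: "H (\<lambda>_. 0) = 0"
    and low: "\<And>k l. k > l \<Longrightarrow> T (E n k l) H = 0"
  shows "H = 0"
proof
  fix d
  show "H d = 0 d"
  proof (induction "nat (tdeg n d)" arbitrary: d rule: less_induct)
    case less
    show ?case
    proof (rule poly_mapping_eqI)
      fix b
      let ?w = "lookup (H d) b"
      have w: "?w \<in> M.pc d" using H by (simp add: tens_completion_iff)
      consider "d = (\<lambda>_. 0)" | "?w = 0" | "tdeg n d > 0" "d \<noteq> (\<lambda>_. 0)" using M.pc_bounded(1)[OF w] by fastforce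
      then have "?w = 0"
      proof cases
        case 3
        have "M.e k l ?w = 0" if kl: "k > l" for k l
        proof -
          let ?d = "\<lambda>r. d r + edeg n k l r"
          have "H ?d = 0 ?d" using less[of ?d] 3 kl n_pos by auto
          then show ?thesis
            using fun_cong[OF low[OF kl], of ?d] arg_cong[of _ _ "\<lambda>x. lookup x b"]
            by (simp add: M.tens_act_E) (metis M.e_lin(3) lookup_map_zero lookup_zero)
        qed
        then show ?thesis using M.no_singular[OF w 3(2)] by blast
      qed (use H0 in auto)
      then show "?w = lookup (0 d) b" by simp
    qed
  qed
qed

text \<open>The degree zero part of \<open>\<Psi> v'\<close> is a multiple of \<open>v\<close> tensored with a symbol whose exponents are forced by
  the weights. Subtracting the same multiple of \<open>\<Phi>\<close> leaves a singular vector without degree zero part.\<close>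

lemma intertwiner_unique:
  assumes \<Phi>: "intertwiner \<Phi>" "\<Phi> v' = singular"
    and \<Psi>: "intertwiner \<Psi>"
  shows "\<exists>c. \<Psi> = (\<lambda>w d. tens_scale scale c (\<Phi> w d))"
proof -
  have lin: "\<Theta> (w + w') = \<Theta> w + \<Theta> w'" "\<Theta> (scale' c w) = (\<lambda>d. tens_scale scale c (\<Theta> w d))" "\<Theta> 0 = 0"
    "\<Theta> (M'.e i j w) = T (E n i j) (\<Theta> w)" "\<Theta> w \<in> tens_completion n scale act v"
    if "intertwiner \<Theta>" for \<Theta> w w' c i j
  proof -
    have l: "Vector_Spaces.linear scale' (tens_scale scale) (\<lambda>w. \<Theta> w d)" for d
      using that by (simp add: is_intertwiner_def)
    interpret l: Vector_Spaces.linear scale' "tens_scale scale" "\<lambda>w. \<Theta> w d" for d by (rule l)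
    show "\<Theta> (w + w') = \<Theta> w + \<Theta> w'" "\<Theta> (scale' c w) = (\<lambda>d. tens_scale scale c (\<Theta> w d))" "\<Theta> 0 = 0"
      by (simp_all add: fun_eq_iff l.add l.scale l.zero)
    show "\<Theta> (M'.e i j w) = T (E n i j) (\<Theta> w)" "\<Theta> w \<in> tens_completion n scale act v"
      using that by (simp_all add: is_intertwiner_def)
  qed
  let ?G = "\<Psi> v'"
  note G = lin(5)[OF \<Psi>, of v', unfolded tens_completion_iff, rule_format]
  have G0: "lookup (?G (\<lambda>_. 0)) b \<in> M.span {v}" for b
    using M.pc_bounded(1)[OF conjunct1[OF G[of "\<lambda>_. 0" b]]] by (auto simp: M.span_zero)
  then obtain c where c: "lookup (?G (\<lambda>_. 0)) top_exp = scale c v"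
    by (auto simp: M.span_singleton)
  have other: "lookup (?G (\<lambda>_. 0)) b = 0" if "b \<noteq> top_exp" for b
  proof (rule ccontr)
    let ?w = "lookup (?G (\<lambda>_. 0)) b"
    assume w: "?w \<noteq> 0"
    then have "b \<in> exps n" using G by blast
    moreover have "b k = top_exp k" if k: "k \<in> {1..n}" for k
    proof -
      have "M.e (int k) (int k) ?w = scale (a k - of_nat k) ?w"
      proof -
        obtain x where "?w = scale x v" using G0[of b] by (auto simp: M.span_singleton)
        then show ?thesis using M.weight[OF k] by (simp add: M.scale_left_commute)
      qed
      then have "lookup (T (E n (int k) (int k)) ?G (\<lambda>_. 0)) b = scale (a k - of_nat k + (b k - m)) ?w"
        using k by (simp add: M.tens_act_E lookup_add M.V_part_diag M.scale_left_distrib)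
      moreover have "T (E n (int k) (int k)) ?G = (\<lambda>d. tens_scale scale (a' k - of_nat k) (?G d))"
        using lin(4)[OF \<Psi>, of "int k" "int k" v'] M'.weight[OF k] lin(2)[OF \<Psi>] by simp
      ultimately have "scale (a' k - of_nat k) ?w = scale (a k - of_nat k + (b k - m)) ?w" by simp
      then have "a' k - of_nat k = a k - of_nat k + (b k - m)" using w by simp
      then show ?thesis using k by (simp add: top_exp_def algebra_simps)
    qed
    ultimately have "b = top_exp" by (auto simp: exps_def top_exp_def)
    then show False using that by simp
  qed
  have top: "?G (\<lambda>_. 0) = single top_exp (scale c v)"
    by (rule poly_mapping_eqI) (use c other in \<open>auto simp: lookup_single when_def\<close>)
  define H where "H = ?G - (\<lambda>d. tens_scale scale c (singular d))"
  have "H = 0"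
  proof (rule no_singular_tensor)
    show "H \<in> tens_completion n scale act v"
      using G singular_completion by (auto simp: H_def tens_completion_iff lookup_minus M.pc_closed)
    show "H (\<lambda>_. 0) = 0" by (simp add: H_def top singular_0)
    fix k l :: int assume kl: "k > l"
    have "T (E n k l) ?G = 0"
      using lin(4)[OF \<Psi>, of k l v', symmetric] M'.lower[OF kl] lin(3)[OF \<Psi>] by simp
    then show "T (E n k l) H = 0"
      unfolding H_def W.e_lin using singular_lower[OF kl] by (simp add: fun_eq_iff) (metis M.scale_zero_right M.tens_scale_single single_zero)
  qed
  then have "?G = (\<lambda>d. tens_scale scale c (\<Phi> v' d))" by (simp add: H_def \<Phi>(2))
  then have "\<Psi> w = (\<lambda>d. tens_scale scale c (\<Phi> w d))" for w
  proof (induction w rule: M'.verma_induct)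
    case (raise i j w)
    then show ?case by (simp add: lin(4)[OF \<Psi>] lin(4)[OF \<Phi>(1)])
  next
    case zero
    show ?case unfolding lin(3)[OF \<Psi>] lin(3)[OF \<Phi>(1)] by (rule W.scale_zero_right[of c, symmetric])
  next
    case (add w w')
    then show ?case by (simp add: lin(1)[OF \<Psi>] lin(1)[OF \<Phi>(1)] fun_eq_iff M.tens_scale_add)
  next
    case (scale d w)
    then show ?case using W.scale_left_commute[of c d "\<Phi> w"] by (simp add: lin(2)[OF \<Psi>] lin(2)[OF \<Phi>(1)])
  qed simp
  then show ?thesis by blast
qed

lemma intertwiner_normalized: "\<Phi> v' = singular \<Longrightarrow> normalized n m a' v' a v \<Phi>"
  by (simp add: normalized_def singular_0 top_exp_def)

end

section \<open>The element \<open>g\<close>\<close>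

lemma sum_swap_triangle:
  fixes f :: "nat \<Rightarrow> nat \<Rightarrow> 'a::comm_monoid_add"
  shows "(\<Sum>j=1..d. \<Sum>i=u..d - j. f j i) = (\<Sum>i=u..d. \<Sum>j=1..d - i. f j i)"
  unfolding sum.Sigma[OF finite_atLeastAtMost ballI[OF finite_atLeastAtMost]]
  by (rule sum.reindex_bij_witness[of _ "\<lambda>(i, j). (j, i)" "\<lambda>(j, i). (i, j)"]) auto

lemma sum_triangle_diagonals:
  fixes f :: "nat \<Rightarrow> nat \<Rightarrow> 'a::comm_monoid_add"
  shows "(\<Sum>j=1..d. \<Sum>i=0..d - j. f j i) = (\<Sum>k=1..d. \<Sum>j=1..k. f j (k - j))"
  unfolding sum.Sigma[OF finite_atLeastAtMost ballI[OF finite_atLeastAtMost]]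
  by (rule sum.reindex_bij_witness[of _ "\<lambda>(k, j). (j, k - j)" "\<lambda>(j, i). (i + j, j)"]) auto

context affgl_rep
begin

text \<open>The part of the \<open>k\<close>-th power of \<open>log g\<close> that lowers the total degree by \<open>d\<close>. Working with these parts
  replaces the exponential series by finite sums.\<close>

primrec log_power :: "nat \<Rightarrow> nat \<Rightarrow> 'a \<Rightarrow> 'a" where
  "log_power 0 d w = (if d = 0 then w else 0)"
| "log_power (Suc k) d w = (\<Sum>l=1..d. scale ((-1) ^ (l - 1) / of_nat l) (S (int l) (log_power k (d - l) w)))"

definition g_part :: "nat \<Rightarrow> 'a \<Rightarrow> 'a" where
  "g_part d w = (\<Sum>k=0..d. scale (1 / fact k) (log_power k d w))"

lemma log_power_lin:
  "log_power k d (w + w') = log_power k d w + log_power k d w'"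
  "log_power k d (scale c w) = scale c (log_power k d w)"
  "log_power k d 0 = 0"
  by (induction k arbitrary: d)
     (simp_all add: scale_right_distrib sum.distrib scale_sum_right mult_ac)

lemma log_power_big: "d < k \<Longrightarrow> log_power k d w = 0"
  by (induction k arbitrary: d) (auto intro!: sum.neutral)

lemma g_part_lin:
  "g_part d (w + w') = g_part d w + g_part d w'"
  "g_part d (scale c w) = scale c (g_part d w)"
  "g_part d 0 = 0"
  by (simp_all add: g_part_def log_power_lin scale_right_distrib sum.distrib scale_sum_right scale_left_commute)

lemma g_part_0 [simp]: "g_part 0 w = w"
  by (simp add: g_part_def)

text \<open>Multiplication by the degree is a derivation, and the \<open>S l\<close> commute; so the power rule holds for it.\<close>

lemma log_power_derivation:
  "scale (of_nat d) (log_power (Suc k) d w) =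
    scale (of_nat (Suc k)) (\<Sum>l=1..d. scale ((-1) ^ (l - 1)) (S (int l) (log_power k (d - l) w)))"
proof (induction k arbitrary: d)
  case 0
  have 1: "(\<Sum>l=1..d. scale (c l) (S (int l) (log_power 0 (d - l) w))) = (if d = 0 then 0 else scale (c d) (S (int d) w))" for c
  proof (cases "d = 0")
    case False
    have "(\<Sum>l=1..d. scale (c l) (S (int l) (log_power 0 (d - l) w))) = (\<Sum>l=1..d. if l = d then scale (c d) (S (int d) w) else 0)"
      by (rule sum.cong) auto
    then show ?thesis using False by simp
  qed simp
  show ?case unfolding log_power.simps(2) 1 by simp
next
  case (Suc k)
  define q c where "q l = ((-1) ^ (l - 1) :: complex)" and "c l = ((-1) ^ (l - 1) / of_nat l :: complex)" for l :: nat
  have qc: "of_nat l * c l = q l" if "l \<ge> 1" for l using that by (simp add: q_def c_def)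
  have rec: "log_power (Suc k) d w = (\<Sum>l=1..d. scale (c l) (S (int l) (log_power k (d - l) w)))" for k d
    by (simp add: c_def)
  have "scale (of_nat d) (log_power (Suc (Suc k)) d w)
      = (\<Sum>l=1..d. scale (q l) (S (int l) (log_power (Suc k) (d - l) w)))
       + (\<Sum>l=1..d. scale (c l) (S (int l) (scale (of_nat (d - l)) (log_power (Suc k) (d - l) w))))"
    unfolding rec[of "Suc k" d] scale_sum_right sum.distrib[symmetric]
  proof (rule sum.cong)
    fix l assume l: "l \<in> {1..d}"
    have "of_nat d * c l = q l + c l * of_nat (d - l)"
      using l qc[of l, symmetric] by (simp add: of_nat_diff algebra_simps)
    then show "scale (of_nat d) (scale (c l) (S (int l) (log_power (Suc k) (d - l) w))) =
      scale (q l) (S (int l) (log_power (Suc k) (d - l) w)) + scale (c l) (S (int l) (scale (of_nat (d - l)) (log_power (Suc k) (d - l) w)))"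
      by (simp add: scale_left_distrib del: log_power.simps)
  qed simp
  also have "(\<Sum>l=1..d. scale (c l) (S (int l) (scale (of_nat (d - l)) (log_power (Suc k) (d - l) w))))
    = scale (of_nat (Suc k)) (\<Sum>l=1..d. \<Sum>l'=1..d - l. scale (c l * q l') (S (int l) (S (int l') (log_power k (d - l - l') w))))"
    unfolding Suc.IH q_def[symmetric] by (simp add: S_sum scale_sum_right ac_simps)
  also have "(\<Sum>l=1..d. \<Sum>l'=1..d - l. scale (c l * q l') (S (int l) (S (int l') (log_power k (d - l - l') w))))
    = (\<Sum>l'=1..d. \<Sum>l=1..d - l'. scale (c l * q l') (S (int l) (S (int l') (log_power k (d - l - l') w))))"
    by (rule sum_swap_triangle)
  also have "\<dots> = (\<Sum>l'=1..d. scale (q l') (S (int l') (log_power (Suc k) (d - l') w)))"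
    unfolding rec S_sum scale_sum_right
  proof (intro sum.cong refl)
    fix l' l assume "l' \<in> {1..d}" "l \<in> {1..d - l'}"
    then show "scale (c l * q l') (S (int l) (S (int l') (log_power k (d - l - l') w))) =
      scale (q l') (S (int l') (scale (c l) (S (int l) (log_power k (d - l' - l) w))))"
      using S_S_comm[of "int l" "int l'"] by (simp add: mult.commute add.commute)
  qed
  finally show ?case
    by (simp only: q_def of_nat_Suc[of "Suc k"] scale_left_distrib scale_one)
qed

text \<open>Newton's identity: as the exponential of the alternating series of the power sums \<open>S l\<close>, the series \<open>g\<close> has
  the elementary symmetric functions as its parts.\<close>

lemma g_part_newton:
  "scale (of_nat d) (g_part d w) = (\<Sum>l=1..d. scale ((-1) ^ (l - 1)) (S (int l) (g_part (d - l) w)))"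
proof (cases d)
  case (Suc d')
  have "scale (of_nat d) (g_part d w) = (\<Sum>k=0..d. scale (1 / fact k) (scale (of_nat d) (log_power k d w)))"
    by (simp add: g_part_def scale_sum_right mult.commute)
  also have "\<dots> = (\<Sum>k=0..d'. scale (1 / fact (Suc k)) (scale (of_nat d) (log_power (Suc k) d w)))"
    unfolding Suc by (subst sum.atLeast0_atMost_Suc_shift) (simp del: log_power.simps(2) fact_Suc)
  also have "\<dots> = (\<Sum>k=0..d'. \<Sum>l=1..d. scale ((-1) ^ (l - 1)) (S (int l) (scale (1 / fact k) (log_power k (d - l) w))))"
  proof (rule sum.cong)
    fix k
    have "(1 / fact (Suc k)) * of_nat (Suc k) = (1 / fact k :: complex)"
      by (simp add: divide_simps del: of_nat_Suc)
    then show "scale (1 / fact (Suc k)) (scale (of_nat d) (log_power (Suc k) d w)) =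
      (\<Sum>l=1..d. scale ((-1) ^ (l - 1)) (S (int l) (scale (1 / fact k) (log_power k (d - l) w))))"
      unfolding log_power_derivation scale_scale by (simp add: scale_sum_right mult.commute del: fact_Suc of_nat_Suc)
  qed simp
  also have "\<dots> = (\<Sum>l=1..d. scale ((-1) ^ (l - 1)) (S (int l) (\<Sum>k=0..d'. scale (1 / fact k) (log_power k (d - l) w))))"
    unfolding S_sum scale_sum_right by (rule sum.swap)
  also have "\<dots> = (\<Sum>l=1..d. scale ((-1) ^ (l - 1)) (S (int l) (g_part (d - l) w)))"
  proof (rule sum.cong)
    fix l assume "l \<in> {1..d}"
    then have "(\<Sum>k=0..d'. scale (1 / fact k) (log_power k (d - l) w)) = g_part (d - l) w"
      unfolding g_part_def using Suc by (intro sum.mono_neutral_right) (auto simp: log_power_big)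
    then show "scale ((-1) ^ (l - 1)) (S (int l) (\<Sum>k=0..d'. scale (1 / fact k) (log_power k (d - l) w)))
      = scale ((-1) ^ (l - 1)) (S (int l) (g_part (d - l) w))" by simp
  qed simp
  finally show ?thesis .
qed simp

text \<open>The coefficients of the series \<open>(1 + L) / (1 + R)\<close> by which \<open>g\<close> conjugates, where \<open>L\<close> raises the first
  index and \<open>R\<close> lowers the second.\<close>

fun conj_coeff :: "nat \<Rightarrow> int \<Rightarrow> int \<Rightarrow> 'a \<Rightarrow> 'a" where
  "conj_coeff 0 k l x = e k l x"
| "conj_coeff (Suc i) k l x = scale ((-1) ^ i) (e (k + 1) (l - int i) x - e k (l - int i - 1) x)"

lemma conj_coeff_lin:
  "conj_coeff i k l (x + y) = conj_coeff i k l x + conj_coeff i k l y"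
  "conj_coeff i k l (scale c x) = scale c (conj_coeff i k l x)"
  "conj_coeff i k l 0 = 0"
  by (cases i; simp add: algebra_simps scale_right_diff_distrib scale_right_distrib scale_left_commute)+

lemma conj_coeff_sum: "conj_coeff i k l (sum f A) = (\<Sum>j\<in>A. conj_coeff i k l (f j))"
  by (induction A rule: infinite_finite_induct) (auto simp: conj_coeff_lin)

lemma S_conj_coeff:
  "S t (conj_coeff i k l x) = conj_coeff i k l (S t x) + (conj_coeff i (k + t) l x - conj_coeff i k (l - t) x)"
  by (cases i) (simp_all add: S_e algebra_simps scale_right_diff_distrib scale_right_distrib)

text \<open>The logarithmic derivative of \<open>(1 + L) / (1 + R)\<close>, coefficient by coefficient; the sum telescopes.\<close>

lemma conj_coeff_newton:
  assumes "r \<ge> 1"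
  shows "(\<Sum>j=1..r. scale ((-1) ^ (j - 1)) (conj_coeff (r - j) (k + int j) l x - conj_coeff (r - j) k (l - int j) x))
    = scale (of_nat r) (conj_coeff r k l x)"
proof -
  obtain N where N: "r = Suc N" using assms by (cases r) auto
  define X where "X a b = e (k + int a) (l - int b) x" for a b
  have r: "conj_coeff r k l x = scale ((-1) ^ N) (X 1 N - X 0 (Suc N))"
    by (simp add: N X_def diff_diff_add add.commute)
  \<comment> \<open>The summand \<open>j = r\<close> has a different shape, as \<open>conj_coeff 0\<close> has one term only.\<close>
  have "(\<Sum>j=1..N. scale ((-1) ^ (j - 1)) (conj_coeff (r - j) (k + int j) l x - conj_coeff (r - j) k (l - int j) x))
    = (\<Sum>j=1..N. scale (- ((-1) ^ N)) ((X (Suc j) (Suc N - Suc j) - X j (Suc N - j)) - (X 1 N - X 0 (Suc N))))"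
  proof (rule sum.cong)
    fix j assume j: "j \<in> {1..N}"
    then obtain i where i: "N = i + j" using le_Suc_ex[of j N] by (auto simp: add.commute)
    obtain j' where j': "j = Suc j'" using j by (cases j) auto
    have "(-1) ^ (j - 1) * (-1) ^ i = (- ((-1) ^ N) :: complex)"
      by (simp add: i j' power_add)
    moreover have "conj_coeff (r - j) (k + int j) l x - conj_coeff (r - j) k (l - int j) x
      = scale ((-1) ^ i) ((X (Suc j) (Suc N - Suc j) - X j (Suc N - j)) - (X 1 N - X 0 (Suc N)))"
    proof -
      have "r - j = Suc i" "Suc N - Suc j = i" "Suc N - j = Suc i" using N i by auto
      moreover have "k + int j + 1 = k + int (Suc j)" "l - int i - 1 = l - int (Suc i)"
        "l - int j - int i = l - int N" "l - int j - int i - 1 = l - int (Suc N)" using i by auto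
      ultimately show ?thesis
        by (simp only: conj_coeff.simps X_def scale_right_diff_distrib of_nat_1 of_nat_0 add_0_right)
    qed
    ultimately show "scale ((-1) ^ (j - 1)) (conj_coeff (r - j) (k + int j) l x - conj_coeff (r - j) k (l - int j) x)
      = scale (- ((-1) ^ N)) ((X (Suc j) (Suc N - Suc j) - X j (Suc N - j)) - (X 1 N - X 0 (Suc N)))"
      by (simp only: scale_scale)
  qed simp
  also have "\<dots> = scale (- ((-1) ^ N)) ((X (Suc N) 0 - X 1 N) - scale (of_nat N) (X 1 N - X 0 (Suc N)))"
    unfolding scale_sum_right[symmetric] sum_subtractf[of "\<lambda>j. X (Suc j) (Suc N - Suc j) - X j (Suc N - j)"]
    by (subst sum_Suc_diff) (simp_all add: sum_constant_scale)
  finally have "(\<Sum>j=1..r. scale ((-1) ^ (j - 1)) (conj_coeff (r - j) (k + int j) l x - conj_coeff (r - j) k (l - int j) x))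
    = scale (- ((-1) ^ N)) ((X (Suc N) 0 - X 1 N) - scale (of_nat N) (X 1 N - X 0 (Suc N)))
     + scale ((-1) ^ N) (X (Suc N) 0 - X 0 (Suc N))"
    by (simp add: N X_def)
  also have "\<dots> = scale ((-1) ^ N) (scale (of_nat (Suc N)) (X 1 N - X 0 (Suc N)))"
  proof -
    have "scale (- s) (A - B - Z) + scale s (A - C) = scale s ((B - C) + Z)" for s :: complex and A B C Z
    proof -
      have "scale (- s) (A - B - Z) + scale s (A - C) = scale s (- (A - B - Z) + (A - C))"
        by (simp only: scale_right_distrib scale_minus_left scale_minus_right)
      also have "- (A - B - Z) + (A - C) = (B - C) + Z" by (simp add: algebra_simps)
      finally show ?thesis .
    qed
    then show ?thesis by (simp add: scale_left_distrib)
  qed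
  finally show ?thesis unfolding r by (simp only: N scale_scale mult.commute)
qed

text \<open>Both sides satisfy Newton's recursion in \<open>d\<close>: on the right the degree \<open>d\<close> splits into \<open>d - i\<close>, contributed
  by \<open>g_part\<close>, and \<open>i\<close>, contributed by \<open>conj_coeff\<close>.\<close>

lemma g_part_e: "g_part d (e k l w) = (\<Sum>i=0..d. conj_coeff i k l (g_part (d - i) w))"
proof (induction d rule: less_induct)
  case (less d)
  show ?case
  proof (cases "d = 0")
    case False
    define q where "q j = ((-1) ^ (j - 1) :: complex)" for j :: nat
    define \<rho> where "\<rho> i j x = conj_coeff i (k + int j) l x - conj_coeff i k (l - int j) x" for i j x
    have "scale (of_nat d) (g_part d (e k l w)) = (\<Sum>j=1..d. scale (q j) (S (int j) (g_part (d - j) (e k l w))))"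
      unfolding q_def by (rule g_part_newton)
    also have "\<dots> = (\<Sum>j=1..d. scale (q j) (S (int j) (\<Sum>i=0..d - j. conj_coeff i k l (g_part (d - j - i) w))))"
      using less False by (intro sum.cong refl arg_cong[of _ _ "scale _"] arg_cong[of _ _ "S _"]) auto
    also have "\<dots> = (\<Sum>j=1..d. \<Sum>i=0..d - j. scale (q j) (conj_coeff i k l (S (int j) (g_part (d - j - i) w))))
       + (\<Sum>j=1..d. \<Sum>i=0..d - j. scale (q j) (\<rho> i j (g_part (d - (i + j)) w)))"
      by (simp add: S_sum S_conj_coeff scale_sum_right scale_right_distrib sum.distrib \<rho>_def diff_diff_eq add.commute)
    also have "(\<Sum>j=1..d. \<Sum>i=0..d - j. scale (q j) (conj_coeff i k l (S (int j) (g_part (d - j - i) w))))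
       = (\<Sum>i=0..d. conj_coeff i k l (scale (of_nat (d - i)) (g_part (d - i) w)))"
      unfolding sum_swap_triangle g_part_newton q_def[symmetric] conj_coeff_sum
      by (intro sum.cong refl) (simp add: conj_coeff_lin add.commute)
    also have "(\<Sum>j=1..d. \<Sum>i=0..d - j. scale (q j) (\<rho> i j (g_part (d - (i + j)) w)))
       = (\<Sum>r=1..d. \<Sum>j=1..r. scale (q j) (\<rho> (r - j) j (g_part (d - (r - j + j)) w)))"
      by (rule sum_triangle_diagonals)
    also have "\<dots> = (\<Sum>r=1..d. scale (of_nat r) (conj_coeff r k l (g_part (d - r) w)))"
    proof (rule sum.cong)
      fix r assume r: "r \<in> {1..d}"
      have "(\<Sum>j=1..r. scale (q j) (\<rho> (r - j) j (g_part (d - (r - j + j)) w)))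
        = (\<Sum>j=1..r. scale (q j) (\<rho> (r - j) j (g_part (d - r) w)))"
        by (rule sum.cong) auto
      then show "(\<Sum>j=1..r. scale (q j) (\<rho> (r - j) j (g_part (d - (r - j + j)) w)))
        = scale (of_nat r) (conj_coeff r k l (g_part (d - r) w))"
        unfolding q_def \<rho>_def using r conj_coeff_newton[of r] by simp
    qed simp
    also have "\<dots> = (\<Sum>r=0..d. scale (of_nat r) (conj_coeff r k l (g_part (d - r) w)))"
      by (rule sum.mono_neutral_left) (auto simp: not_less_eq_eq)
    also have "(\<Sum>i=0..d. conj_coeff i k l (scale (of_nat (d - i)) (g_part (d - i) w))) + \<dots>
      = scale (of_nat d) (\<Sum>i=0..d. conj_coeff i k l (g_part (d - i) w))"
      unfolding scale_sum_right sum.distrib[symmetric]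
      by (intro sum.cong refl) (simp add: conj_coeff_lin flip: scale_left_distrib of_nat_add)
    finally show ?thesis using False by simp
  qed simp
qed

text \<open>Clearing the denominator \<open>1 + R\<close>.\<close>

lemma g_part_intertwines:
  "g_part (Suc d) (e k l w) + g_part d (e k (l - 1) w) = e k l (g_part (Suc d) w) + e (k + 1) l (g_part d w)"
proof -
  have step: "conj_coeff (Suc i) k l x + conj_coeff i k (l - 1) x = (if i = 0 then e (k + 1) l x else 0)" for i x
    by (cases i) (simp_all add: algebra_simps scale_right_diff_distrib)
  have "g_part (Suc d) (e k l w) = e k l (g_part (Suc d) w) + (\<Sum>i=0..d. conj_coeff (Suc i) k l (g_part (d - i) w))"
    unfolding g_part_e[of "Suc d"] by (subst sum.atLeast0_atMost_Suc_shift) (simp del: conj_coeff.simps(2))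
  moreover have "(\<Sum>i=0..d. conj_coeff (Suc i) k l (g_part (d - i) w)) + (\<Sum>i=0..d. conj_coeff i k (l - 1) (g_part (d - i) w))
    = e (k + 1) l (g_part d w)"
    unfolding sum.distrib[symmetric] step by simp
  ultimately show ?thesis by (simp add: g_part_e[of d] add.assoc del: conj_coeff.simps)
qed

end

context verma_rep
begin

text \<open>The vectors of total degree at most \<open>N\<close>. On them the series for \<open>log g\<close> and \<open>g\<close> are finite sums with a
  common bound.\<close>

definition filt :: "int \<Rightarrow> 'a set" where
  "filt N = span (\<Union>d\<in>{d. tdeg n d \<le> N}. pc d)"

lemma subspace_filt: "subspace (filt N)"
  by (simp add: filt_def)

lemmas filt_closed = subspace_0[OF subspace_filt] subspace_add[OF subspace_filt]
  subspace_scale[OF subspace_filt] subspace_sum[OF subspace_filt] subspace_diff[OF subspace_filt]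

lemma filt_mono:
  assumes "N \<le> N'" "w \<in> filt N"
  shows "w \<in> filt N'"
proof -
  have "(\<Union>d\<in>{d. tdeg n d \<le> N}. pc d) \<subseteq> (\<Union>d\<in>{d. tdeg n d \<le> N'}. pc d)"
    by (rule UN_mono) (use assms(1) in auto)
  from subsetD[OF span_mono[OF this]] show ?thesis using assms(2) by (simp only: filt_def)
qed

lemma filt_negative: "w \<in> filt N \<Longrightarrow> N < 0 \<Longrightarrow> w = 0"
proof -
  assume "w \<in> filt N" "N < 0"
  then have "(\<Union>d\<in>{d. tdeg n d \<le> N}. pc d) \<subseteq> {0}" using pc_negative by auto
  then have "span (\<Union>d\<in>{d. tdeg n d \<le> N}. pc d) \<subseteq> span {0}" by (rule span_mono)
  then show "w = 0" using \<open>w \<in> filt N\<close> by (auto simp: filt_def)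
qed

lemma filt_e: "w \<in> filt N \<Longrightarrow> e i j w \<in> filt (N + j - i)"
  unfolding filt_def[of N]
proof (induction rule: span_induct)
  case base
  show ?case by (auto simp: subspace_def filt_closed)
next
  case (step x)
  then obtain d where d: "tdeg n d \<le> N" "x \<in> pc d" by auto
  have "e i j x \<in> pc (\<lambda>r. d r + edeg n i j r)" using e_pc[OF d(2)] .
  moreover have "tdeg n (\<lambda>r. d r + edeg n i j r) \<le> N + j - i" using d(1) n_pos by simp
  ultimately show ?case unfolding filt_def by (intro span_base) blast
qed

lemma filt_exists: "\<exists>N. w \<in> filt (int N)"
proof (induction w rule: verma_induct)
  case (add w w')
  then obtain N N' where "w \<in> filt (int N)" "w' \<in> filt (int N')" by auto
  then have "w + w' \<in> filt (int (max N N'))"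
    using filt_mono[of "int N" "int (max N N')"] filt_mono[of "int N'" "int (max N N')"] by (intro filt_closed) auto
  then show ?case by blast
next
  case base
  have "v \<in> filt (int 0)" unfolding filt_def using v_pc by (intro span_base) (auto intro!: exI[of _ "\<lambda>_. 0"])
  then show ?case by blast
next
  case (raise i j w)
  then obtain N where "w \<in> filt (int N)" by auto
  then have "e i j w \<in> filt (int N + j - i)" by (rule filt_e)
  moreover have "int N + j - i = int (N + nat (j - i))" using raise by simp
  ultimately show ?case by metis
qed (auto intro: filt_closed)

lemma v_filt: "v \<in> filt 0"
  unfolding filt_def using v_pc by (intro span_base) (auto intro!: exI[of _ "\<lambda>_. 0"])

lemma filt_S: "w \<in> filt N \<Longrightarrow> S t w \<in> filt (N - t)"
  unfolding S_def
proof (rule filt_closed(4))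
  fix i assume "w \<in> filt N"
  then show "e (i + t) i w \<in> filt (N - t)" using filt_e[of w N "i + t" i] by simp
qed

lemma filt_log_power: "w \<in> filt N \<Longrightarrow> log_power k d w \<in> filt (N - int d)"
proof (induction k arbitrary: d)
  case (Suc k)
  have "S (int l) (log_power k (d - l) w) \<in> filt (N - int d)" if "l \<in> {1..d}" for l
    using filt_S[OF Suc.IH[OF Suc.prems], of "int l" "d - l"] that by (simp add: of_nat_diff)
  then show ?case by (auto intro!: filt_closed)
qed (auto simp: filt_closed)

lemma log_g_eq:
  assumes "w \<in> filt (int N)"
  shows "log_g n scale act w = (\<Sum>l=1..N. scale ((-1) ^ (l - 1) / of_nat l) (S (int l) w))"
proof -
  define f where "f = (\<lambda>(i, j). if 1 \<le> i \<and> i \<le> int n \<and> i < j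
     then scale ((-1) ^ nat (j - i - 1) / of_int (j - i)) (e j i w) else 0)"
  define A where "A = {1..int n} \<times> {1..N}"
  define \<pi> where "\<pi> = (\<lambda>(i::int, t). (i, i + int t))"
  have "{x. f x \<noteq> 0} \<subseteq> \<pi> ` A"
  proof
    fix x assume "x \<in> {x. f x \<noteq> 0}"
    then obtain i j where x: "x = (i, j)" "1 \<le> i" "i \<le> int n" "i < j" "e j i w \<noteq> 0"
      by (cases x) (auto simp: f_def split: if_splits)
    have "j - i \<le> int N"
    proof (rule ccontr)
      assume "\<not> j - i \<le> int N"
      then have "e j i w = 0" by (intro filt_negative[OF filt_e[OF assms, of j i]]) simp
      with x(5) show False by simp
    qed
    then show "x \<in> \<pi> ` A"
      using x by (intro image_eqI[of _ _ "(i, nat (j - i))"]) (auto simp: \<pi>_def A_def)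
  qed
  then have "log_g n scale act w = sum f (\<pi> ` A)"
    unfolding log_g_def f_def[symmetric] by (intro Sum_any.expand_superset) (auto simp: A_def)
  also have "\<dots> = (\<Sum>x\<in>A. f (\<pi> x))"
    by (rule sum.reindex_cong[of \<pi>]) (auto simp: inj_on_def \<pi>_def)
  also have "\<dots> = (\<Sum>i=1..int n. \<Sum>l=1..N. f (i, i + int l))"
    unfolding A_def \<pi>_def sum.cartesian_product by (simp add: case_prod_unfold)
  also have "\<dots> = (\<Sum>l=1..N. \<Sum>i=1..int n. f (i, i + int l))" by (rule sum.swap)
  also have "\<dots> = (\<Sum>l=1..N. scale ((-1) ^ (l - 1) / of_nat l) (S (int l) w))"
  proof (rule sum.cong)
    fix l assume l: "l \<in> {1..N}"
    then have "nat (int l - 1) = l - 1" by auto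
    then show "(\<Sum>i=1..int n. f (i, i + int l)) = scale ((-1) ^ (l - 1) / of_nat l) (S (int l) w)"
      unfolding S_def scale_sum_right using l by (intro sum.cong) (auto simp: f_def)
  qed simp
  finally show ?thesis .
qed

lemma log_g_power:
  assumes "w \<in> filt (int N)"
  shows "(log_g n scale act ^^ k) w = (\<Sum>d=0..N. log_power k d w)"
proof (induction k)
  case 0
  have "(\<Sum>d=0..N. log_power 0 d w) = (\<Sum>d=0..N. if d = 0 then w else 0)" by (rule sum.cong) auto
  then show ?case by simp
next
  case (Suc k)
  let ?c = "\<lambda>l. (-1) ^ (l - 1) / of_nat l :: complex"
  have in_fl: "(\<Sum>d=0..N. log_power k d w) \<in> filt (int N)"
    by (intro filt_closed(4) filt_mono[OF _ filt_log_power[OF assms]]) simp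
  have vanish: "S (int l) (log_power k d w) = 0" if "l + d > N" for l d
    by (rule filt_negative[OF filt_S[OF filt_log_power[OF assms]]]) (use that in simp)
  have "(log_g n scale act ^^ Suc k) w = log_g n scale act (\<Sum>d=0..N. log_power k d w)"
    by (simp add: Suc)
  also have "\<dots> = (\<Sum>l=1..N. \<Sum>d=0..N. scale (?c l) (S (int l) (log_power k d w)))"
    unfolding log_g_eq[OF in_fl] by (simp add: S_sum scale_sum_right)
  also have "\<dots> = (\<Sum>l=1..N. \<Sum>d=0..N - l. scale (?c l) (S (int l) (log_power k d w)))"
    by (intro sum.cong sum.mono_neutral_right) (auto simp: vanish)
  also have "\<dots> = (\<Sum>d=1..N. \<Sum>l=1..d. scale (?c l) (S (int l) (log_power k (d - l) w)))"
    by (rule sum_triangle_diagonals)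
  also have "\<dots> = (\<Sum>d=1..N. log_power (Suc k) d w)" by simp
  also have "\<dots> = (\<Sum>d=0..N. log_power (Suc k) d w)"
    by (rule sum.mono_neutral_left) (auto simp: not_less_eq_eq)
  finally show ?case .
qed

lemma g_op_eq:
  assumes "w \<in> filt (int N)"
  shows "g_op n scale act w = (\<Sum>d=0..N. g_part d w)"
proof -
  have "g_op n scale act w = (\<Sum>k=0..N. scale (1 / fact k) (\<Sum>d=0..N. log_power k d w))"
  proof -
    have "{k. scale (1 / fact k) ((log_g n scale act ^^ k) w) \<noteq> 0} \<subseteq> {0..N}"
    proof
      fix k assume "k \<in> {k. scale (1 / fact k) ((log_g n scale act ^^ k) w) \<noteq> 0}"
      then have "(\<Sum>d=0..N. log_power k d w) \<noteq> 0" using log_g_power[OF assms] by auto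
      then obtain d where "d \<in> {0..N}" "log_power k d w \<noteq> 0" by (rule sum.not_neutral_contains_not_neutral)
      then show "k \<in> {0..N}" using log_power_big[of d k w] by (meson atLeastAtMost_iff le0 leI order_trans)
    qed
    then show ?thesis
      unfolding g_op_def by (subst Sum_any.expand_superset[of "{0..N}"]) (auto simp: log_g_power[OF assms])
  qed
  also have "\<dots> = (\<Sum>d=0..N. \<Sum>k=0..N. scale (1 / fact k) (log_power k d w))"
    unfolding scale_sum_right by (rule sum.swap)
  also have "\<dots> = (\<Sum>d=0..N. g_part d w)"
    unfolding g_part_def by (intro sum.cong sum.mono_neutral_right) (auto simp: log_power_big)
  finally show ?thesis .
qed

lemma g_op_lin:
  "g_op n scale act (w + w') = g_op n scale act w + g_op n scale act w'"
  "g_op n scale act (scale c w) = scale c (g_op n scale act w)"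
proof -
  obtain N N' where N: "w \<in> filt (int N)" "w' \<in> filt (int N')" using filt_exists by meson
  then have M: "w \<in> filt (int (max N N'))" "w' \<in> filt (int (max N N'))" by (auto elim: filt_mono[rotated])
  then show "g_op n scale act (w + w') = g_op n scale act w + g_op n scale act w'"
    using g_op_eq[OF M(1)] g_op_eq[OF M(2)] g_op_eq[OF filt_closed(2)[OF M]] by (simp add: g_part_lin sum.distrib)
  show "g_op n scale act (scale c w) = scale c (g_op n scale act w)"
    using g_op_eq[OF N(1)] g_op_eq[OF filt_closed(3)[OF N(1)]] by (simp add: g_part_lin scale_sum_right)
qed

lemma g_op_v: "g_op n scale act v = v"
  using g_op_eq[of v 0] v_filt by simp

theorem g_op_intertwines:
  "g_op n scale act (e k l w + e k (l - 1) w) = e k l (g_op n scale act w) + e (k + 1) l (g_op n scale act w)"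
proof -
  obtain N1 where N1: "w \<in> filt (int N1)" using filt_exists by meson
  \<comment> \<open>One more than a bound for all vectors involved: the second sum below ends one step earlier than the first.\<close>
  define N where "N = N1 + nat \<bar>l - k\<bar> + 1"
  have w: "w \<in> filt (int N)" "w \<in> filt (int (Suc N))"
    by (rule filt_mono[OF _ N1], simp add: N_def)+
  have e1: "e k l w \<in> filt (int (Suc N))" by (rule filt_mono[OF _ filt_e[OF N1]]) (simp add: N_def)
  have e2: "e k (l - 1) w \<in> filt (int N)" by (rule filt_mono[OF _ filt_e[OF N1]]) (simp add: N_def)
  have split: "(\<Sum>d=0..Suc N. f d) = f 0 + (\<Sum>d=0..N. f (Suc d))" for f :: "nat \<Rightarrow> 'a"
    by (subst sum.atLeast0_atMost_Suc_shift) simp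
  have "g_op n scale act (e k l w + e k (l - 1) w)
      = e k l w + ((\<Sum>d=0..N. g_part (Suc d) (e k l w)) + (\<Sum>d=0..N. g_part d (e k (l - 1) w)))"
    unfolding g_op_lin g_op_eq[OF e1] g_op_eq[OF e2] split by simp
  also have "\<dots> = e k l w + ((\<Sum>d=0..N. e k l (g_part (Suc d) w)) + (\<Sum>d=0..N. e (k + 1) l (g_part d w)))"
    unfolding sum.distrib[symmetric] g_part_intertwines ..
  also have "\<dots> = e k l (g_op n scale act w) + e (k + 1) l (\<Sum>d=0..N. g_part d w)"
    unfolding g_op_eq[OF w(2)] split by (simp add: e_sum)
  finally show ?thesis using g_op_eq[OF w(1)] by simp
qed

end

section \<open>The operator \<open>A\<close>\<close>

text \<open>At most one of two consecutive integers is divisible by \<open>n\<close>, because \<open>n \<ge> 2\<close>.\<close>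

lemma alpha_eq:
  assumes "n \<ge> 2"
  shows "alpha n p k = char_coeff n p k + char_coeff n p (k + 1)"
proof -
  have not_both: "\<not> (int n dvd k \<and> int n dvd k + 1)"
  proof
    assume "int n dvd k \<and> int n dvd k + 1"
    then have "int n dvd 1" using dvd_diff[of "int n" "k + 1" k] by simp
    then show False using assms by simp
  qed
  consider "k = 0" | "k = -1" | "k > 0" | "k < -1" by linarith
  then show ?thesis
    by cases (use not_both in \<open>auto simp: alpha_def char_coeff_def\<close>)
qed

context affgl_rep
begin

definition evaluation :: "(exps \<Rightarrow>\<^sub>0 'a) \<Rightarrow> 'a" where
  "evaluation G = (\<Sum>b\<in>keys G. lookup G b)"

lemma evaluation_add: "evaluation (G + H) = evaluation G + evaluation H"
proof -
  let ?A = "keys G \<union> keys H"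
  have sup: "evaluation K = (\<Sum>b\<in>?A. lookup K b)" if "keys K \<subseteq> ?A" for K
    unfolding evaluation_def by (rule sum.mono_neutral_left) (use that in \<open>auto simp: in_keys_iff\<close>)
  have "keys (G + H) \<subseteq> ?A" by (rule Poly_Mapping.keys_add)
  then show ?thesis by (simp add: sup lookup_add sum.distrib)
qed

lemma evaluation_single [simp]: "evaluation (single b w) = w"
  by (cases "w = 0") (simp_all add: evaluation_def)

lemma evaluation_zero [simp]: "evaluation 0 = 0"
  by (simp add: evaluation_def)

lemma evaluation_diff: "evaluation (G - H) = evaluation G - evaluation H"
  using evaluation_add[of "G - H" H] by simp

lemma evaluation_scale: "evaluation (tens_scale scale c G) = scale c (evaluation G)"
  by (rule additive_ext[where G = G]) (simp_all add: evaluation_add tens_scale_add scale_right_distrib)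

lemma evaluation_map:
  assumes "X \<in> affgl n"
  shows "evaluation (Poly_Mapping.map (act X) G) = act X (evaluation G)"
  by (rule additive_ext[where G = G]) (simp_all add: evaluation_add map_act_add map_act_single act_lin assms)

lemma id_tens_ev_eq: "id_tens_ev scale F d = evaluation (F d)"
  by (simp add: id_tens_ev_def evaluation_def ev_def)

text \<open>The operators \<open>y\<^sub>i \<partial>\<^sub>j\<close> and \<open>y\<^sub>i\<^sub>+\<^sub>1 \<partial>\<^sub>j\<close> agree after evaluation at \<open>y = 1\<close> and occur with opposite signs.\<close>

lemma evaluation_V_part:
  assumes "n \<ge> 2"
  shows "evaluation (V_part p m (E n i j) G) + evaluation (V_part p m (E n (i + 1) j) G)
    = scale (- (alpha n p (i - j) * m)) (evaluation G)"
proof (rule additive_ext[where G = G])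
  fix b w
  have sgn: "(-1 :: complex) powi (i + 1 - j) = - ((-1) powi (i - j))"
    using power_int_add[of "-1 :: complex" "i - j" 1] by (simp add: algebra_simps)
  have chars: "char_coeff n p (i - j) * m + char_coeff n p (i + 1 - j) * m = alpha n p (i - j) * m"
    by (simp add: alpha_eq[OF assms] algebra_simps)
  show "evaluation (V_part p m (E n i j) (single b w)) + evaluation (V_part p m (E n (i + 1) j) (single b w))
    = scale (- (alpha n p (i - j) * m)) (evaluation (single b w))"
  proof -
    have "(scale (s * x) w - scale (m * y) w) + (scale (- s * x) w - scale (m * z) w) = scale (- (y * m + z * m)) w" for s x y z
      by (simp add: mult.commute scale_left_distrib scale_left_diff_distrib)
    then show ?thesis
      unfolding V_part_E_single evaluation_diff evaluation_single sgn chars[symmetric] .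
  qed
qed (simp_all add: evaluation_add scale_right_distrib)

end

context verma_pair
begin

lemma A_op_factors:
  assumes n: "n \<ge> 2" and \<Phi>: "intertwiner \<Phi>" "\<Phi> v' = singular"
  shows "A_op (\<lambda>w. id_tens_ev scale (\<Phi> (g_op n scale' act' w)))"
    (is "A_op ?A")
proof -
  let ?g = "g_op n scale' act'"
  have A: "?A w d = M.evaluation (\<Phi> (?g w) d)" for w d by (simp add: M.id_tens_ev_eq)
  have l: "Vector_Spaces.linear scale' (tens_scale scale) (\<lambda>w. \<Phi> w d)" for d
    using \<Phi>(1) by (simp add: is_intertwiner_def)
  interpret l: Vector_Spaces.linear scale' "tens_scale scale" "\<lambda>w. \<Phi> w d" for d by (rule l)
  have add: "?A (w + w') d = ?A w d + ?A w' d" for w w' d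
    unfolding A unfolding M'.g_op_lin l.add M.evaluation_add ..
  have sc: "?A (scale' c w) d = scale c (?A w d)" for c w d
    unfolding A unfolding M'.g_op_lin l.scale M.evaluation_scale ..
  have "Vector_Spaces.linear scale' scale (\<lambda>w. ?A w d)" for d
    by (intro Vector_Spaces.linear.intro module_hom.intro module_hom_axioms.intro
      M'.vector_space_axioms M.vector_space_axioms M'.module_axioms M.module_axioms add sc)
  moreover have "?A w \<in> completion n scale act v" for w
  proof -
    have "\<Phi> (?g w) \<in> tens_completion n scale act v" using \<Phi>(1) by (simp add: is_intertwiner_def)
    then have "M.evaluation (\<Phi> (?g w) d) \<in> M.pc d" for d
      unfolding M.evaluation_def tens_completion_iff by (intro M.pc_closed(4)) simp
    then show ?thesis by (simp add: completion_def A)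
  qed
  moreover have "?A v' (\<lambda>_. 0) = v" unfolding A unfolding M'.g_op_v \<Phi>(2) singular_0 by simp
  moreover have "hat_act n act (E n i j) (?A w) d + hat_act n act (E n (i + 1) j) (?A w) d
        = ?A (M'.e i j w + M'.e i (j - 1) w + scale' (alpha n p (i - j) * m) w) d" for i j w d
  proof -
    let ?\<alpha> = "alpha n p (i - j) * m"
    have T: "M.evaluation (T (E n k j) (\<Phi> (?g w)) d) = hat_act n act (E n k j) (?A w) d + M.evaluation (M.V_part p m (E n k j) (\<Phi> (?g w) d))" for k
      by (simp add: M.tens_act_E M.evaluation_add M.evaluation_map A)
    have "?A (M'.e i j w + M'.e i (j - 1) w) d
        = M.evaluation (\<Phi> (M'.e i j (?g w)) d) + M.evaluation (\<Phi> (M'.e (i + 1) j (?g w)) d)"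
      unfolding A unfolding M'.g_op_intertwines l.add M.evaluation_add ..
    also have "\<dots> = M.evaluation (T (E n i j) (\<Phi> (?g w)) d) + M.evaluation (T (E n (i + 1) j) (\<Phi> (?g w)) d)"
      using \<Phi>(1) by (simp add: is_intertwiner_def)
    also have "\<dots> = hat_act n act (E n i j) (?A w) d + hat_act n act (E n (i + 1) j) (?A w) d + scale (- ?\<alpha>) (?A w d)"
    proof -
      have "x + y + (z + u) = x + z + (y + u)" for x y z u :: 'a by simp
      then show ?thesis unfolding T A M.evaluation_V_part[OF n, symmetric] .
    qed
    finally show ?thesis unfolding add[of _ "scale' ?\<alpha> w"] sc by simp
  qed
  ultimately show ?thesis unfolding is_A_op_def by blast
qed

text \<open>The relations for \<open>i \<ge> j\<close>, applied to the generator, express every lowered vector of the difference in degree \<open>d\<close> through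
  its parts in smaller degrees; so the difference vanishes on the generator because there are no singular vectors. Its
  kernel is then stable under all \<open>E n i j\<close>: modulo the kernel \<open>E n i j w\<close> is \<open>-E n i (j - 1) w\<close>, and on
  lowering \<open>j\<close> further the vector becomes zero.\<close>

lemma A_op_unique:
  assumes A: "A_op A" and B: "A_op B"
  shows "A = B"
proof -
  have lA: "Vector_Spaces.linear scale' scale (\<lambda>w. A w d)" and lB: "Vector_Spaces.linear scale' scale (\<lambda>w. B w d)" for d
    using A B by (simp_all add: is_A_op_def)
  interpret lA: Vector_Spaces.linear scale' scale "\<lambda>w. A w d" for d by (rule lA)
  interpret lB: Vector_Spaces.linear scale' scale "\<lambda>w. B w d" for d by (rule lB)
  define D where "D w d = A w d - B w d" for w d
  have D_lin: "D (w + w') d = D w d + D w' d" "D (scale' c w) d = scale c (D w d)" "D 0 d = 0" for w w' c d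
    by (simp_all add: D_def lA.add lB.add lA.scale lB.scale lA.zero lB.zero M.scale_right_diff_distrib)
  have D_pc: "D w d \<in> M.pc d" for w d
  proof -
    have "C w d \<in> M.pc d" if "A_op C" for C
      using that unfolding is_A_op_def completion_def by blast
    then show ?thesis unfolding D_def using A B by (intro M.pc_closed(5))
  qed
  have D0: "D v' (\<lambda>_. 0) = 0" using A B by (simp add: D_def is_A_op_def)
  have D_rel: "M.e i j (D w (\<lambda>r. d r - edeg n i j r)) + M.e (i + 1) j (D w (\<lambda>r. d r - edeg n (i + 1) j r))
      = D (M'.e i j w + M'.e i (j - 1) w + scale' (alpha n p (i - j) * m) w) d" for i j w d
  proof -
    have "M.e i j (C w (\<lambda>r. d r - edeg n i j r)) + M.e (i + 1) j (C w (\<lambda>r. d r - edeg n (i + 1) j r))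
      = C (M'.e i j w + M'.e i (j - 1) w + scale' (alpha n p (i - j) * m) w) d"
      if "A_op C" for C
      using that unfolding is_A_op_def by (simp add: M.hat_act_E)
    from this[OF A, symmetric] this[OF B, symmetric] show ?thesis
      unfolding D_def M.e_lin(5) by (simp only:) (simp add: algebra_simps)
  qed
  have Dv: "D v' d = 0" for d
  proof (induction "nat (tdeg n d)" arbitrary: d rule: less_induct)
    case less
    consider "d = (\<lambda>_. 0)" | "D v' d = 0" | "tdeg n d > 0" "d \<noteq> (\<lambda>_. 0)"
      using M.pc_bounded(1)[OF D_pc[of v' d]] by blast
    then show ?case
    proof cases
      case 3
      have "M.e k l (D v' d) = 0" if kl: "k > l" for k l
      proof -
        let ?d = "\<lambda>r. d r + edeg n k l r"
        have IH: "D v' d' = 0" if "tdeg n d' < tdeg n d" for d' using less[of d'] 3 that by auto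
        \<comment> \<open>In the relation for the indices \<open>k - 1, l\<close> the other summand on the left has smaller degree.\<close>
        obtain c where c: "M'.e (k - 1) l v' = scale' c v'"
        proof (cases "k - 1 = l")
          case True
          then have "M'.e (k - 1) l v' = scale' (M'.shifted_a l - of_int l) v'" using M'.e_diag_v[of l] by simp
          then show ?thesis by (rule that)
        next
          case False
          then have "M'.e (k - 1) l v' = scale' 0 v'" using M'.lower[of l "k - 1"] kl by simp
          then show ?thesis by (rule that)
        qed
        have "M'.e (k - 1) (l - 1) v' = 0" using M'.lower[of "l - 1" "k - 1"] kl by simp
        moreover have "D v' ?d = 0" by (rule IH) (use kl n_pos in simp)
        moreover have "D v' (\<lambda>r. ?d r - edeg n (k - 1) l r) = 0" by (rule IH) (use n_pos in simp)
        ultimately show ?thesis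
          using D_rel[of "k - 1" l v' ?d] c by (simp add: D_lin)
      qed
      then show ?thesis using M.no_singular[OF D_pc 3(2)] by blast
    qed (use D0 in auto)
  qed
  define K where "K = {w. \<forall>d. D w d = 0}"
  have "w \<in> K" for w
  proof (rule M'.generated)
    show K: "M'.subspace K" by (auto simp: M'.subspace_def K_def D_lin)
    show "v' \<in> K" using Dv by (simp add: K_def)
    fix i j w assume w: "w \<in> K"
    have step: "M'.e i j w \<in> K" if "M'.e i (j - 1) w \<in> K" for j
    proof -
      have "D (M'.e i j w) d = 0" for d
        using D_rel[of i j w d] w that by (simp add: K_def D_lin)
      then show ?thesis by (simp add: K_def)
    qed
    obtain N where N: "w \<in> M'.filt (int N)" using M'.filt_exists by blast
    have "M'.e i (i - int N - 1) w = 0"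
      by (rule M'.filt_negative[OF M'.filt_e[OF N]]) simp
    then have start: "M'.e i (i - int N - 1) w \<in> K" by (simp add: K_def D_lin)
    have up: "M'.e i (i - int N - 1 + int t) w \<in> K" for t
    proof (induction t)
      case (Suc t)
      have "M'.e i (i - int N - 1 + int (Suc t) - 1) w \<in> K" using Suc by (simp add: algebra_simps)
      then show ?case by (rule step)
    qed (use start in simp)
    show "M'.e i j w \<in> K"
    proof (cases "j \<ge> i - int N - 1")
      case True
      then show ?thesis using up[of "nat (j - (i - int N - 1))"] by simp
    next
      case False
      then have "M'.e i j w = 0" by (intro M'.filt_negative[OF M'.filt_e[OF N, of i j]]) simp
      then show ?thesis by (simp add: K_def D_lin)
    qed
  qed
  then show ?thesis by (auto simp: K_def D_def fun_eq_iff)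
qed

end

theorem theorem3p30:
  fixes n :: nat and p m :: complex and a a' :: "nat \<Rightarrow> complex"
    and scale :: "complex \<Rightarrow> 'a::ab_group_add \<Rightarrow> 'a" and act :: "affgl \<Rightarrow> 'a \<Rightarrow> 'a" and v :: 'a
    and scale' :: "complex \<Rightarrow> 'b::ab_group_add \<Rightarrow> 'b" and act' :: "affgl \<Rightarrow> 'b \<Rightarrow> 'b" and v' :: 'b
  assumes "n \<ge> 2"
    and "generic n a p" and "generic n a' p"
    and "verma scale n act v a p" and "verma scale' n act' v' a' p"
  shows "(\<exists>!A. is_A_op n p m scale' act' v' scale act v A) \<and>
    (\<exists>\<Phi>. is_intertwiner n p m scale' act' scale act v \<Phi> \<and>
      normalized n m a' v' a v \<Phi> \<and>
      (\<forall>\<Psi>. is_intertwiner n p m scale' act' scale act v \<Psi> \<longrightarrow>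
         (\<exists>c. \<Psi> = (\<lambda>w d. tens_scale scale c (\<Phi> w d)))) \<and>
      (\<forall>A. is_A_op n p m scale' act' v' scale act v A \<longrightarrow>
         A = (\<lambda>w. id_tens_ev scale (\<Phi> (g_op n scale' act' w)))))"
proof -
  interpret M: verma scale n act v a p by fact
  interpret M': verma scale' n act' v' a' p by fact
  interpret verma_pair scale n act v a p scale' act' v' a' m
    using assms(1,2) by unfold_locales auto
  obtain \<Phi> where \<Phi>: "is_intertwiner n p m scale' act' scale act v \<Phi>" "\<Phi> v' = singular"
    using intertwiner_exists by blast
  have A: "is_A_op n p m scale' act' v' scale act v (\<lambda>w. id_tens_ev scale (\<Phi> (g_op n scale' act' w)))"
    using A_op_factors[OF assms(1) \<Phi>] .
  show ?thesis
  proof (intro conjI exI[of _ \<Phi>] allI impI)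
    show "\<exists>!A. is_A_op n p m scale' act' v' scale act v A"
      using A A_op_unique by blast
    show "is_intertwiner n p m scale' act' scale act v \<Phi>" by (rule \<Phi>(1))
    show "normalized n m a' v' a v \<Phi>" by (rule intertwiner_normalized[of \<Phi>, OF \<Phi>(2)])
    show "\<exists>c. \<Psi> = (\<lambda>w d. tens_scale scale c (\<Phi> w d))" if "is_intertwiner n p m scale' act' scale act v \<Psi>" for \<Psi>
      using intertwiner_unique[OF \<Phi> that] .
    show "A = (\<lambda>w. id_tens_ev scale (\<Phi> (g_op n scale' act' w)))" if "is_A_op n p m scale' act' v' scale act v A" for A
      using A_op_unique[OF that A] .
  qed
qed

end
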